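(* For every nonnegative integer $n$, $$\sum_{m=1}^{5} m\left[M_{\omega}(m,11,11n+6)-M_{\omega}(11-m,11,11n+6)\right]=0.$$
   Context: For a partition $\pi$ let $\omega(\pi)$ denote the number of ones in $\pi$. The crank of $\pi$ is the largest part of $\pi$ if $\omega(\pi)=0$; otherwise it is (the number of parts of $\pi$ larger than $\omega(\pi)$) minus $\omega(\pi)$. For integers $r$, $m\ge 1$, $n\ge 0$, $$M_{\omega}(r,m,n)=\sum_{\substack{\pi\vdash n\\ \mathrm{crank}(\pi)\equiv r \pmod m}}\omega(\pi)$$ is the total number of ones in the partitions of $n$ with crank congruent to $r$ modulo $m$. *)

theory Defs
  imports "HOL-Library.Multiset" "HOL-Number_Theory.Cong"
begin

definition partitions :: "nat \<Rightarrow> nat multiset set" where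
  "partitions n = {p. (\<forall>k\<in>#p. k > 0) \<and> sum_mset p = n}"

text \<open>Finiteness ensures that sums over \<open>partitions n\<close> are not trivially zero.\<close>

lemma finite_partitions: "finite (partitions n)"
proof -
  have "partitions n \<subseteq> mset ` {xs. set xs \<subseteq> {0..n} \<and> length xs \<le> n}"
  proof
    fix p assume p: "p \<in> partitions n"
    obtain xs where xs: "p = mset xs"
      by (metis ex_mset)
    have pos: "\<forall>k\<in>set xs. k > 0" and sum: "sum_list xs = n"
      using p by (auto simp: partitions_def xs sum_mset_sum_list)
    have "length xs \<le> sum_list xs"
      using pos by (induction xs) (auto simp: Suc_le_eq)
    moreover have "set xs \<subseteq> {0..n}"
      using sum member_le_sum_list[of _ xs] by auto
    ultimately show "p \<in> mset ` {xs. set xs \<subseteq> {0..n} \<and> length xs \<le> n}"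
      using sum xs by auto
  qed
  then show ?thesis
    by (rule finite_subset) (simp add: finite_lists_length_le)
qed

definition num_ones :: "nat multiset \<Rightarrow> nat" where
  "num_ones p = count p 1"

text \<open>The empty partition has no largest part; its crank is set to 0. This choice is irrelevant
  for the weighted counts below, since the empty partition contains no ones.\<close>

definition crank :: "nat multiset \<Rightarrow> int" where
  "crank p =
     (if p = {#} then 0
      else if num_ones p = 0 then int (Max (set_mset p))
      else int (size {#k \<in># p. k > num_ones p#}) - int (num_ones p))"

definition M_omega :: "int \<Rightarrow> nat \<Rightarrow> nat \<Rightarrow> nat" where
  "M_omega r m n = (\<Sum>p | p \<in> partitions n \<and> [crank p = r] (mod int m). num_ones p)"

end

theory Submission
  imports Defs "HOL-Complex_Analysis.Complex_Analysis"
begin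

text \<open>
Weighting a partition by its number of ones and by the residue of its crank in \<open>{-5..5}\<close> modulo 11, the claim
says that \<open>S(q) = \<Sum> s\<^sub>n q\<^sup>n\<close> has \<open>s\<^sub>n = 0\<close> for \<open>n \<equiv> 6\<close>. The \<open>q\<close>-binomial theorem sums the ones against
\<open>z\<close> to the crank, and a finite Fourier transform over the eleventh roots of unity \<open>\<omega>\<^sup>k\<close> writes \<open>S\<close> as a combination of
\<open>(q;q)\<^sup>2 / \<theta>(\<omega>\<^sup>k)\<close> times a Lambert series that is the logarithmic derivative of \<open>\<theta>\<close> at \<open>\<omega>\<^sup>k\<close>.
The product of \<open>\<theta>(\<omega>\<^sup>j\<^sup>k)\<close> over \<open>j = 1, \<dots>, 5\<close> is a multiple of \<open>(q\<^sup>1\<^sup>1;q\<^sup>1\<^sup>1) (q;q)\<^sup>4\<close>, so multiplying \<open>S\<close> by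
\<open>(q\<^sup>1\<^sup>1;q\<^sup>1\<^sup>1)\<close>, which does not affect the claim, turns \<open>1 / \<theta>(\<omega>\<^sup>k)\<close> into a product of four theta values.
This is Winquist's product at \<open>(\<omega>\<^sup>5\<^sup>k, \<omega>\<^sup>2\<^sup>k)\<close>, and the addition formula for the logarithmic
derivatives of \<open>\<theta>\<close> replaces the Lambert series by those occurring in the two partial derivatives of that product, at
the cost of three products \<open>(q;q) \<theta>(\<omega>\<^sup>a\<^sup>k) \<theta>(\<omega>\<^sup>b\<^sup>k) \<theta>(\<omega>\<^sup>c\<^sup>k)\<close>.

By Winquist's identity the product and its derivatives are binary theta series for \<open>9 x\<^sup>2 + y\<^sup>2\<close>; since \<open>-1\<close> is not a
square modulo 11, the exponents \<open>\<equiv> 6\<close> only receive pairs with \<open>11 dvd x, y\<close>, which cancel in pairs.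
In the remaining three products a Gauss sum over \<open>k\<close> leaves a sum of quadratic characters over
\<open>w\<^sup>2 + 3 (x\<^sup>2 + y\<^sup>2 + z\<^sup>2) = M\<close> with \<open>11 dvd M\<close>. It vanishes because the form has, besides the permutations
and sign changes of \<open>x, y, z\<close>, the symmetry \<open>(w, x) \<mapsto> ((-w - 3 x) / 2, (x - w) / 2)\<close>: the average
of the summand over these symmetries depends only on residues modulo 11 and is zero by a finite check.
\<close>

subsection \<open>Sums over multisets\<close>

text \<open>The representatives -5..5 matter: up to scaling, their Fourier coefficients are -1 / (u
  - 1/u) with u an eleventh root of unity. For z = u^2 this u - 1/u is the factor that turns the
  denominator of the crank generating function into theta, so no elementary factor is left over. The
  obstacle is the Lambert series, essentially the logarithmic derivative Z(k) of theta. Winquist's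
  product at (5 k, 2 k) has two logarithmic derivatives, both combinations of Z(2 k), ..., Z(5 k);
  one special case of the addition formula, used at k, 3 k and 5 k, gives three further relations.
  Z(k) is a linear combination of these five, and its coefficients are the origin of the constants
  2, 2, 3 in \<open>T3\<close> and of 2 and 3/2 in front of \<open>W1\<close> and \<open>W2\<close>.
  The product of u^j - u^(-j) over j = 1, ..., 5 changes with k by the Legendre symbol; this is how
  the quadratic character and the Gauss sum enter. The class 6 is singled out because both quadratic
  forms take the value 24 n + 10 at exponent n, which is divisible by 11 exactly for n congruent to
  6.\<close>

lemma has_sum_dominated:
  fixes f :: "'a \<Rightarrow> complex" and h :: "'a \<Rightarrow> real"
  assumes h: "h summable_on A"
    and bound: "\<And>N x. x \<in> A \<Longrightarrow> norm (F N x) \<le> h x"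
    and lim: "\<And>x. x \<in> A \<Longrightarrow> (\<lambda>N::nat. F N x) \<longlonglongrightarrow> f x"
  shows "(\<lambda>N. infsum (F N) A) \<longlonglongrightarrow> infsum f A" and "f summable_on A"
proof -
  have lb: "norm (f x) \<le> h x" if "x \<in> A" for x
    using lim[OF that] bound[OF that] by (intro LIMSEQ_le_const2[OF tendsto_norm]) auto
  have sF: "(\<lambda>x. norm (F N x)) summable_on A" for N
    using Infinite_Sum.abs_summable_on_comparison_test'[OF h] bound by blast
  have sf: "(\<lambda>x. norm (f x)) summable_on A"
    using Infinite_Sum.abs_summable_on_comparison_test'[OF h] lb by blast
  show "f summable_on A" using sf by (rule abs_summable_summable)
  have sh: "Infinite_Set_Sum.abs_summable_on h A"
    using h summable_on_iff_abs_summable_on_real[of h A] abs_summable_equivalent[of h A] by blast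
  \<comment> \<open>Over the counting measure an absolutely convergent sum is a Lebesgue integral,
    so dominated convergence for integrals applies.\<close>
  have "(\<lambda>N. infsetsum (F N) A) \<longlonglongrightarrow> infsetsum f A"
    unfolding infsetsum_def
  proof (rule integral_dominated_convergence)
    show "integrable (count_space A) h"
      using sh by (simp add: Infinite_Set_Sum.abs_summable_on_def)
  qed (use lim bound in \<open>auto simp: AE_count_space\<close>)
  moreover have "infsetsum (F N) A = infsum (F N) A" for N
    using sF[of N] by (intro infsetsum_infsum) (simp add: abs_summable_equivalent)
  moreover have "infsetsum f A = infsum f A"
    using sf by (intro infsetsum_infsum) (simp add: abs_summable_equivalent)
  ultimately show "(\<lambda>N. infsum (F N) A) \<longlonglongrightarrow> infsum f A" by simp
qed

lemma has_sum_by_degree: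
  fixes c :: "'a \<Rightarrow> complex"
  assumes "((\<lambda>v. c v * q ^ e v) has_sum S) A" and fin: "\<And>n. finite {v \<in> A. e v = n}"
  shows "((\<lambda>n. (\<Sum>v | v \<in> A \<and> e v = n. c v) * q ^ n) has_sum S) UNIV"
proof (rule has_sum_Sigma'[where B = "\<lambda>n. {v \<in> A. e v = n}"])
  have "bij_betw snd (SIGMA n:UNIV. {v \<in> A. e v = n}) A"
    by (rule bij_betwI[where g = "\<lambda>v. (e v, v)"]) auto
  from has_sum_reindex_bij_betw[OF this, of "\<lambda>v. c v * q ^ e v" S] assms(1)
  show "((\<lambda>(n, v). c v * q ^ e v) has_sum S) (SIGMA n:UNIV. {v \<in> A. e v = n})"
    by (simp add: case_prod_unfold)
  show "((\<lambda>y. case (n, y) of (n, v) \<Rightarrow> c v * q ^ e v) has_sum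
          (\<Sum>v | v \<in> A \<and> e v = n. c v) * q ^ n) {v \<in> A. e v = n}" for n
    by (rule has_sum_finiteI) (auto simp: fin sum_distrib_right intro!: sum.cong)
qed

text \<open>Summable complex families are absolutely summable. This yields joint summability on the
  rectangle, which the iterated sums alone would not provide.\<close>

lemma has_sum_mult_product:
  fixes f :: "'a \<Rightarrow> complex" and g :: "'b \<Rightarrow> complex"
  assumes "(f has_sum S) A" "(g has_sum T) B"
  shows "((\<lambda>(x, y). f x * g y) has_sum (S * T)) (A \<times> B)"
proof (rule has_sum_SigmaI)
  show "((\<lambda>y. case (x, y) of (x, y) \<Rightarrow> f x * g y) has_sum (f x * T)) B" if "x \<in> A" for x
    using has_sum_cmult_right[OF assms(2)] by simp
  show "((\<lambda>x. f x * T) has_sum (S * T)) A"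
    using has_sum_cmult_left[OF assms(1)] by simp
  have f: "(\<lambda>x. norm (f x)) summable_on A" and g: "(\<lambda>x. norm (g x)) summable_on B"
    using assms has_sum_imp_summable summable_on_iff_abs_summable_on_complex by blast+
  show "(\<lambda>(x, y). f x * g y) summable_on A \<times> B"
  proof (rule abs_summable_summable, subst Infinite_Sum.abs_summable_on_Sigma_iff, intro conjI ballI)
    fix x
    show "(\<lambda>y. norm (case (x, y) of (x, y) \<Rightarrow> f x * g y)) summable_on B"
      using summable_on_cmult_right[OF g] by (simp add: norm_mult)
    have "(\<Sum>\<^sub>\<infinity>y\<in>B. norm (case (x, y) of (x, y) \<Rightarrow> f x * g y)) = norm (f x) * infsum (\<lambda>y. norm (g y)) B" for x
      by (simp add: norm_mult infsum_cmult_right')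
    then show "(\<lambda>x. norm (\<Sum>\<^sub>\<infinity>y\<in>B. norm (case (x, y) of (x, y) \<Rightarrow> f x * g y))) summable_on A"
      using summable_on_cmult_left[OF f] by (simp add: norm_mult infsum_nonneg)
  qed
qed

text \<open>Euler's product for finitely many parts: a multiset over \<open>insert a J\<close> is a
  multiplicity of \<open>a\<close>, summed by a geometric series, together with a multiset over
  \<open>J\<close>.\<close>

lemma has_sum_multisets_finite:
  fixes x :: "'a \<Rightarrow> complex"
  assumes "finite J" "\<And>j. j \<in> J \<Longrightarrow> norm (x j) < 1"
  shows "((\<lambda>\<rho>. \<Prod>j\<in>#\<rho>. x j) has_sum (\<Prod>j\<in>J. 1 / (1 - x j))) {\<rho>. set_mset \<rho> \<subseteq> J}"
  using assms
proof (induction J rule: finite_induct)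
  case empty
  have "{\<rho>. set_mset \<rho> \<subseteq> ({} :: 'a set)} = {{#}}" by auto
  then show ?case by (auto intro: has_sum_finiteI)
next
  case (insert a J)
  have "((\<lambda>k::nat. x a ^ k) has_sum (1 / (1 - x a))) UNIV"
    using insert.prems
    by (intro norm_summable_imp_has_sum geometric_sums) (auto simp: norm_power intro!: summable_geometric)
  with insert have *: "((\<lambda>(k, \<rho>). x a ^ k * (\<Prod>j\<in>#\<rho>. x j)) has_sum (1 / (1 - x a) * (\<Prod>j\<in>J. 1 / (1 - x j))))
      (UNIV \<times> {\<rho>. set_mset \<rho> \<subseteq> J})"
    by (intro has_sum_mult_product) auto
  have "((\<lambda>\<rho>. \<Prod>j\<in>#\<rho>. x j) has_sum (1 / (1 - x a) * (\<Prod>j\<in>J. 1 / (1 - x j)))) {\<rho>. set_mset \<rho> \<subseteq> insert a J}"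
  proof (rule iffD1[OF has_sum_reindex_bij_witness[where
        i = "\<lambda>\<rho>. (count \<rho> a, filter_mset (\<lambda>j. j \<noteq> a) \<rho>)"
        and j = "\<lambda>(k, \<rho>). replicate_mset k a + \<rho>"] *], goal_cases)
    case (1 p)
    then show ?case using insert.hyps
      by (auto simp: count_eq_zero_iff intro!: multiset_eqI)
  next
    case (3 b)
    have "{#j \<in># b. j = a#} = replicate_mset (count b a) a"
      by (metis filter_eq_replicate_mset)
    then show ?case by (auto simp: multiset_partition[symmetric] multiset_eq_iff)
  qed (auto split: if_splits)
  then show ?case using insert.hyps by simp
qed

text \<open>Parts \<open>j\<close> with \<open>x j = 0\<close> are effectively forbidden.\<close>

lemma has_sum_multisets:
  fixes x :: "nat \<Rightarrow> complex"
  assumes x: "\<And>j. norm (x j) < 1" and s: "summable (\<lambda>j. norm (x j))"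
    and L: "(\<lambda>N. \<Prod>j<N. 1 - x j) \<longlonglongrightarrow> L" and L0: "L \<noteq> 0"
    and L': "(\<lambda>N. \<Prod>j<N. 1 - norm (x j)) \<longlonglongrightarrow> L'" and L0': "L' \<noteq> 0"
  shows "((\<lambda>\<rho>. \<Prod>j\<in>#\<rho>. x j) has_sum (1 / L)) UNIV"
    and "((\<lambda>\<rho>. norm (\<Prod>j\<in>#\<rho>. x j)) has_sum (1 / L')) UNIV"
proof -
  define M where "M = (\<lambda>N. {\<rho> :: nat multiset. set_mset \<rho> \<subseteq> {..<N}})"
  have fM: "((\<lambda>\<rho>. \<Prod>j\<in>#\<rho>. y j) has_sum (1 / (\<Prod>j<N. 1 - y j))) (M N)"
    if "\<And>j. norm (y j) < 1" for y :: "nat \<Rightarrow> complex" and N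
    using has_sum_multisets_finite[of "{..<N}" y] that by (simp add: M_def prod_dividef)
  define h where "h = (\<lambda>\<rho>. \<Prod>j\<in>#\<rho>. norm (x j))"
  have hn: "norm (\<Prod>j\<in>#\<rho>. x j) = h \<rho>" for \<rho> :: "nat multiset"
    unfolding h_def by (induction \<rho>) (auto simp: norm_mult)
  have hof: "of_real (h \<rho>) = (\<Prod>j\<in>#\<rho>. of_real (norm (x j)) :: complex)" for \<rho> :: "nat multiset"
    unfolding h_def by (induction \<rho>) auto
  have h0: "h \<rho> \<ge> 0" for \<rho> using norm_ge_zero[of "\<Prod>j\<in>#\<rho>. x j"] hn[of \<rho>] by simp
  have hM: "(h has_sum (1 / (\<Prod>j<N. 1 - norm (x j)))) (M N)" for N
  proof -
    have "((\<lambda>\<rho>. of_real (h \<rho>) :: complex) has_sum of_real (1 / (\<Prod>j<N. 1 - norm (x j)))) (M N)"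
      unfolding hof using fM[of "\<lambda>j. of_real (norm (x j))" N] x by simp
    then show ?thesis by (simp only: has_sum_of_real_iff)
  qed
  have "(\<lambda>N. 1 / (\<Prod>j<N. 1 - norm (x j))) \<longlonglongrightarrow> 1 / L'"
    using L' L0' by (intro tendsto_intros)
  then have "Bseq (\<lambda>N. 1 / (\<Prod>j<N. 1 - norm (x j)))"
    using convergent_imp_Bseq convergent_def by blast
  then obtain K where K: "\<And>N. norm (1 / (\<Prod>j<N. 1 - norm (x j))) \<le> K"
    by (auto simp: Bseq_def)
  \<comment> \<open>Every finite set of multisets lies in some \<open>M N\<close>, and the finite
    Euler products are uniformly bounded by \<open>K\<close> because they converge to 1 /
    L'.\<close>
  have hs: "h summable_on UNIV"
  proof (rule nonneg_bdd_above_summable_on)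
    show "bdd_above (sum h ` {F. F \<subseteq> UNIV \<and> finite F})"
    proof (rule bdd_aboveI2)
      fix F :: "nat multiset set" assume "F \<in> {F. F \<subseteq> UNIV \<and> finite F}"
      then have F: "finite F" by simp
      have "finite (\<Union>\<rho>\<in>F. set_mset \<rho>)" using F by simp
      then obtain N where "(\<Union>\<rho>\<in>F. set_mset \<rho>) \<subseteq> {..<N}"
        using finite_nat_iff_bounded by blast
      then have "F \<subseteq> M N" by (auto simp: M_def)
      then have "sum h F \<le> 1 / (\<Prod>j<N. 1 - norm (x j))"
        using hM[of N] F h0 by (intro finite_sum_le_has_sum) auto
      also have "\<dots> \<le> K" using order_trans[OF abs_ge_self K[of N, unfolded real_norm_def]] .
      finally show "sum h F \<le> K" .
    qed
  qed (use h0 in auto)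
  have lim: "(\<lambda>N. infsum f (M N)) \<longlonglongrightarrow> infsum f UNIV \<and> f summable_on UNIV"
    if "\<And>\<rho>. norm (f \<rho>) \<le> h \<rho>" for f :: "nat multiset \<Rightarrow> complex"
  proof -
    \<comment> \<open>Extension by zero puts the truncated sums on a common domain, where
      \<open>h\<close> dominates all of them.\<close>
    define G where "G = (\<lambda>N \<rho>. if \<rho> \<in> M N then f \<rho> else 0)"
    have G1: "(\<lambda>N. G N \<rho>) \<longlonglongrightarrow> f \<rho>" for \<rho>
    proof (rule tendsto_eventually)
      obtain N0 where "set_mset \<rho> \<subseteq> {..<N0}"
        using finite_nat_iff_bounded finite_set_mset by blast
      then have "G N \<rho> = f \<rho>" if "N \<ge> N0" for N using that by (force simp: G_def M_def)
      then show "\<forall>\<^sub>F N in sequentially. G N \<rho> = f \<rho>"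
        using eventually_sequentially by blast
    qed
    have G2: "norm (G N \<rho>) \<le> h \<rho>" for N \<rho>
      using that[of \<rho>] h0[of \<rho>] by (simp add: G_def)
    note has_sum_dominated[OF hs, where F = G and f = f, OF G2 G1]
    moreover have "infsum (G N) UNIV = infsum f (M N)" for N
      by (rule infsum_cong_neutral) (auto simp: G_def)
    ultimately show ?thesis by simp
  qed
  have *: "infsum (\<lambda>\<rho>. \<Prod>j\<in>#\<rho>. x j) UNIV = 1 / L"
  proof (rule LIMSEQ_unique)
    show "(\<lambda>N. infsum (\<lambda>\<rho>. \<Prod>j\<in>#\<rho>. x j) (M N)) \<longlonglongrightarrow> infsum (\<lambda>\<rho>. \<Prod>j\<in>#\<rho>. x j) UNIV"
      by (rule conjunct1[OF lim[OF eq_refl[OF hn]]])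
    have "(\<lambda>N. 1 / (\<Prod>j<N. 1 - x j)) \<longlonglongrightarrow> 1 / L"
      using L L0 by (intro tendsto_intros)
    then show "(\<lambda>N. infsum (\<lambda>\<rho>. \<Prod>j\<in>#\<rho>. x j) (M N)) \<longlonglongrightarrow> 1 / L"
      using infsumI[OF fM[of x], OF x] by simp
  qed
  then show "((\<lambda>\<rho>. \<Prod>j\<in>#\<rho>. x j) has_sum (1 / L)) UNIV"
    using has_sum_infsum[OF conjunct2[OF lim[OF eq_refl[OF hn]]]] by (simp only:)
  have hC: "norm (complex_of_real (h \<rho>)) \<le> h \<rho>" for \<rho>
    by (simp only: norm_of_real abs_of_nonneg[OF h0])
  have "infsum (\<lambda>\<rho>. of_real (h \<rho>)) UNIV = (of_real (1 / L') :: complex)"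
  proof (rule LIMSEQ_unique[OF conjunct1[OF lim[OF hC]]])
    have "(\<lambda>N. of_real (1 / (\<Prod>j<N. 1 - norm (x j))) :: complex) \<longlonglongrightarrow> of_real (1 / L')"
      using L' L0' by (intro tendsto_intros)
    then show "(\<lambda>N. infsum (\<lambda>\<rho>. of_real (h \<rho>) :: complex) (M N)) \<longlonglongrightarrow> of_real (1 / L')"
      by (simp only: infsumI[OF has_sum_of_real[OF hM]])
  qed
  then have "((\<lambda>\<rho>. of_real (h \<rho>)) has_sum (of_real (1 / L') :: complex)) UNIV"
    using has_sum_infsum[OF conjunct2[OF lim[OF hC]]] by (simp only:)
  then show "((\<lambda>\<rho>. norm (\<Prod>j\<in>#\<rho>. x j)) has_sum (1 / L')) UNIV"
    unfolding hn by (simp only: has_sum_of_real_iff)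
qed

text \<open>The infinite q-Pochhammer symbol (x;q).\<close>

definition qpoch :: "complex \<Rightarrow> complex \<Rightarrow> complex" where
  "qpoch q x = (\<Prod>n. 1 - x * q ^ n)"

context
  fixes q :: complex
  assumes q: "norm q < 1"
begin

lemma summable_qpow: "summable (\<lambda>n. norm (x * q ^ n))"
  using q by (auto simp: norm_mult norm_power intro!: summable_mult summable_geometric)

lemma convergent_prod_qpoch: "convergent_prod (\<lambda>n. 1 - x * q ^ n)"
proof -
  have "summable (\<lambda>n. norm ((1 - x * q ^ n) - 1))"
    using summable_qpow[of x] by simp
  then show ?thesis
    by (intro abs_convergent_prod_imp_convergent_prod summable_imp_abs_convergent_prod)
qed

lemma qpoch_tendsto: "(\<lambda>N. \<Prod>n<N. 1 - x * q ^ n) \<longlonglongrightarrow> qpoch q x"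
  using convergent_prod_LIMSEQ[OF convergent_prod_qpoch[of x]]
  unfolding qpoch_def by (subst (asm) LIMSEQ_lessThan_iff_atMost[symmetric])

lemma qpoch_rec: "qpoch q x = (1 - x) * qpoch q (q * x)"
proof -
  have "(\<lambda>N. \<Prod>n<Suc N. 1 - x * q ^ n) \<longlonglongrightarrow> qpoch q x"
    using qpoch_tendsto by (rule LIMSEQ_Suc)
  moreover have "(\<Prod>n<Suc N. 1 - x * q ^ n) = (1 - x) * (\<Prod>n<N. 1 - (q * x) * q ^ n)" for N
    by (subst prod.lessThan_Suc_shift) (simp add: mult_ac)
  moreover have "(\<lambda>N. (1 - x) * (\<Prod>n<N. 1 - (q * x) * q ^ n)) \<longlonglongrightarrow> (1 - x) * qpoch q (q * x)"
    by (intro tendsto_intros qpoch_tendsto)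
  ultimately show ?thesis using LIMSEQ_unique by auto
qed

lemma qpoch_shift: "qpoch q x = (\<Prod>n<N. 1 - x * q ^ n) * qpoch q (q ^ N * x)"
proof (induction N)
  case (Suc N)
  then show ?case
    by (subst Suc, subst qpoch_rec[of "q ^ N * x"]) (simp add: mult_ac)
qed simp

lemma qpoch_nonzero: "qpoch q x \<noteq> 0 \<longleftrightarrow> (\<forall>n. x * q ^ n \<noteq> 1)"
proof -
  have "qpoch q x = 0 \<longleftrightarrow> 0 \<in> range (\<lambda>n. 1 - x * q ^ n)"
    unfolding qpoch_def
    by (rule has_prod_eq_0_iff[OF convergent_prod_has_prod[OF convergent_prod_qpoch]])
  also have "\<dots> \<longleftrightarrow> (\<exists>n. x * q ^ n = 1)"
    by (auto simp: image_iff)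
  finally show ?thesis by blast
qed

lemma qpoch_nonzero': "norm x < 1 \<Longrightarrow> qpoch q x \<noteq> 0"
proof -
  assume x: "norm x < 1"
  have "x * q ^ n \<noteq> 1" for n
  proof
    assume "x * q ^ n = 1"
    then have "norm x * norm q ^ n = 1" by (metis norm_mult norm_one norm_power)
    moreover have "norm x * norm q ^ n \<le> norm x * 1"
      using q by (intro mult_left_mono power_le_one) auto
    ultimately show False using x by simp
  qed
  then show ?thesis using qpoch_nonzero by blast
qed

end

subsection \<open>The q-binomial theorem\<close>

text \<open>For |t| < 1 this is minus t d/dt log (t;q); see \<open>qpoch_deriv\<close>.\<close>

definition lambert :: "complex \<Rightarrow> complex \<Rightarrow> complex" where
  "lambert q t = (\<Sum>n. t * q ^ n / (1 - t * q ^ n))"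

text \<open>(a;q)_k / (q;q)_k, the coefficients of the q-binomial series.\<close>

definition qbin :: "complex \<Rightarrow> complex \<Rightarrow> nat \<Rightarrow> complex" where
  "qbin q a k = (\<Prod>i<k. (1 - a * q ^ i) / (1 - q ^ Suc i))"

context
  fixes q :: complex
  assumes q: "norm q < 1"
begin

lemma qpow_Suc_neq_1: "q ^ Suc i \<noteq> 1"
proof
  assume "q ^ Suc i = 1"
  then have "norm q ^ Suc i = 1" by (metis norm_one norm_power)
  moreover have "norm q ^ Suc i < 1"
    using q mult_left_mono[OF power_le_one[of "norm q" i] norm_ge_zero[of q]] by simp
  ultimately show False by simp
qed

lemma tendsto_q_pow_mult: "(\<lambda>N. q ^ N * t) \<longlonglongrightarrow> 0"
  using tendsto_mult[OF LIMSEQ_power_zero[OF q] tendsto_const[of t]] by simp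

lemma summable_lambert: "summable (\<lambda>n. norm (t * q ^ n / (1 - t * q ^ n)))"
proof (rule summable_comparison_test_ev)
  show "summable (\<lambda>n. 2 * norm (t * q ^ n))"
    using summable_qpow[OF q, of t] by (rule summable_mult)
  have "(\<lambda>n. q ^ n * t) \<longlonglongrightarrow> 0" by (rule tendsto_q_pow_mult)
  then have "eventually (\<lambda>n. norm (q ^ n * t) < 1 / 2) sequentially"
    by (auto simp: tendsto_iff dist_norm elim!: allE[of _ "1/2"])
  then show "eventually (\<lambda>n. norm (norm (t * q ^ n / (1 - t * q ^ n))) \<le> 2 * norm (t * q ^ n)) sequentially"
  proof eventually_elim
    case (elim n)
    then have h: "norm (t * q ^ n) < 1 / 2" by (simp add: mult.commute)
    have "norm (1 - t * q ^ n) \<ge> norm (1 :: complex) - norm (t * q ^ n)"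
      by (rule norm_triangle_ineq2)
    then have "norm (1 - t * q ^ n) \<ge> 1 / 2" using h by simp
    then have "norm (t * q ^ n) / norm (1 - t * q ^ n) \<le> norm (t * q ^ n) / (1 / 2)"
      by (intro divide_left_mono) auto
    then show ?case by (simp add: norm_divide mult_ac)
  qed
qed

lemma lambert_sums: "(\<lambda>n. t * q ^ n / (1 - t * q ^ n)) sums lambert q t"
  unfolding lambert_def using summable_norm_cancel[OF summable_lambert] by (rule summable_sums)

lemma lambert_rec: "lambert q t = t / (1 - t) + lambert q (q * t)"
proof -
  have "(\<lambda>n. t * q ^ Suc n / (1 - t * q ^ Suc n)) sums lambert q (q * t)"
    using lambert_sums[of "q * t"] by (simp add: mult_ac)
  then have "(\<lambda>n. t * q ^ n / (1 - t * q ^ n)) sums (lambert q (q * t) + t * q ^ 0 / (1 - t * q ^ 0))"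
    by (rule sums_Suc)
  then show ?thesis using lambert_sums sums_unique2 by fastforce
qed

lemma lambert_0 [simp]: "lambert q 0 = 0"
  by (simp add: lambert_def)

lemma Bseq_qbin: "Bseq (qbin q a)"
proof -
  have "(\<lambda>k. (\<Prod>i<k. 1 - a * q ^ i) / (\<Prod>i<k. 1 - q * q ^ i)) \<longlonglongrightarrow> qpoch q a / qpoch q q"
    by (intro tendsto_divide qpoch_tendsto q qpoch_nonzero')
  moreover have "qbin q a = (\<lambda>k. (\<Prod>i<k. 1 - a * q ^ i) / (\<Prod>i<k. 1 - q * q ^ i))"
    by (auto simp: qbin_def prod_dividef)
  ultimately show ?thesis
    by (intro convergent_imp_Bseq) (auto simp: convergent_def)
qed

lemma summable_qbin:
  assumes "norm t < 1"
  shows "summable (\<lambda>k. norm (qbin q a k * t ^ k))"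
proof -
  obtain B where B: "\<And>k. norm (qbin q a k) \<le> B" using Bseq_qbin[of a] by (auto simp: Bseq_def)
  show ?thesis
  proof (rule summable_comparison_test')
    show "summable (\<lambda>k. B * norm t ^ k)" using assms by (intro summable_mult summable_geometric) auto
    show "norm (norm (qbin q a k * t ^ k)) \<le> B * norm t ^ k" if "k \<ge> 0" for k
      using B[of k] by (simp add: norm_mult norm_power mult_right_mono)
  qed
qed

definition qbin_series :: "complex \<Rightarrow> complex \<Rightarrow> complex" where
  "qbin_series a t = (\<Sum>k. qbin q a k * t ^ k)"

definition qbin_series' :: "complex \<Rightarrow> complex \<Rightarrow> complex" where
  "qbin_series' a t = (\<Sum>k. diffs (qbin q a) k * t ^ k)"

lemma qbin_series_sums: "norm t < 1 \<Longrightarrow> (\<lambda>k. qbin q a k * t ^ k) sums qbin_series a t"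
  unfolding qbin_series_def using summable_norm_cancel[OF summable_qbin] by (rule summable_sums)

lemma qbin_series_deriv: "norm t < 1 \<Longrightarrow> (qbin_series a has_field_derivative qbin_series' a t) (at t)"
  unfolding qbin_series_def[abs_def] qbin_series'_def
  by (rule termdiffs_strong'[of 1]) (auto intro: summable_norm_cancel[OF summable_qbin])

lemma norm_q_mult: "norm t < 1 \<Longrightarrow> norm (q * t) < 1"
  using q mult_strict_mono'[of "norm q" 1 "norm t" 1] by (simp add: norm_mult)

lemma norm_q_pow_mult: "norm t < 1 \<Longrightarrow> norm (q ^ n * t) < 1"
  by (induction n) (use norm_q_mult in \<open>auto simp: mult.assoc\<close>)

text \<open>The ratio (1 - a q^k) / (1 - q^(k+1)) of consecutive coefficients, cleared of its
  denominator, is this q-difference equation read coefficientwise.\<close>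

lemma qbin_series_rec:
  assumes t: "norm t < 1"
  shows "(1 - t) * qbin_series a t = (1 - a * t) * qbin_series a (q * t)"
proof -
  have 1: "(\<lambda>k. qbin q a k * t ^ k - qbin q a k * (q * t) ^ k) sums (qbin_series a t - qbin_series a (q * t))"
    by (intro sums_diff qbin_series_sums t norm_q_mult)
  have "(\<lambda>k. (qbin q a k * t ^ k - a * (qbin q a k * (q * t) ^ k)) * t) sums ((qbin_series a t - a * qbin_series a (q * t)) * t)"
    by (intro sums_mult2 sums_diff sums_mult qbin_series_sums t norm_q_mult)
  moreover have "(qbin q a k * t ^ k - a * (qbin q a k * (q * t) ^ k)) * t =
      qbin q a (Suc k) * t ^ Suc k - qbin q a (Suc k) * (q * t) ^ Suc k" for k
  proof -
    have "qbin q a (Suc k) * (1 - q ^ Suc k) = qbin q a k * (1 - a * q ^ k)"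
      unfolding qbin_def using qpow_Suc_neq_1[of k] by simp
    then have "qbin q a (Suc k) * (1 - q ^ Suc k) * t ^ Suc k = qbin q a k * (1 - a * q ^ k) * t ^ Suc k"
      by simp
    then show ?thesis by (simp add: algebra_simps power_mult_distrib)
  qed
  ultimately have "(\<lambda>k. qbin q a (Suc k) * t ^ Suc k - qbin q a (Suc k) * (q * t) ^ Suc k) sums
      ((qbin_series a t - a * qbin_series a (q * t)) * t)"
    by simp
  from sums_Suc[OF this] have "(\<lambda>k. qbin q a k * t ^ k - qbin q a k * (q * t) ^ k) sums
      ((qbin_series a t - a * qbin_series a (q * t)) * t)" by simp
  with 1 have "qbin_series a t - qbin_series a (q * t) = (qbin_series a t - a * qbin_series a (q * t)) * t" by (rule sums_unique2)
  then show ?thesis by (simp add: algebra_simps)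
qed

text \<open>Iterating the q-difference equation N times splits off the first N factors of both
  products and leaves the series at q^N t, which tends to its value 1 at 0.\<close>

lemma qbin_series_eq:
  assumes t: "norm t < 1"
  shows "qbin_series a t = qpoch q (a * t) / qpoch q t"
proof -
  have N: "(\<Prod>n<N. 1 - t * q ^ n) * qbin_series a t = (\<Prod>n<N. 1 - a * t * q ^ n) * qbin_series a (q ^ N * t)" for N
  proof (induction N)
    case (Suc N)
    have "(\<Prod>n<Suc N. 1 - t * q ^ n) * qbin_series a t = (1 - t * q ^ N) * ((\<Prod>n<N. 1 - t * q ^ n) * qbin_series a t)"
      by simp
    also have "\<dots> = (\<Prod>n<N. 1 - a * t * q ^ n) * ((1 - q ^ N * t) * qbin_series a (q ^ N * t))"
      unfolding Suc by (simp add: mult_ac)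
    also have "\<dots> = (\<Prod>n<N. 1 - a * t * q ^ n) * ((1 - a * (q ^ N * t)) * qbin_series a (q * (q ^ N * t)))"
      by (simp only: qbin_series_rec[OF norm_q_pow_mult[OF t]])
    finally show ?case by (simp add: mult_ac)
  qed simp
  have "isCont (qbin_series a) 0" using qbin_series_deriv[of 0 a] DERIV_isCont by force
  then have "(\<lambda>N. qbin_series a (q ^ N * t)) \<longlonglongrightarrow> qbin_series a 0"
    using tendsto_q_pow_mult isCont_tendsto_compose by blast
  moreover have "qbin_series a 0 = 1"
    by (simp add: qbin_series_def qbin_def)
  ultimately have "(\<lambda>N. (\<Prod>n<N. 1 - a * t * q ^ n) * qbin_series a (q ^ N * t)) \<longlonglongrightarrow> qpoch q (a * t) * 1"
    by (intro tendsto_intros qpoch_tendsto q) simp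
  moreover have "(\<lambda>N. (\<Prod>n<N. 1 - t * q ^ n) * qbin_series a t) \<longlonglongrightarrow> qpoch q t * qbin_series a t"
    by (intro tendsto_intros qpoch_tendsto q)
  ultimately have "qpoch q t * qbin_series a t = qpoch q (a * t)"
    using LIMSEQ_unique N by simp
  then show ?thesis using qpoch_nonzero'[OF q t] by (simp add: field_simps)
qed

lemma one_minus_nonzero: "norm (t :: complex) < 1 \<Longrightarrow> 1 - t \<noteq> 0"
  by auto

lemma qbin_series_nonzero:
  assumes "norm t < 1" "norm a \<le> 1"
  shows "qbin_series a t \<noteq> 0"
proof -
  have "norm (a * t) < 1"
    using assms mult_right_mono[of "norm a" 1 "norm t"] by (simp add: norm_mult)
  then show ?thesis using assms by (simp add: qbin_series_eq qpoch_nonzero' q)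
qed

text \<open>The logarithmic derivative \<open>D\<close> and the difference of Lambert series change
  by the same amount when t is replaced by q t. Their difference is therefore constant along q^N t,
  where it tends to 0.\<close>

lemma qbin_series_logderiv:
  assumes t: "norm t < 1" and a: "norm a \<le> 1"
  shows "t * qbin_series' a t = qbin_series a t * (lambert q t - lambert q (a * t))"
proof -
  define D where "D = (\<lambda>t. t * qbin_series' a t / qbin_series a t)"
  have rec: "D t = t / (1 - t) - a * t / (1 - a * t) + D (q * t)" if t: "norm t < 1" for t
  proof -
    have at: "norm (a * t) < 1"
      using t a mult_right_mono[of "norm a" 1 "norm t"] by (simp add: norm_mult)
    have "((\<lambda>t. (1 - t) * qbin_series a t) has_field_derivative (- 1 * qbin_series a t + qbin_series' a t * (1 - t))) (at t)"
      by (auto intro!: derivative_eq_intros qbin_series_deriv t)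
    moreover have "((\<lambda>t. (1 - a * t) * qbin_series a (q * t)) has_field_derivative
        (- a * qbin_series a (q * t) + (qbin_series' a (q * t) * q) * (1 - a * t))) (at t)"
      by (auto intro!: derivative_eq_intros DERIV_chain'[OF _ qbin_series_deriv] norm_q_mult t)
    then have "((\<lambda>t. (1 - t) * qbin_series a t) has_field_derivative
        (- a * qbin_series a (q * t) + (qbin_series' a (q * t) * q) * (1 - a * t))) (at t)"
    proof (rule has_field_derivative_transform_within_open[where S = "ball 0 1"])
      show "\<And>x. x \<in> ball 0 1 \<Longrightarrow> (1 - a * x) * qbin_series a (q * x) = (1 - x) * qbin_series a x"
        using qbin_series_rec by simp
    qed (use t in auto)
    ultimately have e: "- 1 * qbin_series a t + qbin_series' a t * (1 - t) = - a * qbin_series a (q * t) + (qbin_series' a (q * t) * q) * (1 - a * t)"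
      using DERIV_unique by blast
    have nz: "qbin_series a t \<noteq> 0" "qbin_series a (q * t) \<noteq> 0" "1 - t \<noteq> 0" "1 - a * t \<noteq> 0"
      using t a at qbin_series_nonzero norm_q_mult one_minus_nonzero by blast+
    define X where "X = (1 - t) * qbin_series a t"
    have X: "X = (1 - a * t) * qbin_series a (q * t)" "X \<noteq> 0" using qbin_series_rec[OF t] nz by (simp_all add: X_def)
    have "D t - t / (1 - t) = t * (- 1 * qbin_series a t + qbin_series' a t * (1 - t)) / X"
      unfolding X_def D_def using nz by (simp add: field_simps)
    also have "\<dots> = t * (- a * qbin_series a (q * t) + (qbin_series' a (q * t) * q) * (1 - a * t)) / X"
      by (simp only: e)
    also have "\<dots> = D (q * t) - a * t / (1 - a * t)"
      unfolding X(1) D_def using nz by (simp add: field_simps)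
    finally show ?thesis by (simp add: algebra_simps)
  qed
  have N: "D t - (lambert q t - lambert q (a * t)) = D (q ^ N * t) - (lambert q (q ^ N * t) - lambert q (q ^ N * (a * t)))" for N
  proof (induction N)
    case (Suc N)
    show ?case
      unfolding Suc
      using rec[OF norm_q_pow_mult[OF t, of N]] lambert_rec[of "q ^ N * t"] lambert_rec[of "q ^ N * (a * t)"]
      by (simp add: mult_ac)
  qed simp
  have lambert_eq: "lambert q (q ^ N * x) = lambert q x - (\<Sum>n<N. x * q ^ n / (1 - x * q ^ n))" for N x
    by (induction N) (use lambert_rec[of "q ^ _ * x"] in \<open>auto simp: mult_ac algebra_simps\<close>)
  have lambert_lim: "(\<lambda>N. lambert q (q ^ N * x)) \<longlonglongrightarrow> 0" for x
  proof -
    have "(\<lambda>N. lambert q x - (\<Sum>n<N. x * q ^ n / (1 - x * q ^ n))) \<longlonglongrightarrow> lambert q x - lambert q x"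
      using lambert_sums[of x] by (intro tendsto_intros) (simp add: sums_def)
    then show ?thesis by (simp add: lambert_eq)
  qed
  have c1: "isCont (qbin_series a) 0" using qbin_series_deriv[of 0 a] DERIV_isCont by force
  have c2: "isCont (qbin_series' a) 0"
  proof -
    have "summable (\<lambda>n. diffs (qbin q a) n * x ^ n)" if "norm x < 1" for x
      using that by (intro termdiff_converges[of x 1]) (auto intro: summable_norm_cancel[OF summable_qbin])
    from isCont_powser[OF this[of "1/2"], of 0] show ?thesis
      unfolding qbin_series'_def[abs_def] by simp
  qed
  have c3: "qbin_series a 0 = 1"
    by (simp add: qbin_series_def qbin_def)
  have "isCont D 0"
    using isCont_divide[OF isCont_mult[OF continuous_ident c2] c1] c3 by (simp add: D_def)
  then have "(\<lambda>N. D (q ^ N * t)) \<longlonglongrightarrow> D 0"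
    using tendsto_q_pow_mult isCont_tendsto_compose by blast
  then have "(\<lambda>N. D (q ^ N * t) - (lambert q (q ^ N * t) - lambert q (q ^ N * (a * t)))) \<longlonglongrightarrow> D 0 - (0 - 0)"
    by (intro tendsto_intros lambert_lim)
  then have "(\<lambda>N::nat. D t - (lambert q t - lambert q (a * t))) \<longlonglongrightarrow> 0"
    unfolding N[symmetric] by (simp add: D_def)
  then have "D t - (lambert q t - lambert q (a * t)) = 0"
    by (simp only: LIMSEQ_const_iff)
  then show ?thesis using qbin_series_nonzero[OF t a] by (simp add: D_def field_simps)
qed

text \<open>The factor \<open>k\<close> produced by t d/dt will be the number of ones of a
  partition.\<close>

lemma qbin_series_weighted_sums:
  assumes "norm t < 1"
  shows "(\<lambda>k. of_nat k * (qbin q a k * t ^ k)) sums (t * qbin_series' a t)"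
    and "summable (\<lambda>k. norm (of_nat k * (qbin q a k * t ^ k)))"
proof -
  have "(\<lambda>n. diffs (qbin q a) n * t ^ n) sums qbin_series' a t"
    by (rule termdiffs_sums_strong[OF qbin_series_sums qbin_series_deriv]) (use assms in auto)
  then have "(\<lambda>n. t * (diffs (qbin q a) n * t ^ n)) sums (t * qbin_series' a t)" by (rule sums_mult)
  moreover have "t * (diffs (qbin q a) n * t ^ n) = of_nat (Suc n) * (qbin q a (Suc n) * t ^ Suc n)" for n
    by (simp add: diffs_def)
  ultimately have "(\<lambda>n. of_nat (Suc n) * (qbin q a (Suc n) * t ^ Suc n)) sums (t * qbin_series' a t)" by simp
  from sums_Suc[OF this] show "(\<lambda>k. of_nat k * (qbin q a k * t ^ k)) sums (t * qbin_series' a t)" by simp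
  have "summable (\<lambda>n. norm (diffs (qbin q a) n) * of_real (norm t) ^ n)"
  proof -
    obtain s where s: "norm t < s" "s < 1" using dense assms by blast
    then have "0 < s" using norm_ge_zero[of t] by linarith
    have "summable (\<lambda>n. norm (diffs (qbin q a) n * t ^ n))"
      by (rule powser_insidea[of _ "of_real s"])
         (use s \<open>0 < s\<close> in \<open>auto intro!: termdiff_converges[of _ 1] intro: summable_norm_cancel[OF summable_qbin]\<close>)
    then show ?thesis by (simp add: norm_mult norm_power)
  qed
  then have "summable (\<lambda>n. norm t * (norm (diffs (qbin q a) n) * norm t ^ n))"
    by (intro summable_mult) simp
  moreover have "norm t * (norm (diffs (qbin q a) n) * norm t ^ n) =
      norm (of_nat (Suc n) * (qbin q a (Suc n) * t ^ Suc n))" for n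
    by (simp add: diffs_def norm_mult norm_power)
  ultimately have "summable (\<lambda>n. norm (of_nat (Suc n) * (qbin q a (Suc n) * t ^ Suc n)))" by simp
  then show "summable (\<lambda>k. norm (of_nat k * (qbin q a k * t ^ k)))"
    by (subst (asm) summable_Suc_iff)
qed

end

subsection \<open>Ones and cranks\<close>

text \<open>The majorant for the generating function of partitions into parts at least 2.\<close>

lemma real_geometric_prod:
  fixes r :: real
  assumes "0 \<le> r" "r < 1"
  shows "\<exists>L. (\<lambda>N. \<Prod>j<N. 1 - (if j \<le> 1 then 0 else r ^ j)) \<longlonglongrightarrow> L \<and> L \<noteq> 0"
proof -
  let ?x = "\<lambda>j::nat. if j \<le> 1 then 0 else r ^ j"
  have lt: "?x j < 1" for j
    using assms power_decreasing[of 1 j r] by auto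
  have "summable (\<lambda>j. norm ((1 - ?x j) - 1))"
  proof (rule summable_comparison_test')
    show "summable (\<lambda>j. r ^ j)" using assms by (intro summable_geometric) auto
    show "norm (norm ((1 - ?x j) - 1)) \<le> r ^ j" if "j \<ge> 0" for j
      using assms by auto
  qed
  then have c: "convergent_prod (\<lambda>j. 1 - ?x j)"
    by (intro abs_convergent_prod_imp_convergent_prod summable_imp_abs_convergent_prod)
  have "(\<lambda>N. \<Prod>j<N. 1 - ?x j) \<longlonglongrightarrow> prodinf (\<lambda>j. 1 - ?x j)"
    using convergent_prod_LIMSEQ[OF c] by (subst (asm) LIMSEQ_lessThan_iff_atMost[symmetric])
  moreover have "prodinf (\<lambda>j. 1 - ?x j) \<noteq> 0"
    using c lt by (intro prodinf_nonzero) (auto simp: less_imp_neq[symmetric])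
  ultimately show ?thesis by blast
qed

context
  fixes q z :: complex
  assumes q: "norm q < 1" and z: "norm z = 1"
begin

text \<open>In a partition with \<open>k\<close> ones, \<open>z\<close> marks the parts counted positively by the crank; the ones themselves
  are accounted for separately, hence the weight \<open>0\<close>.\<close>

definition part_weight :: "nat \<Rightarrow> nat \<Rightarrow> complex" where
  "part_weight k j = (if j \<le> 1 then 0 else if j \<le> k then q ^ j else z * q ^ j)"

lemma norm_part_weight: "norm (part_weight k j) = (if j \<le> 1 then 0 else norm q ^ j)"
  using z by (simp add: part_weight_def norm_mult norm_power)

lemma norm_part_weight_less: "norm (part_weight k j) < 1"
proof (cases j)
  case (Suc i)
  have "norm q ^ Suc i < 1"
    using q mult_left_mono[OF power_le_one[of "norm q" i] norm_ge_zero[of q]] by simp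
  then show ?thesis using Suc by (simp add: norm_part_weight)
qed (simp add: part_weight_def)

lemma qpoch_zq_nonzero: "qpoch q (z * q) \<noteq> 0" "qpoch q (q / z) \<noteq> 0" "qpoch q q \<noteq> 0"
  by (rule qpoch_nonzero'[OF q]; use q z in \<open>simp add: norm_mult norm_divide\<close>)+

text \<open>The parts 2, ..., k + 1 contribute (q;q)_(k+1) / (1 - q), the larger ones (z q^(k+2);q).
  The limit is written with \<open>qbin\<close> because its reciprocal is what the q-binomial
  theorem sums over k.\<close>

lemma part_weight_prod_tendsto:
  "(\<lambda>N. \<Prod>j<N. 1 - part_weight (Suc k) j) \<longlonglongrightarrow>
     qpoch q (z * q) / ((1 - q) * qbin q (z * q) (Suc k))"
proof -
  let ?k = "Suc k"
  have small: "(\<Prod>j<Suc m. 1 - part_weight ?k j) = (\<Prod>i<m. 1 - q ^ Suc i) / (1 - q)"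
    if "1 \<le> m" "m \<le> ?k" for m
    using that
  proof (induction m rule: dec_induct)
    case base
    then show ?case using q by (auto simp: part_weight_def)
  next
    case (step m)
    then show ?case by (simp add: part_weight_def)
  qed
  have split: "(\<Prod>j<M + Suc ?k. 1 - part_weight ?k j) =
      (\<Prod>i<?k. 1 - q ^ Suc i) / (1 - q) * (\<Prod>n<M. 1 - (q ^ ?k * (z * q)) * q ^ n)" for M
  proof (induction M)
    case 0
    then show ?case using small[of ?k] by simp
  next
    case (Suc M)
    have "part_weight ?k (M + Suc ?k) = q ^ ?k * (z * q) * q ^ M"
      by (simp add: part_weight_def power_add)
    then show ?case using Suc by (simp add: mult.assoc)
  qed
  have "(\<lambda>M. \<Prod>j<M + Suc ?k. 1 - part_weight ?k j) \<longlonglongrightarrow>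
      (\<Prod>i<?k. 1 - q ^ Suc i) / (1 - q) * qpoch q (q ^ ?k * (z * q))"
    unfolding split by (intro tendsto_intros qpoch_tendsto q)
  moreover have "(\<Prod>i<?k. 1 - q ^ Suc i) / (1 - q) * qpoch q (q ^ ?k * (z * q)) =
      qpoch q (z * q) / ((1 - q) * qbin q (z * q) ?k)"
  proof -
    have s: "qpoch q (z * q) = (\<Prod>i<?k. 1 - z * q * q ^ i) * qpoch q (q ^ ?k * (z * q))"
      by (rule qpoch_shift[OF q])
    then have nz: "(\<Prod>i<?k. 1 - z * q * q ^ i) \<noteq> 0" using qpoch_zq_nonzero by auto
    have nz2: "(\<Prod>i<?k. 1 - q ^ Suc i) \<noteq> 0"
      using qpow_Suc_neq_1[OF q] by simp
    have b: "qbin q (z * q) ?k = (\<Prod>i<?k. 1 - z * q * q ^ i) / (\<Prod>i<?k. 1 - q ^ Suc i)"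
      by (simp only: qbin_def prod_dividef)
    have "b / c * x = (a * x) / (c * (a / b))" if "a \<noteq> 0" "b \<noteq> 0" for a b c x :: complex
      using that by simp
    from this[OF nz nz2] show ?thesis unfolding b s .
  qed
  ultimately show ?thesis by (simp only: LIMSEQ_offset)
qed

text \<open>As |z| = 1, the moduli of the weights do not depend on k. The common value
  \<open>L\<close> is what makes the later sum over k converge absolutely.\<close>

lemma part_weight_multisets:
  obtains L where "\<And>k. ((\<lambda>\<rho>. \<Prod>j\<in>#\<rho>. part_weight (Suc k) j) has_sum
       ((1 - q) / qpoch q (z * q) * qbin q (z * q) (Suc k))) UNIV"
    and "\<And>k. ((\<lambda>\<rho>. norm (\<Prod>j\<in>#\<rho>. part_weight (Suc k) j)) has_sum L) UNIV"
proof -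
  obtain L where L: "(\<lambda>N. \<Prod>j<N. 1 - (if j \<le> 1 then 0 else norm q ^ j)) \<longlonglongrightarrow> L" "L \<noteq> 0"
    using real_geometric_prod[of "norm q"] q by auto
  have s: "summable (\<lambda>j. norm (part_weight k j))" for k
  proof (rule summable_comparison_test')
    show "summable (\<lambda>j. norm q ^ j)" using q by (intro summable_geometric) auto
    show "norm (norm (part_weight k j)) \<le> norm q ^ j" if "j \<ge> 0" for j by (simp add: norm_part_weight)
  qed
  have L': "(\<lambda>N. \<Prod>j<N. 1 - norm (part_weight k j)) \<longlonglongrightarrow> L" for k
    unfolding norm_part_weight by (rule L(1))
  have nz: "qpoch q (z * q) / ((1 - q) * qbin q (z * q) (Suc k)) \<noteq> 0" for k
  proof -
    have "1 - q \<noteq> 0" using q by auto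
    moreover have "qbin q (z * q) (Suc k) \<noteq> 0"
    proof -
      have "1 - z * q * q ^ i \<noteq> 0" for i
        using qpoch_nonzero[OF q, of "z * q"] qpoch_zq_nonzero by auto
      then show ?thesis using qpow_Suc_neq_1[OF q] by (simp add: qbin_def)
    qed
    ultimately show ?thesis using qpoch_zq_nonzero by simp
  qed
  show ?thesis
  proof
    show "((\<lambda>\<rho>. \<Prod>j\<in>#\<rho>. part_weight (Suc k) j) has_sum
       ((1 - q) / qpoch q (z * q) * qbin q (z * q) (Suc k))) UNIV" for k
      using has_sum_multisets(1)[OF norm_part_weight_less s part_weight_prod_tendsto nz L' L(2), of k] by simp
    show "((\<lambda>\<rho>. norm (\<Prod>j\<in>#\<rho>. part_weight (Suc k) j)) has_sum (1 / L)) UNIV" for k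
      using has_sum_multisets(2)[OF norm_part_weight_less s part_weight_prod_tendsto nz L' L(2), of k] by simp
  qed
qed

lemma prod_part_weight:
  assumes "\<forall>j\<in>#\<rho>. j \<ge> 2"
  shows "(\<Prod>j\<in>#\<rho>. part_weight k j) = q ^ sum_mset \<rho> * z ^ size {#j \<in># \<rho>. j > k#}"
  using assms by (induction \<rho>) (auto simp: part_weight_def power_add)

text \<open>The logarithmic derivative of the q-binomial product at a = z q and t = q / z. Since a t
  = q^2, the second Lambert series does not involve z.\<close>

definition crank_ones_gf :: complex where
  "crank_ones_gf = qpoch q q / (qpoch q (z * q) * qpoch q (q / z)) * (lambert q (q / z) - lambert q (q * q))"

text \<open>A partition with k + 1 ones is a multiset \<rho> of parts at least 2 together with these
  ones. Its crank is the number of parts of \<rho> above k + 1 minus (k + 1), so the ones contribute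
  (k + 1) t^(k+1) with t = q / z, and the parts of \<rho> contribute
  \<open>part_weight\<close>.\<close>

lemma crank_ones_has_sum:
  "((\<lambda>\<pi>. of_nat (num_ones \<pi>) * z powi crank \<pi> * q ^ sum_mset \<pi>) has_sum crank_ones_gf) {\<pi>. 0 \<notin># \<pi>}"
proof -
  obtain L where inner: "\<And>k. ((\<lambda>\<rho>. \<Prod>j\<in>#\<rho>. part_weight (Suc k) j) has_sum
       ((1 - q) / qpoch q (z * q) * qbin q (z * q) (Suc k))) UNIV"
    and innern: "\<And>k. ((\<lambda>\<rho>. norm (\<Prod>j\<in>#\<rho>. part_weight (Suc k) j)) has_sum L) UNIV"
    using part_weight_multisets by metis
  have z0: "z \<noteq> 0" using z by auto
  define t where "t = q / z"
  have t: "norm t < 1" using q z by (simp add: t_def norm_divide)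
  have a: "norm (z * q) \<le> 1" using q z by (simp add: norm_mult)
  define c where "c = (\<lambda>k. of_nat (Suc k) * t ^ Suc k)"
  define W where "W = (\<lambda>(k, \<rho>). c k * (\<Prod>j\<in>#\<rho>. part_weight (Suc k) j))"
  have total: "(W has_sum crank_ones_gf) (UNIV \<times> UNIV)"
  proof (rule has_sum_SigmaI)
    show "((\<lambda>\<rho>. W (k, \<rho>)) has_sum (c k * ((1 - q) / qpoch q (z * q) * qbin q (z * q) (Suc k)))) UNIV" for k
      unfolding W_def using has_sum_cmult_right[OF inner, of "c k" k] by simp
    let ?f = "\<lambda>k. of_nat k * (qbin q (z * q) k * t ^ k)"
    have "(\<lambda>k. ?f (Suc k)) sums (t * qbin_series' q (z * q) t)"
      using qbin_series_weighted_sums(1)[OF q t, of "z * q"] by (subst sums_Suc_iff) simp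
    moreover have "summable (\<lambda>k. norm (?f (Suc k)))"
      using qbin_series_weighted_sums(2)[OF q t, of "z * q"] by (subst summable_Suc_iff[of "\<lambda>k. norm (?f k)"])
    ultimately have "((\<lambda>k. ?f (Suc k)) has_sum (t * qbin_series' q (z * q) t)) UNIV"
      by (intro norm_summable_imp_has_sum)
    from has_sum_cmult_right[OF this, of "(1 - q) / qpoch q (z * q)"]
    have "((\<lambda>k. c k * ((1 - q) / qpoch q (z * q) * qbin q (z * q) (Suc k))) has_sum
        ((1 - q) / qpoch q (z * q) * (t * qbin_series' q (z * q) t))) UNIV"
      by (simp add: c_def mult_ac)
    also have "(1 - q) / qpoch q (z * q) * (t * qbin_series' q (z * q) t) = crank_ones_gf"
    proof -
      have e: "z * q * t = q * q" using z0 by (simp add: t_def)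
      have "qpoch q q = (1 - q) * qpoch q (q * q)" by (rule qpoch_rec[OF q])
      then show ?thesis
        unfolding qbin_series_logderiv[OF q t a] qbin_series_eq[OF q t] e crank_ones_gf_def
        by (simp add: t_def)
    qed
    finally show "((\<lambda>k. c k * ((1 - q) / qpoch q (z * q) * qbin q (z * q) (Suc k))) has_sum crank_ones_gf) UNIV" .
    show "W summable_on UNIV \<times> UNIV"
    proof (rule abs_summable_summable, subst Infinite_Sum.abs_summable_on_Sigma_iff, intro conjI ballI)
      have n: "((\<lambda>\<rho>. norm (W (k, \<rho>))) has_sum (norm (c k) * L)) UNIV" for k
        using has_sum_cmult_right[OF innern, of "norm (c k)" k] by (simp add: W_def norm_mult)
      then show "(\<lambda>\<rho>. norm (W (k, \<rho>))) summable_on UNIV" for k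
        by (rule has_sum_imp_summable)
      have "(\<lambda>k. norm (c k)) summable_on UNIV"
      proof (rule norm_summable_imp_summable_on)
        have "summable (\<lambda>n. of_nat (Suc n) * norm t ^ n)"
          using geometric_deriv_sums[of "norm t"] t by (simp add: sums_iff)
        moreover have "norm (c k) = norm t * (of_nat (Suc k) * norm t ^ k)" for k
          by (simp only: c_def norm_mult norm_power norm_of_nat power_Suc mult_ac)
        ultimately have "summable (\<lambda>k. norm (c k))"
          using summable_mult[of "\<lambda>n. of_nat (Suc n) * norm t ^ n" "norm t"] by (simp only:)
        then show "summable (\<lambda>k. norm (norm (c k)))" by (simp only: real_norm_def abs_norm_cancel)
      qed
      then have "(\<lambda>k. norm (c k) * L) summable_on UNIV" by (rule summable_on_cmult_left)
      moreover have "L \<ge> 0" using innern[of 0] by (rule has_sum_nonneg) simp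
      ultimately show "(\<lambda>k. norm (\<Sum>\<^sub>\<infinity>\<rho>. norm (W (k, \<rho>)))) summable_on UNIV"
        unfolding infsumI[OF n] by (simp add: norm_mult)
    qed
  qed
  \<comment> \<open>A multiset containing 0 or 1 has weight zero, so the sum over all multisets is
    carried by \<open>R\<close>.\<close>
  define R where "R = {\<rho> :: nat multiset. \<forall>j\<in>#\<rho>. j \<ge> 2}"
  have "(W has_sum crank_ones_gf) (UNIV \<times> R)"
  proof (rule iffD1[OF has_sum_cong_neutral total])
    fix v :: "nat \<times> nat multiset" assume "v \<in> UNIV \<times> UNIV - UNIV \<times> R"
    then obtain k \<rho> j where v: "v = (k, \<rho>)" "j \<in># \<rho>" "\<not> j \<ge> 2"
      by (cases v) (auto simp: R_def)
    then have "part_weight (Suc k) j = 0" by (simp add: part_weight_def)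
    then have "0 \<in># image_mset (part_weight (Suc k)) \<rho>" using v(2) by (force simp: image_iff)
    then have "(\<Prod>j\<in>#\<rho>. part_weight (Suc k) j) = 0" by (simp add: prod_mset_zero_iff)
    then show "W v = 0" by (simp add: W_def v)
  qed auto
  also have "(W has_sum crank_ones_gf) (UNIV \<times> R) \<longleftrightarrow>
     ((\<lambda>\<pi>. of_nat (num_ones \<pi>) * z powi crank \<pi> * q ^ sum_mset \<pi>) has_sum crank_ones_gf) {\<pi>. 0 \<notin># \<pi> \<and> 1 \<in># \<pi>}"
  proof (rule has_sum_reindex_bij_witness[where
        i = "\<lambda>\<pi>. (count \<pi> 1 - 1, filter_mset (\<lambda>j. j \<noteq> 1) \<pi>)" and
        j = "\<lambda>(k, \<rho>). replicate_mset (Suc k) 1 + \<rho>"])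
    fix v assume "v \<in> (UNIV :: nat set) \<times> R"
    then obtain k \<rho> where v: "v = (k, \<rho>)" and \<rho>: "\<forall>j\<in>#\<rho>. j \<ge> 2" by (auto simp: R_def)
    have c: "count \<rho> (Suc 0) = 0" "count \<rho> 0 = 0" using \<rho> by (auto simp: count_eq_zero_iff)
    have f: "filter_mset (\<lambda>j. j \<noteq> Suc 0) \<rho> = \<rho>" using \<rho> by (auto simp: filter_mset_eq_conv)
    let ?p = "replicate_mset (Suc k) 1 + \<rho>"
    show "(count (case v of (k, \<rho>) \<Rightarrow> replicate_mset (Suc k) 1 + \<rho>) 1 - 1,
         {#j \<in># case v of (k, \<rho>) \<Rightarrow> replicate_mset (Suc k) 1 + \<rho>. j \<noteq> 1#}) = v"
      by (simp add: v c f)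
    show "(case v of (k, \<rho>) \<Rightarrow> replicate_mset (Suc k) 1 + \<rho>) \<in> {\<pi>. 0 \<notin># \<pi> \<and> 1 \<in># \<pi>}"
      using \<rho> by (auto simp: v)
    have ones: "num_ones ?p = Suc k" by (simp add: num_ones_def c)
    have g: "{#j \<in># ?p. j > Suc k#} = {#j \<in># \<rho>. j > Suc k#}" by simp
    have cp: "crank ?p = int (size {#j \<in># \<rho>. j > Suc k#}) - int (Suc k)"
      unfolding crank_def ones g by simp
    have cr: "z powi crank ?p = z ^ size {#j \<in># \<rho>. j > Suc k#} / z ^ Suc k"
      unfolding cp power_int_diff[OF disjI1[OF z0]] power_int_of_nat ..
    show "of_nat (num_ones (case v of (k, \<rho>) \<Rightarrow> replicate_mset (Suc k) 1 + \<rho>)) *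
         z powi crank (case v of (k, \<rho>) \<Rightarrow> replicate_mset (Suc k) 1 + \<rho>) *
         q ^ sum_mset (case v of (k, \<rho>) \<Rightarrow> replicate_mset (Suc k) 1 + \<rho>) = W v"
      unfolding v prod.case ones cr W_def c_def t_def prod_part_weight[OF \<rho>] power_divide
      by (simp add: power_add)
  next
    fix \<pi> :: "nat multiset" assume "\<pi> \<in> {\<pi>. 0 \<notin># \<pi> \<and> 1 \<in># \<pi>}"
    then have p: "0 \<notin># \<pi>" "1 \<in># \<pi>" by auto
    then have "Suc (count \<pi> 1 - 1) = count \<pi> 1" by simp
    then show "(case (count \<pi> 1 - 1, {#j \<in># \<pi>. j \<noteq> 1#}) of (k, \<rho>) \<Rightarrow> replicate_mset (Suc k) 1 + \<rho>) = \<pi>"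
      by (auto simp: multiset_eq_iff)
    show "(count \<pi> 1 - 1, {#j \<in># \<pi>. j \<noteq> 1#}) \<in> UNIV \<times> R"
    proof -
      have "j \<ge> 2" if "j \<in># \<pi>" "j \<noteq> 1" for j using that p by (cases "j = 0") auto
      then show ?thesis by (auto simp: R_def)
    qed
  qed simp
  finally show ?thesis
  proof (rule iffD1[OF has_sum_cong_neutral, rotated -1])
    fix \<pi> :: "nat multiset" assume "\<pi> \<in> {\<pi>. 0 \<notin># \<pi>} - {\<pi>. 0 \<notin># \<pi> \<and> 1 \<in># \<pi>}"
    then have "num_ones \<pi> = 0" by (auto simp: num_ones_def count_eq_zero_iff)
    then show "of_nat (num_ones \<pi>) * z powi crank \<pi> * q ^ sum_mset \<pi> = 0" by simp
  qed auto
qed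

end

subsection \<open>Theta series\<close>

text \<open>The nontrivial Dirichlet character modulo 4. At x = 2 n + 1 it is (-1)^n, so it carries
  the signs of a theta series indexed by odd integers.\<close>

definition chi4 :: "int \<Rightarrow> int" where
  "chi4 x = (if x mod 4 = 1 then 1 else if x mod 4 = 3 then -1 else 0)"

lemma chi4_neg: "chi4 (- x) = - chi4 x"
proof -
  have "x mod 4 = 0 \<or> x mod 4 = 1 \<or> x mod 4 = 2 \<or> x mod 4 = 3" by presburger
  then show ?thesis by (auto simp: chi4_def zmod_zminus1_eq_if)
qed

lemma chi4_add2: "chi4 (x + 2) = - chi4 x"
proof -
  have "x mod 4 = 0 \<or> x mod 4 = 1 \<or> x mod 4 = 2 \<or> x mod 4 = 3" by presburger
  then show ?thesis by (auto simp: chi4_def mod_add_eq[symmetric, of x])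
qed

lemma chi4_even: "even x \<Longrightarrow> chi4 x = 0"
  unfolding chi4_def by presburger

lemma norm_chi4: "norm (of_int (chi4 x) :: complex) \<le> 1"
  by (simp add: chi4_def)

text \<open>The decay under which the bilateral series \<open>bil\<close> converges absolutely on
  the whole punctured plane.\<close>

definition rapid :: "(int \<Rightarrow> complex) \<Rightarrow> bool" where
  "rapid a \<longleftrightarrow> (\<forall>R>0. (\<lambda>x. norm (a x) * R ^ nat \<bar>x\<bar>) summable_on UNIV)"

definition bil :: "(int \<Rightarrow> complex) \<Rightarrow> complex \<Rightarrow> complex" where
  "bil a u = (\<Sum>\<^sub>\<infinity>x. a x * u powi x)"

lemma norm_powi_le:
  fixes u :: complex
  assumes "u \<noteq> 0"
  shows "norm (u powi x) \<le> (max (norm u) (1 / norm u)) ^ nat \<bar>x\<bar>"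
proof (cases "x \<ge> 0")
  case True
  then show ?thesis
    by (auto simp: power_int_def norm_power intro!: power_mono)
next
  case False
  then show ?thesis
    by (auto simp: power_int_def norm_power norm_inverse divide_inverse power_inverse[symmetric] intro!: power_mono)
qed

lemma rapid_summable_norm:
  assumes "rapid a" "u \<noteq> 0"
  shows "(\<lambda>x. norm (a x * u powi x)) summable_on UNIV"
proof -
  have "max (norm u) (1 / norm u) > 0" using assms by (simp add: less_max_iff_disj)
  then have "(\<lambda>x. norm (a x) * (max (norm u) (1 / norm u)) ^ nat \<bar>x\<bar>) summable_on UNIV"
    using assms(1) by (auto simp: rapid_def)
  then show ?thesis
    by (rule Infinite_Sum.abs_summable_on_comparison_test')
       (simp add: norm_mult mult_left_mono norm_powi_le[OF assms(2)])
qed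

lemma bil_has_sum:
  assumes "rapid a" "u \<noteq> 0"
  shows "((\<lambda>x. a x * u powi x) has_sum bil a u) UNIV"
  unfolding bil_def by (rule has_sum_infsum[OF abs_summable_summable[OF rapid_summable_norm[OF assms]]])

text \<open>The factor x is absorbed by doubling the radius, as |x| <= 2^|x|.\<close>

lemma rapid_weight:
  assumes "rapid a"
  shows "rapid (\<lambda>x. of_int x * a x)"
  unfolding rapid_def
proof (intro allI impI)
  fix R :: real assume R: "R > 0"
  have "(\<lambda>x. norm (a x) * (2 * R) ^ nat \<bar>x\<bar>) summable_on UNIV"
    using assms[unfolded rapid_def, THEN spec, of "2 * R"] R by simp
  then have "(\<lambda>x. norm (norm (of_int x * a x) * R ^ nat \<bar>x\<bar>)) summable_on UNIV"
  proof (rule Infinite_Sum.abs_summable_on_comparison_test')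
    fix x :: int
    have "real (nat \<bar>x\<bar>) \<le> 2 ^ nat \<bar>x\<bar>"
      using less_exp[of "nat \<bar>x\<bar>"] by (metis of_nat_less_numeral_power_cancel_iff less_imp_le)
    then have "real_of_int \<bar>x\<bar> \<le> 2 ^ nat \<bar>x\<bar>" by simp
    then have "real_of_int \<bar>x\<bar> * (norm (a x) * R ^ nat \<bar>x\<bar>) \<le> 2 ^ nat \<bar>x\<bar> * (norm (a x) * R ^ nat \<bar>x\<bar>)"
      using R by (intro mult_right_mono) auto
    then show "norm (norm (of_int x * a x) * R ^ nat \<bar>x\<bar>) \<le> norm (a x) * (2 * R) ^ nat \<bar>x\<bar>"
      using R by (simp add: norm_mult power_mult_distrib mult_ac abs_mult)
  qed
  then show "(\<lambda>x. norm (of_int x * a x) * R ^ nat \<bar>x\<bar>) summable_on UNIV"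
    by (rule abs_summable_summable)
qed

text \<open>Both halves contain the index 0, hence the correction \<open>a 0\<close>.\<close>

lemma bil_split:
  assumes "rapid a" "u \<noteq> 0"
  shows "(\<lambda>n. a (int n) * u ^ n) sums (bil a u - (\<Sum>n. a (- int n) * (1 / u) ^ n) + a 0)"
    and "summable (\<lambda>n. a (int n) * u ^ n)" "summable (\<lambda>n. a (- int n) * (1 / u) ^ n)"
proof -
  let ?f = "\<lambda>x. a x * u powi x"
  have s: "?f summable_on X" for X
    by (rule summable_on_subset_banach[OF abs_summable_summable[OF rapid_summable_norm[OF assms]] subset_UNIV])
  have 1: "((\<lambda>n. ?f (int n)) has_sum infsum ?f {0..}) UNIV"
    by (rule iffD2[OF has_sum_reindex_bij_betw has_sum_infsum[OF s]])
       (rule bij_betwI[of _ _ _ nat], auto)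
  have 2: "((\<lambda>n. ?f (- int n)) has_sum infsum ?f {..0}) UNIV"
    by (rule iffD2[OF has_sum_reindex_bij_betw has_sum_infsum[OF s]])
       (rule bij_betwI[of _ _ _ "\<lambda>x. nat (- x)"], auto)
  have e1: "?f (int n) = a (int n) * u ^ n" and e2: "?f (- int n) = a (- int n) * (1 / u) ^ n" for n
    by (simp_all add: power_int_minus power_one_over inverse_eq_divide)
  note 1 = has_sum_imp_sums[OF 1, unfolded e1] and 2 = has_sum_imp_sums[OF 2, unfolded e2]
  have "bil a u = infsum ?f ({0..} \<union> {..<0})"
    unfolding bil_def by (rule arg_cong[of _ _ "infsum _"]) auto
  also have "\<dots> = infsum ?f {0..} + infsum ?f {..<0}"
    by (rule infsum_Un_disjoint) (use s in auto)
  also have "infsum ?f {..0} = infsum ?f (insert 0 {..<0})"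
    by (rule arg_cong[of _ _ "infsum _"]) auto
  then have "infsum ?f {..<0} = infsum ?f {..0} - a 0"
    using s by (simp add: infsum_insert)
  finally have "infsum ?f {0..} = bil a u - (\<Sum>n. a (- int n) * (1 / u) ^ n) + a 0"
    using 2 by (simp add: sums_iff)
  then show "(\<lambda>n. a (int n) * u ^ n) sums (bil a u - (\<Sum>n. a (- int n) * (1 / u) ^ n) + a 0)"
    using 1 by simp
  show "summable (\<lambda>n. a (int n) * u ^ n)" "summable (\<lambda>n. a (- int n) * (1 / u) ^ n)"
    using 1 2 by (auto simp: summable_def)
qed

lemma powser_weighted_deriv:
  fixes c :: "nat \<Rightarrow> complex"
  assumes "\<And>y. summable (\<lambda>n. c n * y ^ n)"
  shows "\<exists>D. ((\<lambda>x. \<Sum>n. c n * x ^ n) has_field_derivative D) (at x) \<and> x * D = (\<Sum>n. of_nat n * c n * x ^ n)"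
proof (intro exI conjI)
  show "((\<lambda>x. \<Sum>n. c n * x ^ n) has_field_derivative (\<Sum>n. diffs c n * x ^ n)) (at x)"
    by (rule termdiffs_strong_converges_everywhere[OF assms])
  have "summable (\<lambda>n. diffs c n * x ^ n)"
    by (rule termdiff_converges_all[OF assms])
  then have "(\<lambda>n. x * (diffs c n * x ^ n)) sums (x * (\<Sum>n. diffs c n * x ^ n))"
    by (intro sums_mult summable_sums)
  moreover have "x * (diffs c n * x ^ n) = of_nat (Suc n) * c (Suc n) * x ^ Suc n" for n
    by (simp add: diffs_def)
  ultimately have "(\<lambda>n. of_nat (Suc n) * c (Suc n) * x ^ Suc n) sums (x * (\<Sum>n. diffs c n * x ^ n))"
    by simp
  from sums_Suc[OF this] show "x * (\<Sum>n. diffs c n * x ^ n) = (\<Sum>n. of_nat n * c n * x ^ n)"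
    by (simp add: sums_iff)
qed

text \<open>Away from 0 the series is P(u) + N(1/u) - a(0) with entire power series P and N, so only
  power series have to be differentiated termwise.\<close>

lemma bil_deriv:
  assumes a: "rapid a" and u: "u \<noteq> 0"
  shows "(bil a has_field_derivative bil (\<lambda>x. of_int x * a x) u / u) (at u)"
proof -
  define P where "P = (\<lambda>x. \<Sum>n. a (int n) * x ^ n)"
  define N where "N = (\<lambda>x. \<Sum>n. a (- int n) * x ^ n)"
  have sP: "summable (\<lambda>n. a (int n) * y ^ n)" for y
  proof (cases "y = 0")
    case False then show ?thesis using bil_split(2)[OF a] by simp
  qed simp
  have sN: "summable (\<lambda>n. a (- int n) * y ^ n)" for y
  proof (cases "y = 0")
    case False then show ?thesis using bil_split(3)[OF a, of "1 / y"] by simp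
  qed simp
  have eq: "bil a v = P v + N (1 / v) - a 0" if "v \<noteq> 0" for v
    using bil_split(1)[OF a that] by (simp add: P_def N_def sums_iff)
  obtain D where D: "(P has_field_derivative D) (at u)" "u * D = (\<Sum>n. of_nat n * a (int n) * u ^ n)"
    using powser_weighted_deriv[OF sP] unfolding P_def by blast
  obtain D' where D': "(N has_field_derivative D') (at (1 / u))"
      "1 / u * D' = (\<Sum>n. of_nat n * a (- int n) * (1 / u) ^ n)"
    using powser_weighted_deriv[OF sN] unfolding N_def by blast
  have "((\<lambda>v. N (1 / v)) has_field_derivative D' * (- 1 / (u * u))) (at u)"
    by (rule DERIV_chain2[of N D' "\<lambda>v. 1 / v" u]) (use D' u in \<open>auto intro!: derivative_eq_intros\<close>)
  then have "((\<lambda>v. P v + N (1 / v) - a 0) has_field_derivative (D + D' * (- 1 / (u * u)) - 0)) (at u)"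
    by (intro DERIV_add DERIV_diff D DERIV_const)
  then have "(bil a has_field_derivative (D + D' * (- 1 / (u * u)) - 0)) (at u)"
    by (rule has_field_derivative_transform_within_open[of _ _ _ "- {0}"]) (use u eq in auto)
  moreover have "bil (\<lambda>x. of_int x * a x) u = u * D - 1 / u * D'"
  proof -
    have "(\<Sum>n. of_int (- int n) * a (- int n) * (1 / u) ^ n) = - (\<Sum>n. of_nat n * a (- int n) * (1 / u) ^ n)"
      using bil_split(3)[OF rapid_weight[OF a] u]
      by (subst suminf_minus[symmetric]) (use summable_minus_iff in \<open>fastforce+\<close>)
    then show ?thesis
      using bil_split(1)[OF rapid_weight[OF a] u] D(2) D'(2) by (simp add: sums_iff)
  qed
  then have "D + D' * (- 1 / (u * u)) - 0 = bil (\<lambda>x. of_int x * a x) u / u"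
    using u by (simp add: diff_divide_distrib)
  ultimately show ?thesis by simp
qed

lemma bil_holomorphic:
  assumes "rapid a"
  shows "bil a holomorphic_on - {0}"
  unfolding holomorphic_on_def field_differentiable_def
  using bil_deriv[OF assms] has_field_derivative_at_within by blast

text \<open>Once n >= 24 M, the exponent is at least M n, so each step gains a factor r^M that can
  be made to beat R. The divisor 24 is small enough decay for both theta series below.\<close>

lemma summable_theta_bound:
  fixes r R :: real
  assumes r: "0 \<le> r" "r < 1" and R: "R > 0"
  shows "summable (\<lambda>n. r ^ (n\<^sup>2 div 24) * R ^ n)"
proof -
  have "(\<lambda>M. r ^ M * R) \<longlonglongrightarrow> 0 * R"
    using r by (intro tendsto_mult LIMSEQ_realpow_zero tendsto_const) auto
  then have "eventually (\<lambda>M. r ^ M * R < 1 / 2) sequentially"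
    by (rule order_tendstoD) simp
  then obtain M where M: "r ^ M * R < 1 / 2" by (auto simp: eventually_sequentially)
  show ?thesis
  proof (rule summable_comparison_test')
    show "summable (\<lambda>n. (1 / 2 :: real) ^ n)" by (intro summable_geometric) auto
    fix n assume n: "n \<ge> 24 * M"
    have "24 * (M * n) \<le> n\<^sup>2" using n by (simp add: power2_eq_square)
    then have "M * n \<le> n\<^sup>2 div 24" by (simp add: less_eq_div_iff_mult_less_eq mult.commute)
    then have "r ^ (n\<^sup>2 div 24) \<le> r ^ (M * n)" using r by (intro power_decreasing) auto
    then have "r ^ (n\<^sup>2 div 24) * R ^ n \<le> (r ^ M * R) ^ n"
      using R by (simp add: power_mult power_mult_distrib mult_right_mono)
    also have "\<dots> \<le> (1 / 2) ^ n" using M r R by (intro power_mono) auto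
    finally show "norm (r ^ (n\<^sup>2 div 24) * R ^ n) \<le> (1 / 2) ^ n" using r R by simp
  qed
qed

lemma rapidI:
  assumes q: "norm q < 1" and a: "\<And>x. norm (a x) \<le> norm q ^ nat (x\<^sup>2 div 24)"
  shows "rapid a"
  unfolding rapid_def
proof (intro allI impI)
  fix R :: real assume R: "R > 0"
  let ?h = "\<lambda>x::int. norm q ^ nat (x\<^sup>2 div 24) * R ^ nat \<bar>x\<bar>"
  have sq: "nat ((int n)\<^sup>2 div 24) = n\<^sup>2 div 24" for n
    by (metis nat_int of_nat_numeral of_nat_power zdiv_int)
  have s: "(\<lambda>n. norm q ^ (n\<^sup>2 div 24) * R ^ n) summable_on UNIV"
    using summable_theta_bound[of "norm q" R] q R by (intro summable_nonneg_imp_summable_on) auto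
  have "?h summable_on range int"
    using s by (subst summable_on_reindex) (auto simp: o_def sq)
  moreover have "?h summable_on range (\<lambda>n. - int n)"
    using s by (subst summable_on_reindex) (auto simp: o_def sq inj_on_def)
  ultimately have "?h summable_on (range int \<union> range (\<lambda>n. - int n))"
    by (rule summable_on_union)
  moreover have "range int \<union> range (\<lambda>n. - int n) = UNIV"
    by (auto simp: image_iff) (metis int_cases2)
  ultimately have "?h summable_on UNIV" by simp
  then have "(\<lambda>x. norm (norm (a x) * R ^ nat \<bar>x\<bar>)) summable_on UNIV"
    by (rule Infinite_Sum.abs_summable_on_comparison_test') (use R a in \<open>simp add: mult_right_mono\<close>)
  then show "(\<lambda>x. norm (a x) * R ^ nat \<bar>x\<bar>) summable_on UNIV" by (rule abs_summable_summable)
qed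

text \<open>Up to a power of \<open>q\<close>, this is the odd Jacobi theta function in the square root \<open>u\<close> of the usual variable, so that
  \<open>th q u = (u - 1 / u) (q;q) (q u\<^sup>2;q) (q u\<^sup>-\<^sup>2;q)\<close>.\<close>

definition th_coeff :: "complex \<Rightarrow> int \<Rightarrow> complex" where
  "th_coeff q x = of_int (chi4 x) * q ^ nat ((x\<^sup>2 - 1) div 8)"

definition th :: "complex \<Rightarrow> complex \<Rightarrow> complex" where
  "th q = bil (th_coeff q)"

text \<open>Formally, the part of the theta series with q^(1/3) in place of q whose indices are
  prime to 3. The indices divisible by 3 give, up to a constant factor, the series \<open>al\<close>
  below.\<close>

definition be_coeff :: "complex \<Rightarrow> int \<Rightarrow> complex" where
  "be_coeff q x = (if 3 dvd x then 0 else of_int (chi4 x) * q ^ nat ((x\<^sup>2 - 1) div 24))"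

definition be :: "complex \<Rightarrow> complex \<Rightarrow> complex" where
  "be q = bil (be_coeff q)"

lemma rapid_th:
  assumes q: "norm q < 1" shows "rapid (th_coeff q)"
proof (rule rapidI[OF q])
  fix x :: int
  show "norm (th_coeff q x) \<le> norm q ^ nat (x\<^sup>2 div 24)"
  proof (cases "odd x")
    case True
    have "x\<^sup>2 div 24 \<le> (x\<^sup>2 - 1) div 8"
    proof -
      have "x\<^sup>2 \<ge> 1" using True by (cases "x = 0") (auto simp: int_one_le_iff_zero_less)
      then have "8 * (x\<^sup>2 div 24) \<le> x\<^sup>2 - 1"
        using mult_div_mod_eq[of 24 "x\<^sup>2"] pos_mod_sign[of 24 "x\<^sup>2"] by (cases "x\<^sup>2 div 24 \<le> 0") linarith+
      then show ?thesis using zdiv_mono1[of "8 * (x\<^sup>2 div 24)" "x\<^sup>2 - 1" 8] by simp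
    qed
    then have "norm q ^ nat ((x\<^sup>2 - 1) div 8) \<le> norm q ^ nat (x\<^sup>2 div 24)"
      using q by (intro power_decreasing nat_mono) auto
    moreover have "norm (th_coeff q x) \<le> 1 * norm q ^ nat ((x\<^sup>2 - 1) div 8)"
      unfolding th_coeff_def norm_mult norm_power by (intro mult_right_mono norm_chi4) auto
    ultimately show ?thesis by simp
  qed (simp add: th_coeff_def chi4_even)
qed

lemma rapid_be:
  assumes q: "norm q < 1" shows "rapid (be_coeff q)"
proof (rule rapidI[OF q])
  fix x :: int
  show "norm (be_coeff q x) \<le> norm q ^ nat (x\<^sup>2 div 24)"
  proof (cases "odd x \<and> \<not> 3 dvd x")
    case True
    have "x\<^sup>2 div 24 \<le> (x\<^sup>2 - 1) div 24"
    proof -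
      have "x mod 24 \<in> {1,5,7,11,13,17,19,23}" using True by simp presburger
      then have "(x mod 24)\<^sup>2 mod 24 = 1" by auto
      then have "x\<^sup>2 mod 24 = 1" by (simp add: power_mod)
      then show ?thesis by presburger
    qed
    then have "norm q ^ nat ((x\<^sup>2 - 1) div 24) \<le> norm q ^ nat (x\<^sup>2 div 24)"
      using q by (intro power_decreasing nat_mono) auto
    moreover have "norm (be_coeff q x) \<le> 1 * norm q ^ nat ((x\<^sup>2 - 1) div 24)"
      using True unfolding be_coeff_def by (simp add: norm_mult norm_power) (intro mult_left_le_one_le, auto simp: chi4_def)
    ultimately show ?thesis by simp
  qed (auto simp: be_coeff_def chi4_even)
qed

lemma has_sum_diff_complex:
  fixes f g :: "'a \<Rightarrow> complex"
  assumes "(f has_sum S) A" "(g has_sum T) A"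
  shows "((\<lambda>x. f x - g x) has_sum (S - T)) A"
  using has_sum_add[OF assms(1) has_sum_uminusI[OF assms(2)]] by simp

section \<open>The Jacobi triple product\<close>

context
  fixes q :: complex
  assumes q: "norm q < 1" and q0: "q \<noteq> 0"
begin

text \<open>1 / (q;q)_m. The value 0 at negative m lets sums over all integers terminate by
  themselves.\<close>

definition iq :: "int \<Rightarrow> complex" where
  "iq m = (if m < 0 then 0 else 1 / (\<Prod>i<nat m. 1 - q ^ Suc i))"

lemma iq_rec: "iq (m - 1) = (1 - q powi m) * iq m"
proof (cases "m > 0")
  case True
  then have "m = int (Suc (nat m - 1))" by simp
  then obtain k where k: "m = int (Suc k)" by blast
  have "nat (1 + int k) = Suc k" by simp
  then have "iq m = 1 / ((\<Prod>i<k. 1 - q ^ Suc i) * (1 - q ^ Suc k))"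
    by (simp add: iq_def k)
  moreover have "iq (m - 1) = 1 / (\<Prod>i<k. 1 - q ^ Suc i)"
    by (simp add: iq_def k)
  moreover have "q powi m = q ^ Suc k" unfolding k power_int_of_nat ..
  moreover have "1 - q ^ Suc k \<noteq> 0" using qpow_Suc_neq_1[OF q, of k] by (metis right_minus_eq)
  ultimately show ?thesis by (simp del: power_Suc)
next
  case False
  then show ?thesis by (cases "m = 0") (auto simp: iq_def)
qed

text \<open>The Gaussian binomial coefficient with upper index 2 N + 1 and lower index N - n; it is
  supported on -N - 1 <= n <= N.\<close>

definition gJ :: "nat \<Rightarrow> int \<Rightarrow> complex" where
  "gJ N n = (\<Prod>i<2 * N + 1. 1 - q ^ Suc i) * iq (int N - n) * iq (int N + 1 + n)"

text \<open>A q-Pascal rule in which the upper index grows by 2. With X = q^N and Y = q^n, and the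
  common factors \<open>Pr\<close> and \<open>I\<close> removed, it is an identity of rational
  functions.\<close>

lemma gJ_rec:
  "gJ (Suc N) n = (1 + q ^ (2 * N + 2)) * gJ N n + q powi (int N + 1 - n) * gJ N (n - 1)
     + q powi (int N + 2 + n) * gJ N (n + 1)"
proof -
  define X where "X = q ^ N"
  define Y where "Y = q powi n"
  have XY: "X \<noteq> 0" "Y \<noteq> 0" using q0 by (simp_all add: X_def Y_def)
  define I where "I = iq (int N + 1 - n) * iq (int N + 2 + n)"
  define Pr where "Pr = (\<Prod>i<2 * N + 1. 1 - q ^ Suc i)"
  have e: "q powi (int N + 1 - n) = q * X / Y" "q powi (int N + 2 + n) = q * q * X * Y"
    "q powi (int N + 1 + n) = q * X * Y" "q powi (int N - n) = X / Y"
    "q ^ (2 * N + 2) = q * q * X * X" "q ^ (2 * N + 3) = q * q * q * X * X"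
    using q0 by (simp_all add: power_int_add power_int_diff X_def Y_def power_add power_mult
        power2_eq_square power3_eq_cube eval_nat_numeral mult_2 mult_ac)
  have 1: "iq (int N - n) = (1 - q * X / Y) * iq (int N + 1 - n)"
    using iq_rec[of "int N + 1 - n", unfolded e] by simp
  have 2: "iq (int N + 1 + n) = (1 - q * q * X * Y) * iq (int N + 2 + n)"
    using iq_rec[of "int N + 2 + n", unfolded e] by (simp add: add.commute add.left_commute)
  have 3: "iq (int N + n) = (1 - q * X * Y) * iq (int N + 1 + n)"
    using iq_rec[of "int N + 1 + n", unfolded e] by (simp add: add.commute add.left_commute)
  have 4: "iq (int N - n - 1) = (1 - X / Y) * iq (int N - n)"
    using iq_rec[of "int N - n", unfolded e] .
  have g0: "gJ N n = Pr * ((1 - q * X / Y) * (1 - q * q * X * Y)) * I"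
    by (simp add: gJ_def Pr_def I_def 1 2 mult_ac)
  have g1: "gJ N (n - 1) = Pr * ((1 - q * X * Y) * (1 - q * q * X * Y)) * I"
  proof -
    have "gJ N (n - 1) = Pr * iq (int N + 1 - n) * iq (int N + n)"
      by (simp add: gJ_def Pr_def algebra_simps)
    then show ?thesis by (simp add: I_def 3 2 mult_ac)
  qed
  have g2: "gJ N (n + 1) = Pr * ((1 - X / Y) * (1 - q * X / Y)) * I"
  proof -
    have "gJ N (n + 1) = Pr * iq (int N - n - 1) * iq (int N + 2 + n)"
      by (simp add: gJ_def Pr_def algebra_simps)
    then show ?thesis by (simp add: I_def 4 1 mult_ac)
  qed
  have g3: "gJ (Suc N) n = Pr * ((1 - q * q * X * X) * (1 - q * q * q * X * X)) * I"
  proof -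
    have "(\<Prod>i<2 * Suc N + 1. 1 - q ^ Suc i) = Pr * (1 - q ^ (2 * N + 2)) * (1 - q ^ (2 * N + 3))"
      by (simp add: Pr_def numeral_3_eq_3)
    then have "gJ (Suc N) n = Pr * (1 - q ^ (2 * N + 2)) * (1 - q ^ (2 * N + 3)) *
        iq (int N + 1 - n) * iq (int N + 2 + n)"
      by (simp only: gJ_def) (simp add: algebra_simps)
    then show ?thesis unfolding e I_def by (simp only: mult_ac)
  qed
  have "(1 - q * q * X * X) * (1 - q * q * q * X * X) =
      (1 + q * q * X * X) * ((1 - q * X / Y) * (1 - q * q * X * Y))
      + q * X / Y * ((1 - q * X * Y) * (1 - q * q * X * Y))
      + q * q * X * Y * ((1 - X / Y) * (1 - q * X / Y))"
    using XY by (simp add: field_simps)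
  then have "Pr * ((1 - q * q * X * X) * (1 - q * q * q * X * X)) * I =
      Pr * ((1 + q * q * X * X) * ((1 - q * X / Y) * (1 - q * q * X * Y))
      + q * X / Y * ((1 - q * X * Y) * (1 - q * q * X * Y))
      + q * q * X * Y * ((1 - X / Y) * (1 - q * X / Y))) * I" by (simp only:)
  then show ?thesis unfolding g0 g1 g2 g3 e by (simp only: distrib_left distrib_right mult_ac)
qed

text \<open>This is \<open>th_coeff q (2 * n + 1)\<close>, indexed by all integers instead of the
  odd ones.\<close>

definition tJ :: "int \<Rightarrow> complex" where
  "tJ n = (if even n then 1 else -1) * q powi (n * (n + 1) div 2)"

lemma tJ_shift: "tJ (n - 1) = - (q powi (- n)) * tJ n" "tJ (n + 1) = - (q powi (n + 1)) * tJ n"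
proof -
  have "(n - 1) * (n - 1 + 1) div 2 = n * (n + 1) div 2 - n"
  proof -
    have "(n - 1) * (n - 1 + 1) = n * (n + 1) - 2 * n" by (simp add: algebra_simps)
    then show ?thesis by simp
  qed
  then have "q powi ((n - 1) * (n - 1 + 1) div 2) = q powi (- n) * q powi (n * (n + 1) div 2)"
    using q0 by (simp add: power_int_diff power_int_minus divide_inverse)
  then show "tJ (n - 1) = - (q powi (- n)) * tJ n" unfolding tJ_def by simp
  have "(n + 1) * (n + 1 + 1) div 2 = n * (n + 1) div 2 + (n + 1)"
  proof -
    have "(n + 1) * (n + 1 + 1) = n * (n + 1) + 2 * (n + 1)" by (simp add: algebra_simps)
    then show ?thesis by simp
  qed
  then have "q powi ((n + 1) * (n + 1 + 1) div 2) = q powi (n + 1) * q powi (n * (n + 1) div 2)"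
    using q0 by (simp add: power_int_add)
  then show "tJ (n + 1) = - (q powi (n + 1)) * tJ n" unfolding tJ_def by simp
qed

text \<open>Multiplying by the two new factors combines the terms at n - 1, n and n + 1, and the
  quotients of \<open>tJ\<close> turn this into the three terms of \<open>gJ_rec\<close>.\<close>

lemma finite_triple_product:
  assumes u: "u \<noteq> 0"
  shows "((\<lambda>n. tJ n * gJ N n * u powi (2 * n + 1)) has_sum
     ((u - 1 / u) * (\<Prod>k<N. (1 - q * u\<^sup>2 * q ^ k) * (1 - q / u\<^sup>2 * q ^ k)))) UNIV"
proof (induction N)
  case 0
  have i: "iq 0 = 1" "iq 1 = 1 / (1 - q)" by (simp_all add: iq_def)
  have "1 - q \<noteq> 0" using q by auto
  then have v: "tJ 0 * gJ 0 0 * u powi (2 * 0 + 1) = u" "tJ (-1) * gJ 0 (-1) * u powi (2 * (-1) + 1) = - 1 / u"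
    by (simp_all add: gJ_def i tJ_def power_int_minus divide_inverse)
  show ?case
  proof (rule has_sum_finite_neutralI[of "{-1, 0}"])
    fix n :: int assume "n \<in> UNIV - {-1, 0}"
    then have "gJ 0 n = 0" by (cases "n > 0") (auto simp: gJ_def iq_def)
    then show "tJ n * gJ 0 n * u powi (2 * n + 1) = 0" by simp
  qed (use v in auto)
next
  case (Suc N)
  define F where "F = (\<lambda>n. tJ n * gJ N n * u powi (2 * n + 1))"
  define S where "S = (u - 1 / u) * (\<Prod>k<N. (1 - q * u\<^sup>2 * q ^ k) * (1 - q / u\<^sup>2 * q ^ k))"
  have F: "(F has_sum S) UNIV" using Suc by (simp add: F_def S_def)
  have m: "((\<lambda>n. F (n - 1)) has_sum S) UNIV" and p: "((\<lambda>n. F (n + 1)) has_sum S) UNIV"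
    using F by (simp_all add: has_sum_reindex_bij_witness[of UNIV "\<lambda>n. n + 1" "\<lambda>n. n - 1" UNIV F]
      has_sum_reindex_bij_witness[of UNIV "\<lambda>n. n - 1" "\<lambda>n. n + 1" UNIV F])
  have "((\<lambda>n. (1 + q ^ (2 * N + 2)) * F n - q ^ Suc N * u\<^sup>2 * F (n - 1) - q ^ Suc N / u\<^sup>2 * F (n + 1)) has_sum
     ((1 + q ^ (2 * N + 2)) * S - q ^ Suc N * u\<^sup>2 * S - q ^ Suc N / u\<^sup>2 * S)) UNIV"
    by (intro has_sum_diff_complex has_sum_cmult_right F m p)
  moreover have "(1 + q ^ (2 * N + 2)) * F n - q ^ Suc N * u\<^sup>2 * F (n - 1) - q ^ Suc N / u\<^sup>2 * F (n + 1) =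
      tJ n * gJ (Suc N) n * u powi (2 * n + 1)" for n
  proof -
    have um: "u powi (2 * (n - 1) + 1) = u powi (2 * n + 1) / u\<^sup>2"
    proof -
      have "2 * (n - 1) + 1 = (2 * n + 1) - int 2" by simp
      then show ?thesis using u by (simp only: power_int_diff[OF disjI1[OF u]] power_int_of_nat)
    qed
    have up: "u powi (2 * (n + 1) + 1) = u powi (2 * n + 1) * u\<^sup>2"
    proof -
      have "2 * (n + 1) + 1 = (2 * n + 1) + int 2" by simp
      then show ?thesis using u by (simp only: power_int_add[OF disjI1[OF u]] power_int_of_nat)
    qed
    have e1: "q ^ Suc N * q powi (- n) = q powi (int N + 1 - n)"
    proof -
      have "int N + 1 - n = int (Suc N) + (- n)" by simp
      then show ?thesis by (simp only: power_int_add[OF disjI1[OF q0]] power_int_of_nat)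
    qed
    have e2: "q ^ Suc N * q powi (n + 1) = q powi (int N + 2 + n)"
    proof -
      have "int N + 2 + n = int (Suc N) + (n + 1)" by simp
      then show ?thesis by (simp only: power_int_add[OF disjI1[OF q0]] power_int_of_nat)
    qed
    have "q ^ Suc N * u\<^sup>2 * F (n - 1) = - (q ^ Suc N * q powi (- n)) * gJ N (n - 1) * tJ n * u powi (2 * n + 1)"
      unfolding F_def tJ_shift um using u by simp
    moreover have "q ^ Suc N / u\<^sup>2 * F (n + 1) = - (q ^ Suc N * q powi (n + 1)) * gJ N (n + 1) * tJ n * u powi (2 * n + 1)"
      unfolding F_def tJ_shift up using u by simp
    ultimately show ?thesis unfolding gJ_rec e1 e2 by (simp add: F_def algebra_simps)
  qed
  moreover have "(1 + q ^ (2 * N + 2)) * S - q ^ Suc N * u\<^sup>2 * S - q ^ Suc N / u\<^sup>2 * S =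
      S * ((1 - q * u\<^sup>2 * q ^ N) * (1 - q / u\<^sup>2 * q ^ N))"
  proof -
    have "q ^ (2 * N + 2) = q ^ Suc N * q ^ Suc N"
      unfolding power_add[symmetric] by (rule arg_cong[of _ _ "power q"]) simp
    then show ?thesis using u by (simp add: field_simps)
  qed
  ultimately show ?case by (simp add: S_def mult_ac)
qed

lemma rapid_tJ_summable:
  assumes u: "u \<noteq> 0"
  shows "((\<lambda>n. tJ n * u powi (2 * n + 1)) has_sum th q u) UNIV"
    and "(\<lambda>n. norm (tJ n * u powi (2 * n + 1))) summable_on UNIV"
proof -
  have t: "th_coeff q (2 * n + 1) = tJ n" for n
  proof -
    have "(2 * n + 1)\<^sup>2 - 1 = 8 * (n * (n + 1) div 2)"
    proof -
      have "even (n * (n + 1))" by simp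
      then have "8 * (n * (n + 1) div 2) = 4 * (n * (n + 1))" by simp
      then show ?thesis by (simp only:) (simp add: power2_eq_square algebra_simps)
    qed
    then have e: "((2 * n + 1)\<^sup>2 - 1) div 8 = n * (n + 1) div 2" by simp
    have "n * (n + 1) \<ge> 0" by (cases "n \<ge> 0") (auto simp: mult_nonpos_nonpos)
    then have "n * (n + 1) div 2 \<ge> 0" by simp
    moreover have "chi4 (2 * n + 1) = (if even n then 1 else -1)"
      unfolding chi4_def by presburger
    ultimately show ?thesis unfolding th_coeff_def tJ_def e by (simp add: power_int_def)
  qed
  have b: "bij_betw (\<lambda>n. 2 * n + 1) UNIV {x::int. odd x}"
    by (rule bij_betwI[of _ _ _ "\<lambda>x. (x - 1) div 2"]) auto
  have "((\<lambda>x. th_coeff q x * u powi x) has_sum th q u) UNIV"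
    unfolding th_def by (rule bil_has_sum[OF rapid_th[OF q] u])
  then have "((\<lambda>x. th_coeff q x * u powi x) has_sum th q u) {x. odd x}"
    by (rule iffD1[OF has_sum_cong_neutral, rotated -1]) (auto simp: th_coeff_def chi4_even)
  then show "((\<lambda>n. tJ n * u powi (2 * n + 1)) has_sum th q u) UNIV"
    unfolding t[symmetric] by (subst has_sum_reindex_bij_betw[OF b])
  then show "(\<lambda>n. norm (tJ n * u powi (2 * n + 1))) summable_on UNIV"
    by (rule iffD1[OF summable_on_iff_abs_summable_on_complex has_sum_imp_summable])
qed

text \<open>As N grows, \<open>gJ N n\<close> stays bounded and tends to 1 / (q;q), so dominated
  convergence passes to the limit in the finite form.\<close>

theorem triple_product:
  assumes u: "u \<noteq> 0"
  shows "th q u = (u - 1 / u) * qpoch q q * qpoch q (q * u\<^sup>2) * qpoch q (q / u\<^sup>2)"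
proof -
  let ?E = "qpoch q q"
  let ?P = "\<lambda>M. \<Prod>i<M. 1 - q ^ Suc i"
  have E0: "?E \<noteq> 0" by (rule qpoch_nonzero'[OF q q])
  have P: "?P \<longlonglongrightarrow> ?E"
    using qpoch_tendsto[OF q, of q] by simp
  have iP: "(\<lambda>M. 1 / ?P M) \<longlonglongrightarrow> 1 / ?E" using P E0 by (intro tendsto_intros)
  obtain B1 where B1: "\<And>M. norm (?P M) \<le> B1"
    using P convergent_imp_Bseq convergentI Bseq_def by metis
  obtain B2 where B2: "\<And>M. norm (1 / ?P M) \<le> B2"
    using iP convergent_imp_Bseq convergentI Bseq_def by metis
  have B10: "B1 \<ge> 0" and B20: "B2 \<ge> 0" using B1 B2 norm_ge_zero order_trans by blast+
  have iqB: "norm (iq m) \<le> B2" for m using B2[of "nat m"] B20 by (auto simp: iq_def)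
  have gB: "norm (gJ N n) \<le> B1 * B2 * B2" for N n
    unfolding gJ_def norm_mult by (intro mult_mono B1 iqB mult_nonneg_nonneg B10 B20) auto
  have glim: "(\<lambda>N. gJ N n) \<longlonglongrightarrow> ?E * (1 / ?E) * (1 / ?E)" for n
  proof -
    have sub: "filterlim (\<lambda>N. nat (int N + c)) sequentially sequentially" for c
      unfolding filterlim_at_top
    proof
      fix Z
      show "eventually (\<lambda>N. Z \<le> nat (int N + c)) sequentially"
        unfolding eventually_sequentially by (rule exI[of _ "Z + nat \<bar>c\<bar>"]) auto
    qed
    have iql: "(\<lambda>N. iq (int N + c)) \<longlonglongrightarrow> 1 / ?E" for c
    proof (rule Lim_transform_eventually[OF filterlim_compose[OF iP sub[of c]]])
      show "eventually (\<lambda>N. 1 / ?P (nat (int N + c)) = iq (int N + c)) sequentially"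
        unfolding eventually_sequentially by (rule exI[of _ "nat \<bar>c\<bar>"]) (auto simp: iq_def)
    qed
    have s2: "filterlim (\<lambda>N::nat. 2 * N + 1) sequentially sequentially"
      by (rule filterlim_subseq) (auto simp: strict_mono_def)
    have "(\<lambda>N. ?P (2 * N + 1) * iq (int N + (- n)) * iq (int N + (1 + n))) \<longlonglongrightarrow> ?E * (1 / ?E) * (1 / ?E)"
      by (intro tendsto_mult iql filterlim_compose[OF P s2])
    then show ?thesis by (simp add: gJ_def algebra_simps)
  qed
  define h where "h = (\<lambda>n. (B1 * B2 * B2) * norm (tJ n * u powi (2 * n + 1)))"
  have "h summable_on UNIV"
    unfolding h_def by (rule summable_on_cmult_right[OF rapid_tJ_summable(2)[OF u]])
  from has_sum_dominated(1)[OF this, of "\<lambda>N n. tJ n * gJ N n * u powi (2 * n + 1)"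
        "\<lambda>n. tJ n * (1 / ?E) * u powi (2 * n + 1)"]
  have "(\<lambda>N. \<Sum>\<^sub>\<infinity>n. tJ n * gJ N n * u powi (2 * n + 1)) \<longlonglongrightarrow> (\<Sum>\<^sub>\<infinity>n. tJ n * (1 / ?E) * u powi (2 * n + 1))"
  proof (rule meta_mp[OF meta_mp, rotated 2])
    show "norm (tJ n * gJ N n * u powi (2 * n + 1)) \<le> h n" for N n
      using mult_right_mono[OF gB[of N n], of "norm (tJ n * u powi (2 * n + 1))"]
      by (simp add: h_def norm_mult mult_ac)
    show "(\<lambda>N. tJ n * gJ N n * u powi (2 * n + 1)) \<longlonglongrightarrow> tJ n * (1 / ?E) * u powi (2 * n + 1)" for n
      using glim[of n] E0 by (intro tendsto_intros) simp
  qed auto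
  moreover have "(\<Sum>\<^sub>\<infinity>n. tJ n * (1 / ?E) * u powi (2 * n + 1)) = th q u / ?E"
    using infsumI[OF has_sum_cmult_right[OF rapid_tJ_summable(1)[OF u], of "1 / ?E"]]
    by (simp add: mult_ac divide_inverse)
  moreover have "(\<Sum>\<^sub>\<infinity>n. tJ n * gJ N n * u powi (2 * n + 1)) =
      (u - 1 / u) * ((\<Prod>k<N. 1 - q * u\<^sup>2 * q ^ k) * (\<Prod>k<N. 1 - q / u\<^sup>2 * q ^ k))" for N
    using infsumI[OF finite_triple_product[OF u, of N]] by (simp add: prod.distrib)
  moreover have "(\<lambda>N. (u - 1 / u) * ((\<Prod>k<N. 1 - q * u\<^sup>2 * q ^ k) * (\<Prod>k<N. 1 - q / u\<^sup>2 * q ^ k))) \<longlonglongrightarrow>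
      (u - 1 / u) * (qpoch q (q * u\<^sup>2) * qpoch q (q / u\<^sup>2))"
    by (intro tendsto_intros qpoch_tendsto q)
  ultimately have "th q u / ?E = (u - 1 / u) * (qpoch q (q * u\<^sup>2) * qpoch q (q / u\<^sup>2))"
    using LIMSEQ_unique by simp
  then show ?thesis using E0 by (simp add: field_simps)
qed

end

subsection \<open>Quasiperiodic functions\<close>

text \<open>All values of h are attained on the compact annulus |p| <= |u| <= 1, so the entire
  function h(exp w) is bounded and Liouville's theorem applies.\<close>

lemma multiplicative_liouville:
  fixes h :: "complex \<Rightarrow> complex"
  assumes p: "0 < norm p" "norm p < 1"
    and holo: "h holomorphic_on - {0}" and per: "\<And>u. u \<noteq> 0 \<Longrightarrow> h (p * u) = h u"
  shows "\<exists>K. \<forall>u. u \<noteq> 0 \<longrightarrow> h u = K"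
proof -
  have p0: "p \<noteq> 0" using p by auto
  define Ann where "Ann = {u :: complex. norm p \<le> norm u \<and> norm u \<le> 1}"
  have "compact Ann"
  proof -
    have "Ann = cball 0 1 - ball 0 (norm p)" by (auto simp: Ann_def)
    then show ?thesis by (simp add: compact_diff)
  qed
  moreover have "continuous_on Ann h"
    by (rule continuous_on_subset[OF holomorphic_on_imp_continuous_on[OF holo]]) (use p in \<open>auto simp: Ann_def\<close>)
  ultimately have "bounded (h ` Ann)"
    using compact_continuous_image compact_imp_bounded by blast
  have pn: "h (p ^ n * u) = h u" if "u \<noteq> 0" for n u
    using that p0 by (induction n) (auto simp: per mult.assoc)
  have up: "\<exists>v\<in>Ann. h u = h v" if "u \<noteq> 0" "norm u \<le> 1" for u
  proof -
    have "\<exists>n. norm p ^ n < norm u" using that p by (intro real_arch_pow_inv) auto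
    then obtain n where n: "norm p ^ n < norm u" by blast
    have "\<exists>v\<in>Ann. h u = h v" if "norm p ^ n \<le> norm u" "norm u \<le> 1" "u \<noteq> 0" for n u
      using that
    proof (induction n arbitrary: u)
      case 0
      then show ?case using p by (intro bexI[of _ u]) (auto simp: Ann_def)
    next
      case (Suc n)
      show ?case
      proof (cases "norm p \<le> norm u")
        case True
        then show ?thesis using Suc.prems by (intro bexI[of _ u]) (auto simp: Ann_def)
      next
        case False
        have "\<exists>v\<in>Ann. h (u / p) = h v"
          using Suc.prems False p p0 by (intro Suc.IH) (auto simp: norm_divide field_simps)
        moreover have "h (u / p) = h u" using per[of "u / p"] Suc.prems p0 by simp
        ultimately show ?thesis by simp
      qed
    qed
    then show ?thesis using n that by (meson less_imp_le)
  qed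
  have "\<exists>v\<in>Ann. h u = h v" if "u \<noteq> 0" for u
  proof -
    have "\<exists>n. norm p ^ n < 1 / norm u" using that p by (intro real_arch_pow_inv) auto
    then obtain n where n: "norm p ^ n < 1 / norm u" by blast
    then have "norm (p ^ n * u) \<le> 1" using that by (simp add: norm_mult norm_power field_simps)
    then show ?thesis using up[of "p ^ n * u"] pn[OF that] that p0 by simp
  qed
  then have "range (h \<circ> exp) \<subseteq> h ` Ann" by (auto simp: image_iff)
  then have "bounded (range (h \<circ> exp))" using \<open>bounded (h ` Ann)\<close> bounded_subset by blast
  moreover have "(h \<circ> exp) holomorphic_on UNIV"
    by (intro holomorphic_on_compose_gen[OF _ holo] holomorphic_intros) auto
  ultimately have "(h \<circ> exp) constant_on UNIV" by (rule Liouville_theorem[rotated])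
  then obtain K where K: "\<And>w. h (exp w) = K" by (auto simp: constant_on_def)
  have "h u = K" if "u \<noteq> 0" for u
    using K[of "Ln u"] that by simp
  then show ?thesis by blast
qed

text \<open>The quotient f / g is invariant under multiplication by p. The zeros of g are simple and
  shared by f, so the singularities are removable; the value to fill in is the quotient of the
  derivatives.\<close>

lemma quotient_of_quasiperiodic_is_const:
  fixes f g :: "complex \<Rightarrow> complex"
  assumes p: "0 < norm p" "norm p < 1"
    and f: "f holomorphic_on - {0}" and g: "g holomorphic_on - {0}"
    and m: "\<And>u. u \<noteq> 0 \<Longrightarrow> m u \<noteq> 0"
    and fp: "\<And>u. u \<noteq> 0 \<Longrightarrow> f (p * u) = m u * f u"
    and gp: "\<And>u. u \<noteq> 0 \<Longrightarrow> g (p * u) = m u * g u"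
    and zero: "\<And>u. u \<noteq> 0 \<Longrightarrow> g u = 0 \<Longrightarrow> f u = 0 \<and> deriv g u \<noteq> 0"
  shows "\<exists>K. \<forall>u. u \<noteq> 0 \<longrightarrow> f u = K * g u"
proof -
  have p0: "p \<noteq> 0" using p by auto
  have op: "open (- {0 :: complex})" by auto
  define h where "h = (\<lambda>u. if g u = 0 then deriv f u / deriv g u else f u / g u)"
  have loc: "\<exists>S. open S \<and> u \<in> S \<and> S \<subseteq> - {0} \<and> h holomorphic_on S \<and> (\<forall>w\<in>S - {u}. g w \<noteq> 0)"
    if u: "u \<noteq> 0" for u
  proof (cases "g u = 0")
    case False
    define S where "S = {w \<in> - {0}. g w \<noteq> 0}"
    have "open S"
    proof -
      have "S = - {0} \<inter> g -` (- {0})" by (auto simp: S_def)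
      then show ?thesis
        using continuous_open_preimage[OF holomorphic_on_imp_continuous_on[OF g] op, of "- {0}"] by auto
    qed
    moreover have "(\<lambda>w. f w / g w) holomorphic_on S"
      by (intro holomorphic_on_divide holomorphic_on_subset[OF f] holomorphic_on_subset[OF g]) (auto simp: S_def)
    then have "h holomorphic_on S" by (rule holomorphic_transform) (auto simp: S_def h_def)
    ultimately show ?thesis using u False by (intro exI[of _ S]) (auto simp: S_def)
  next
    case True
    then have z: "f u = 0" "deriv g u \<noteq> 0" using zero[OF u] by auto
    define F where "F = (\<lambda>w. if w = u then deriv f u else (f w - f u) / (w - u))"
    define G where "G = (\<lambda>w. if w = u then deriv g u else (g w - g u) / (w - u))"
    have F: "F holomorphic_on - {0}" and G: "G holomorphic_on - {0}"
      unfolding F_def G_def by (rule pole_lemma_open[OF f op], rule pole_lemma_open[OF g op])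
    define S where "S = {w \<in> - {0}. G w \<noteq> 0}"
    have "open S"
    proof -
      have "S = - {0} \<inter> G -` (- {0})" by (auto simp: S_def)
      then show ?thesis
        using continuous_open_preimage[OF holomorphic_on_imp_continuous_on[OF G] op, of "- {0}"] by auto
    qed
    moreover have "u \<in> S" using u z by (auto simp: S_def G_def)
    moreover have nz: "\<forall>w\<in>S - {u}. g w \<noteq> 0" using True by (auto simp: S_def G_def)
    moreover have "(\<lambda>w. F w / G w) holomorphic_on S"
      by (intro holomorphic_on_divide holomorphic_on_subset[OF F] holomorphic_on_subset[OF G]) (auto simp: S_def)
    then have "h holomorphic_on S"
      by (rule holomorphic_transform) (use nz True z in \<open>auto simp: h_def F_def G_def S_def\<close>)
    ultimately show ?thesis by (intro exI[of _ S]) (auto simp: S_def)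
  qed
  have holo: "h holomorphic_on - {0}"
    unfolding holomorphic_on_def
  proof
    fix u :: complex assume "u \<in> - {0}"
    then obtain S where "open S" "u \<in> S" "h holomorphic_on S" using loc[of u] by auto
    then show "h field_differentiable at u within - {0}"
      using field_differentiable_at_within holomorphic_on_imp_differentiable_at by blast
  qed
  have cont: "isCont h u" if "u \<noteq> 0" for u
    using holomorphic_on_imp_continuous_on[OF holo] op that continuous_on_eq_continuous_at by blast
  \<comment> \<open>At a zero of g the formula for h does not show the invariance; it follows by
    continuity, since zeros of g are isolated.\<close>
  have per: "h (p * u) = h u" if u: "u \<noteq> 0" for u
  proof -
    obtain S where S: "open S" "u \<in> S" "S \<subseteq> - {0}" "\<forall>w\<in>S - {u}. g w \<noteq> 0" using loc[OF u] by auto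
    have ev: "eventually (\<lambda>w. h (p * w) = h w) (at u)"
      unfolding eventually_at_topological
    proof (intro exI[of _ S] conjI ballI impI)
      fix w assume w: "w \<in> S" "w \<noteq> u"
      then have "w \<noteq> 0" "g w \<noteq> 0" using S by auto
      then show "h (p * w) = h w" using m[of w] fp[of w] gp[of w] by (simp add: h_def)
    qed (use S in auto)
    have "isCont (\<lambda>w. h (p * w)) u"
      by (rule isCont_o2[where f = "\<lambda>w. p * w" and g = h]) (use cont[of "p * u"] u p0 in \<open>auto intro!: continuous_intros\<close>)
    then have "((\<lambda>w. h (p * w)) \<longlongrightarrow> h (p * u)) (at u)" by (simp add: isCont_def)
    then have "(h \<longlongrightarrow> h (p * u)) (at u)" using ev by (rule Lim_transform_eventually)
    moreover have "(h \<longlongrightarrow> h u) (at u)" using cont[OF u] by (simp add: isCont_def)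
    ultimately show ?thesis using tendsto_unique[OF at_neq_bot] by blast
  qed
  obtain K where K: "\<And>u. u \<noteq> 0 \<Longrightarrow> h u = K"
    using multiplicative_liouville[OF p holo per] by blast
  have "f u = K * g u" if "u \<noteq> 0" for u
    using K[OF that] zero[OF that] by (auto simp: h_def split: if_splits)
  then show ?thesis by blast
qed

text \<open>By the q-binomial theorem with a = 0, (t;q) is the reciprocal of a power series.\<close>

lemma isCont_qpoch:
  assumes q: "norm q < 1" and x: "norm x < 1"
  shows "isCont (qpoch q) x"
proof -
  have z: "qpoch q 0 = 1" by (simp add: qpoch_def)
  have c: "isCont (\<lambda>t. 1 / qbin_series q 0 t) x"
    using DERIV_isCont[OF qbin_series_deriv[OF q x, of 0]] qbin_series_nonzero[OF q x, of 0]
    by (intro continuous_intros) auto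
  have "1 / qbin_series q 0 t = qpoch q t" if "norm t < 1" for t
    using qbin_series_eq[OF q that, of 0] by (simp add: z)
  then have "eventually (\<lambda>t. 1 / qbin_series q 0 t = qpoch q t) (nhds x)"
    unfolding eventually_nhds by (intro exI[of _ "ball 0 1"]) (use x in auto)
  from isCont_cong[OF this] c show ?thesis by simp
qed

text \<open>As \<open>th q\<close> is a function of \<open>u\<close> rather than \<open>u\<^sup>2\<close>, its quasi-period is the square root \<open>p\<close> of \<open>q\<close>.\<close>

locale nome =
  fixes p q :: complex
  assumes p: "0 < norm p" "norm p < 1" and qp: "q = p\<^sup>2"
begin

lemma p0: "p \<noteq> 0" and q: "norm q < 1" and q0: "q \<noteq> 0"
  using p by (auto simp: qp norm_power power_less_one_iff)

text \<open>The Euler derivative u d/du of \<open>th q\<close>.\<close>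

definition dth :: "complex \<Rightarrow> complex" where
  "dth = bil (\<lambda>x. of_int x * th_coeff q x)"

lemma th_deriv: "u \<noteq> 0 \<Longrightarrow> (th q has_field_derivative dth u / u) (at u)"
  unfolding th_def dth_def by (rule bil_deriv[OF rapid_th[OF q]])

lemma th_holo: "th q holomorphic_on - {0}"
  unfolding th_def by (rule bil_holomorphic[OF rapid_th[OF q]])

lemma dth_holo: "dth holomorphic_on - {0}"
  unfolding dth_def by (rule bil_holomorphic[OF rapid_weight[OF rapid_th[OF q]]])

lemma th_minus: "u \<noteq> 0 \<Longrightarrow> th q (- u) = - th q u"
proof -
  assume u: "u \<noteq> 0"
  then have e: "- u - 1 / (- u) = - (u - 1 / u)" and u': "- u \<noteq> 0" by simp_all
  show ?thesis
    unfolding triple_product[OF q q0 u] triple_product[OF q q0 u'] power2_minus e by (simp only: mult_minus_left)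
qed

lemma th_inverse: "u \<noteq> 0 \<Longrightarrow> th q (1 / u) = - th q u"
proof -
  assume u: "u \<noteq> 0"
  then have e: "1 / u - 1 / (1 / u) = - (u - 1 / u)" "q * (1 / u)\<^sup>2 = q / u\<^sup>2" "q / (1 / u)\<^sup>2 = q * u\<^sup>2"
    and u': "1 / u \<noteq> 0"
    by (simp_all add: power_divide)
  show ?thesis
    unfolding triple_product[OF q q0 u] triple_product[OF q q0 u'] e by (simp only: mult_minus_left mult_minus_right mult_ac)
qed

lemma th_shift:
  assumes u: "u \<noteq> 0"
  shows "th q (p * u) = - 1 / (p * u\<^sup>2) * th q u"
proof -
  have 1: "th q (p * u) = (p * u - 1 / (p * u)) * qpoch q q * qpoch q (q * (q * u\<^sup>2)) * qpoch q (1 / u\<^sup>2)"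
    using triple_product[OF q q0, of "p * u"] u p0 by (simp add: power_mult_distrib qp)
  have 2: "qpoch q (q * u\<^sup>2) = (1 - q * u\<^sup>2) * qpoch q (q * (q * u\<^sup>2))"
    by (rule qpoch_rec[OF q])
  have 3: "qpoch q (1 / u\<^sup>2) = (1 - 1 / u\<^sup>2) * qpoch q (q / u\<^sup>2)"
    using qpoch_rec[OF q, of "1 / u\<^sup>2"] by simp
  have 4: "p * u - 1 / (p * u) = - 1 / (p * u) * (1 - q * u\<^sup>2)"
    using u p0 by (simp add: field_simps power2_eq_square qp)
  have 5: "1 - 1 / u\<^sup>2 = (u - 1 / u) / u" using u by (simp add: field_simps power2_eq_square)
  have "th q (p * u) = - 1 / (p * u) * qpoch q q * qpoch q (q * u\<^sup>2) * ((u - 1 / u) / u * qpoch q (q / u\<^sup>2))"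
    unfolding 1 2 3 4 5 by (simp add: mult_ac)
  then show ?thesis
    unfolding triple_product[OF q q0 u] by (simp add: power2_eq_square mult_ac)
qed

lemma th_1 [simp]: "th q 1 = 0"
  using triple_product[OF q q0, of 1] by simp

text \<open>The zero of the triple product at u = 1 comes from u - 1/u, with derivative 2 there; the
  three remaining products all become (q;q).\<close>

lemma dth_1: "dth 1 = 2 * qpoch q q ^ 3"
proof -
  define g where "g = (\<lambda>u. qpoch q q * qpoch q (q * u\<^sup>2) * qpoch q (q / u\<^sup>2))"
  have "isCont (\<lambda>u. qpoch q (q * u\<^sup>2)) 1" "isCont (\<lambda>u. qpoch q (q / u\<^sup>2)) 1"
    by (rule isCont_o2[OF _ isCont_qpoch[OF q]]; use q in \<open>auto intro!: continuous_intros\<close>)+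
  then have "isCont (\<lambda>u. (u + 1) / u * g u) 1"
    unfolding g_def by (intro continuous_intros) auto
  then have "((\<lambda>u. (u + 1) / u * g u) \<longlongrightarrow> (1 + 1) / 1 * g 1) (at 1)"
    by (simp add: isCont_def)
  moreover have "eventually (\<lambda>u. (u + 1) / u * g u = (th q u - th q 1) / (u - 1)) (at 1)"
    unfolding eventually_at_topological
  proof (intro exI[of _ "- {0}"] conjI ballI impI)
    fix u :: complex assume "u \<in> - {0}" "u \<noteq> 1"
    then have u: "u \<noteq> 0" "u - 1 \<noteq> 0" by auto
    have "th q u = (u - 1) * ((u + 1) / u * g u)"
      unfolding triple_product[OF q q0 u(1)] g_def using u by (simp add: field_simps)
    then show "(u + 1) / u * g u = (th q u - th q 1) / (u - 1)" using u by simp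
  qed auto
  ultimately have "((\<lambda>u. (th q u - th q 1) / (u - 1)) \<longlongrightarrow> (1 + 1) / 1 * g 1) (at 1)"
    by (rule Lim_transform_eventually)
  then have "(th q has_field_derivative 2 * g 1) (at 1)"
    by (simp add: has_field_derivative_iff)
  moreover have "(th q has_field_derivative dth 1) (at 1)" using th_deriv[of 1] by simp
  ultimately have "dth 1 = 2 * g 1" using DERIV_unique by blast
  then show ?thesis by (simp add: g_def power3_eq_cube)
qed

lemma dth_1_nonzero: "dth 1 \<noteq> 0"
  unfolding dth_1 using qpoch_nonzero'[OF q q] by simp

lemma dth_minus: "u \<noteq> 0 \<Longrightarrow> dth (- u) = - dth u"
proof -
  assume u: "u \<noteq> 0"
  have "((\<lambda>v. - th q (- v)) has_field_derivative - (dth (- u) / (- u) * (- 1))) (at u)"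
    by (intro DERIV_minus DERIV_chain2[of "th q"] th_deriv) (use u in \<open>auto intro!: derivative_eq_intros\<close>)
  then have "(th q has_field_derivative - (dth (- u) / (- u) * (- 1))) (at u)"
    by (rule has_field_derivative_transform_within_open[of _ _ _ "- {0}"]) (use u th_minus in auto)
  then have "- (dth (- u) / (- u) * (- 1)) = dth u / u" using th_deriv[OF u] DERIV_unique by blast
  then have "- dth (- u) = dth u" using u by (simp add: field_simps)
  then show ?thesis by (metis minus_minus)
qed

lemma dth_inverse: "u \<noteq> 0 \<Longrightarrow> dth (1 / u) = dth u"
proof -
  assume u: "u \<noteq> 0"
  have "((\<lambda>v. - th q (1 / v)) has_field_derivative - (dth (1 / u) / (1 / u) * (- 1 / (u * u)))) (at u)"
    by (intro DERIV_minus DERIV_chain2[of "th q"] th_deriv) (use u in \<open>auto intro!: derivative_eq_intros\<close>)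
  then have "(th q has_field_derivative - (dth (1 / u) / (1 / u) * (- 1 / (u * u)))) (at u)"
    by (rule has_field_derivative_transform_within_open[of _ _ _ "- {0}"]) (use u th_inverse in auto)
  then have "- (dth (1 / u) / (1 / u) * (- 1 / (u * u))) = dth u / u" using th_deriv[OF u] DERIV_unique by blast
  then show ?thesis using u by (simp add: field_simps)
qed

lemma dth_shift:
  assumes u: "u \<noteq> 0"
  shows "dth (p * u) = - 1 / (p * u\<^sup>2) * (dth u - 2 * th q u)"
proof -
  have "((\<lambda>v. th q (p * v)) has_field_derivative dth (p * u) / (p * u) * p) (at u)"
    by (intro DERIV_chain2[of "th q"] th_deriv) (use u p0 in \<open>auto intro!: derivative_eq_intros\<close>)
  moreover have "((\<lambda>v. - 1 / (p * v\<^sup>2) * th q v) has_field_derivative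
     (2 / (p * (u * u * u)) * th q u + dth u / u * (- 1 / (p * u\<^sup>2)))) (at u)"
    by (rule DERIV_mult[OF _ th_deriv[OF u]])
       (use u p0 in \<open>auto intro!: derivative_eq_intros simp: field_simps power2_eq_square\<close>)
  then have "((\<lambda>v. th q (p * v)) has_field_derivative
     (2 / (p * (u * u * u)) * th q u + dth u / u * (- 1 / (p * u\<^sup>2)))) (at u)"
    by (rule has_field_derivative_transform_within_open[of _ _ _ "- {0}"]) (use u th_shift in auto)
  ultimately have "dth (p * u) / (p * u) * p = 2 / (p * (u * u * u)) * th q u + dth u / u * (- 1 / (p * u\<^sup>2))"
    using DERIV_unique by blast
  then show ?thesis using u p0 by (simp add: field_simps power2_eq_square)
qed

end

text \<open>Two polynomials of degree at most m agree at m + 1 points: the inverses of the m roots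
  of unity and 0, which fixes the scalar.\<close>

lemma prod_roots_of_unity:
  fixes \<omega> y :: complex
  assumes m: "m > 0" and \<omega>: "\<omega> ^ m = 1" and inj: "inj_on (\<lambda>j. \<omega> ^ j) {..<m}"
  shows "(\<Prod>j<m. 1 - \<omega> ^ j * y) = 1 - y ^ m"
proof -
  have \<omega>0: "\<omega> \<noteq> 0" using \<omega> m by (auto simp: power_0_left)
  define P where "P = (\<Prod>j<m. [:1, - (\<omega> ^ j):])"
  define Q where "Q = 1 - monom (1 :: complex) m"
  define A where "A = insert 0 ((\<lambda>j. 1 / \<omega> ^ j) ` {..<m})"
  have "inj_on (\<lambda>j. 1 / \<omega> ^ j) {..<m}"
    using inj by (auto simp: inj_on_def)
  then have "card ((\<lambda>j. 1 / \<omega> ^ j) ` {..<m}) = m" by (simp add: card_image)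
  then have cA: "card A = Suc m" using \<omega>0 by (simp add: A_def card_insert_if image_iff)
  have dP: "degree P \<le> m"
    unfolding P_def using degree_prod_sum_le[of "{..<m}" "\<lambda>j. [:1, - (\<omega> ^ j):]"] \<omega>0 by simp
  have dQ: "degree Q \<le> m"
    unfolding Q_def by (intro degree_diff_le) (auto simp: degree_monom_le)
  have eP: "poly P x = (\<Prod>j<m. 1 - \<omega> ^ j * x)" for x
    by (simp add: P_def poly_prod mult.commute)
  have eQ: "poly Q x = 1 - x ^ m" for x by (simp add: Q_def poly_monom)
  have "P = Q"
  proof (rule poly_eqI_degree[of A])
    fix x assume x: "x \<in> A"
    show "poly P x = poly Q x"
    proof (cases "x = 0")
      case False
      then obtain j where j: "j < m" "x = 1 / \<omega> ^ j" using x by (auto simp: A_def)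
      have "x ^ m = 1 / (\<omega> ^ m) ^ j" by (simp add: j power_divide mult.commute flip: power_mult)
      then have "poly Q x = 0" using \<omega> by (simp add: eQ)
      moreover have "\<exists>i\<in>{..<m}. 1 - \<omega> ^ i * x = 0" using j \<omega>0 by (intro bexI[of _ j]) auto
      then have "poly P x = 0" unfolding eP by (intro prod_zero) auto
      ultimately show ?thesis by simp
    qed (use m in \<open>simp add: eP eQ power_0_left\<close>)
  qed (use cA dP dQ in auto)
  then show ?thesis using eP eQ by metis
qed

lemma qpoch_prod_roots:
  assumes q: "norm q < 1" and m: "m > 0"
    and root: "\<And>y. (\<Prod>j<m. 1 - \<omega> ^ j * y) = 1 - y ^ m"
  shows "(\<Prod>j<m. qpoch q (\<omega> ^ j * x)) = qpoch (q ^ m) (x ^ m)"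
proof -
  have qm: "norm (q ^ m) < 1"
    using q m power_less_one_iff[of "norm q" m] by (cases "q = 0") (auto simp: norm_power power_0_left power_Suc_less_one)
  have "(\<lambda>N. \<Prod>j<m. \<Prod>n<N. 1 - \<omega> ^ j * x * q ^ n) \<longlonglongrightarrow> (\<Prod>j<m. qpoch q (\<omega> ^ j * x))"
    by (intro tendsto_prod qpoch_tendsto q)
  moreover have "(\<Prod>j<m. \<Prod>n<N. 1 - \<omega> ^ j * x * q ^ n) = (\<Prod>n<N. 1 - x ^ m * (q ^ m) ^ n)" for N
  proof -
    have "(\<Prod>j<m. \<Prod>n<N. 1 - \<omega> ^ j * x * q ^ n) = (\<Prod>n<N. \<Prod>j<m. 1 - \<omega> ^ j * (x * q ^ n))"
      by (subst prod.swap) (simp add: mult.assoc)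
    also have "\<dots> = (\<Prod>n<N. 1 - (x * q ^ n) ^ m)" by (simp only: root)
    finally show ?thesis by (simp add: power_mult_distrib mult.commute flip: power_mult)
  qed
  ultimately have "(\<lambda>N. \<Prod>n<N. 1 - x ^ m * (q ^ m) ^ n) \<longlonglongrightarrow> (\<Prod>j<m. qpoch q (\<omega> ^ j * x))" by simp
  then show ?thesis using qpoch_tendsto[OF qm, of "x ^ m"] LIMSEQ_unique by blast
qed

lemma qpoch_split3:
  assumes q: "norm q < 1"
  shows "qpoch q x = qpoch (q ^ 3) x * qpoch (q ^ 3) (q * x) * qpoch (q ^ 3) (q\<^sup>2 * x)"
proof -
  have q3: "norm (q ^ 3) < 1" using q by (simp add: norm_power power_less_one_iff)
  have "(\<lambda>N. \<Prod>n<N * 3. 1 - x * q ^ n) \<longlonglongrightarrow> qpoch q x"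
    by (rule filterlim_compose[OF qpoch_tendsto[OF q]], rule filterlim_subseq) (auto simp: strict_mono_def)
  moreover have "(\<Prod>n<N * 3. 1 - x * q ^ n) =
      (\<Prod>n<N. 1 - x * (q ^ 3) ^ n) * (\<Prod>n<N. 1 - q * x * (q ^ 3) ^ n) * (\<Prod>n<N. 1 - q\<^sup>2 * x * (q ^ 3) ^ n)" for N
  proof (induction N)
    case (Suc N)
    have "Suc N * 3 = Suc (Suc (Suc (N * 3)))" by simp
    moreover have "q ^ (N * 3) = (q ^ 3) ^ N" by (simp add: mult.commute flip: power_mult)
    ultimately show ?case
      by (simp only: prod.lessThan_Suc Suc power_Suc) (simp add: power2_eq_square mult_ac)
  qed simp
  moreover have "(\<lambda>N. (\<Prod>n<N. 1 - x * (q ^ 3) ^ n) * (\<Prod>n<N. 1 - q * x * (q ^ 3) ^ n) * (\<Prod>n<N. 1 - q\<^sup>2 * x * (q ^ 3) ^ n))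
      \<longlonglongrightarrow> qpoch (q ^ 3) x * qpoch (q ^ 3) (q * x) * qpoch (q ^ 3) (q\<^sup>2 * x)"
    by (intro tendsto_intros qpoch_tendsto q3)
  ultimately show ?thesis using LIMSEQ_unique by simp
qed

lemma odd_mod6_coprime3:
  fixes x :: int
  assumes "odd x" "\<not> 3 dvd x"
  obtains m where "x\<^sup>2 - 1 = 24 * m" "(x\<^sup>2 - 1) div 24 = m" "m \<ge> 0"
proof -
  have "x mod 24 \<in> {1,5,7,11,13,17,19,23}" using assms by simp presburger
  then have "(x mod 24)\<^sup>2 mod 24 = 1" by auto
  then have "x\<^sup>2 mod 24 = 1" by (simp add: power_mod)
  then have "(x\<^sup>2 - 1) mod 24 = 0" by presburger
  then obtain m where m: "x\<^sup>2 - 1 = 24 * m" by (auto elim: dvdE simp: mod_eq_0_iff_dvd)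
  have "x \<noteq> 0" using assms by auto
  then have "x\<^sup>2 > 0" by simp
  then have "m \<ge> 0" using m by linarith
  then show ?thesis using that[of m] m by simp
qed

lemma odd_square_mod8:
  fixes x :: int
  assumes "odd x"
  obtains m where "x\<^sup>2 - 1 = 8 * m" "(x\<^sup>2 - 1) div 8 = m" "m \<ge> 0"
proof -
  have "x mod 8 \<in> {1,3,5,7}" using assms by simp presburger
  then have "(x mod 8)\<^sup>2 mod 8 = 1" by auto
  then have "x\<^sup>2 mod 8 = 1" by (simp add: power_mod)
  then have "(x\<^sup>2 - 1) mod 8 = 0" by presburger
  then obtain m where m: "x\<^sup>2 - 1 = 8 * m" by (auto elim: dvdE simp: mod_eq_0_iff_dvd)
  have "x \<noteq> 0" using assms by auto
  then have "x\<^sup>2 > 0" by simp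
  then have "m \<ge> 0" using m by linarith
  then show ?thesis using that[of m] m by simp
qed

lemma power_nat_eq_powi: "n \<ge> 0 \<Longrightarrow> a ^ nat n = a powi n"
  by (simp add: power_int_def)

section \<open>The series \<open>be\<close> and the pentagonal number theorem\<close>

context nome
begin

lemma nome_power: "k > 0 \<Longrightarrow> nome (p ^ k) (q ^ k)"
  using p p0 power_strict_decreasing[of 0 k "norm p"]
  by unfold_locales (auto simp: norm_power qp mult.commute simp flip: power_mult)

lemma q_powi: "q powi n = p powi (2 * n)"
proof -
  have "p powi (2 * n) = (p powi 2) powi n" by (rule power_int_mult)
  then show ?thesis by (simp add: qp)
qed

lemma be_has_sum: "u \<noteq> 0 \<Longrightarrow> ((\<lambda>x. be_coeff q x * u powi x) has_sum be q u) UNIV"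
  unfolding be_def by (rule bil_has_sum[OF rapid_be[OF q]])

lemma be_holo: "be q holomorphic_on - {0}"
  unfolding be_def by (rule bil_holomorphic[OF rapid_be[OF q]])

lemma be_coeff_even: "even x \<Longrightarrow> be_coeff q x = 0"
  by (simp add: be_coeff_def chi4_even)

lemma be_coeff_neg: "be_coeff q (- x) = - be_coeff q x"
  by (simp add: be_coeff_def chi4_neg)

lemma be_minus:
  assumes u: "u \<noteq> 0"
  shows "be q (- u) = - be q u"
proof -
  have "be_coeff q x * (- u) powi x = - (be_coeff q x * u powi x)" for x
  proof (cases "even x")
    case False
    then have "(- u) powi x = - (u powi x)" by (simp add: power_int_minus_left_odd)
    then show ?thesis by simp
  qed (simp add: be_coeff_even)
  then have "((\<lambda>x. - (be_coeff q x * u powi x)) has_sum be q (- u)) UNIV"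
    using be_has_sum[of "- u"] u by simp
  moreover have "((\<lambda>x. - (be_coeff q x * u powi x)) has_sum - be q u) UNIV"
    by (intro has_sum_uminusI be_has_sum u)
  ultimately show ?thesis by (rule has_sum_unique)
qed

lemma be_inverse:
  assumes u: "u \<noteq> 0"
  shows "be q (1 / u) = - be q u"
proof -
  have "((\<lambda>x. be_coeff q (- x) * u powi (- x)) has_sum be q u) UNIV"
    using be_has_sum[OF u]
    by (subst has_sum_reindex_bij_witness[where T = UNIV and j = uminus and i = uminus
          and h = "\<lambda>x. be_coeff q x * u powi x" and s' = "be q u"]) auto
  moreover have "be_coeff q (- x) * u powi (- x) = - (be_coeff q x * (1 / u) powi x)" for x
    by (simp add: be_coeff_neg power_int_minus power_int_divide_distrib divide_inverse power_int_inverse)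
  ultimately have "((\<lambda>x. - (be_coeff q x * (1 / u) powi x)) has_sum be q u) UNIV" by simp
  moreover have "((\<lambda>x. - (be_coeff q x * (1 / u) powi x)) has_sum - be q (1 / u)) UNIV"
    by (intro has_sum_uminusI be_has_sum) (use u in simp)
  ultimately have "- be q (1 / u) = be q u" using has_sum_unique by blast
  then show ?thesis by (metis minus_minus)
qed

text \<open>Completing the square, x^2 / 12 + x = (x + 6)^2 / 12 - 3, so the shift by p is the
  reindexing x to x + 6. The multiplier agrees with that of \<open>al\<close>, which allows the two
  series to be combined in Winquist's identity.\<close>

lemma be_shift:
  assumes u: "u \<noteq> 0"
  shows "be q (p * u) = - 1 / (p ^ 3 * u ^ 6) * be q u"
proof -
  have "be_coeff q x * (p * u) powi x = - 1 / (p ^ 3 * u ^ 6) * (be_coeff q (x + 6) * u powi (x + 6))" for x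
  proof (cases "odd x \<and> \<not> 3 dvd x")
    case True
    then have x6: "odd (x + 6)" "\<not> 3 dvd x + 6" by (auto simp: dvd_add_left_iff)
    obtain m where m: "x\<^sup>2 - 1 = 24 * m" "(x\<^sup>2 - 1) div 24 = m" "m \<ge> 0"
      using odd_mod6_coprime3 True by blast
    obtain m' where m': "(x + 6)\<^sup>2 - 1 = 24 * m'" "((x + 6)\<^sup>2 - 1) div 24 = m'" "m' \<ge> 0"
      using odd_mod6_coprime3 x6 by blast
    have e: "2 * m + x = 2 * m' + (- 3)"
      using m(1) m'(1) by (simp add: power2_eq_square algebra_simps)
    have c: "chi4 (x + 6) = - chi4 x"
      using chi4_add2[of x] chi4_add2[of "x + 2"] chi4_add2[of "x + 4"] by (simp add: add.assoc)
    have "q ^ nat m * p powi x = p powi (2 * m + x)"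
      unfolding power_nat_eq_powi[OF m(3)] q_powi using p0 by (simp add: power_int_add)
    also have "\<dots> = q ^ nat m' * p powi (- 3)"
      unfolding e power_nat_eq_powi[OF m'(3)] q_powi using p0 by (simp add: power_int_add power_int_diff power_int_minus divide_inverse)
    finally have qm: "q ^ nat m * p powi x = q ^ nat m' / p ^ 3"
      by (simp add: power_int_minus divide_inverse)
    have u6: "u powi (x + 6) = u powi x * u ^ 6"
      using u by (simp add: power_int_add)
    have "be_coeff q x * (p * u) powi x = of_int (chi4 x) * (q ^ nat m * p powi x) * u powi x"
      using True m(2) by (simp add: be_coeff_def power_int_mult_distrib)
    then show ?thesis
      unfolding qm u6 using x6 m'(2) c u p0 by (simp add: be_coeff_def)
  next
    case False
    then have "be_coeff q x = 0" "be_coeff q (x + 6) = 0"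
      by (auto simp: be_coeff_def chi4_even dvd_add_left_iff)
    then show ?thesis by simp
  qed
  then have "((\<lambda>x. - 1 / (p ^ 3 * u ^ 6) * (be_coeff q (x + 6) * u powi (x + 6))) has_sum be q (p * u)) UNIV"
    using be_has_sum[of "p * u"] u p0 by simp
  moreover have "((\<lambda>x. be_coeff q (x + 6) * u powi (x + 6)) has_sum be q u) UNIV"
    using be_has_sum[OF u]
    by (subst has_sum_reindex_bij_witness[where T = UNIV and j = "\<lambda>x. x + 6" and i = "\<lambda>x. x - 6"
          and h = "\<lambda>x. be_coeff q x * u powi x" and s' = "be q u"]) auto
  then have "((\<lambda>x. - 1 / (p ^ 3 * u ^ 6) * (be_coeff q (x + 6) * u powi (x + 6))) has_sum - 1 / (p ^ 3 * u ^ 6) * be q u) UNIV"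
    by (rule has_sum_cmult_right)
  ultimately show ?thesis by (rule has_sum_unique)
qed

text \<open>Euler's theorem is the triple product for q^3 at u = 1 / p, whose three factors collect
  the residue classes modulo 3 of the exponents in (q;q). Indexing by w congruent to 1 modulo 6
  makes the exponent (w^2 - 1) / 24, a square up to constants like all other exponents here.\<close>

lemma pentagonal:
  "((\<lambda>w. of_int (chi4 w) * q ^ nat ((w\<^sup>2 - 1) div 24)) has_sum qpoch q q) {w. w mod 6 = 1}"
proof -
  interpret n3: nome "p ^ 3" "q ^ 3" by (rule nome_power) simp
  have "((\<lambda>x. th_coeff (q ^ 3) x * (1 / p) powi x) has_sum th (q ^ 3) (1 / p)) UNIV"
    unfolding th_def by (rule bil_has_sum[OF rapid_th[OF n3.q]]) (use p0 in simp)
  then have "((\<lambda>x. th_coeff (q ^ 3) x * (1 / p) powi x) has_sum th (q ^ 3) (1 / p)) {x. odd x}"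
    by (rule iffD1[OF has_sum_cong_neutral, rotated -1]) (auto simp: th_coeff_def chi4_even)
  also have "th (q ^ 3) (1 / p) = qpoch q q / p"
  proof -
    have t: "th (q ^ 3) (1 / p) = (1 / p - p) * qpoch (q ^ 3) (q ^ 3) * qpoch (q ^ 3) (q\<^sup>2) * qpoch (q ^ 3) (q ^ 3 * q)"
      using triple_product[OF n3.q n3.q0, of "1 / p"] p0
      by (simp add: qp power_divide power2_eq_square power3_eq_cube)
    have "qpoch (q ^ 3) q = (1 - q) * qpoch (q ^ 3) (q ^ 3 * q)" by (rule qpoch_rec[OF n3.q])
    moreover have "qpoch q q = qpoch (q ^ 3) q * qpoch (q ^ 3) (q * q) * qpoch (q ^ 3) (q\<^sup>2 * q)"
      by (rule qpoch_split3[OF q])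
    moreover have "1 / p - p = (1 - q) / p" using p0 by (simp add: qp field_simps power2_eq_square)
    ultimately show ?thesis unfolding t by (simp add: power2_eq_square power3_eq_cube)
  qed
  finally have "((\<lambda>x. p * (th_coeff (q ^ 3) x * (1 / p) powi x)) has_sum p * (qpoch q q / p)) {x. odd x}"
    by (rule has_sum_cmult_right)
  then have "((\<lambda>x. p * (th_coeff (q ^ 3) x * (1 / p) powi x)) has_sum qpoch q q) {x. odd x}"
    using p0 by simp
  \<comment> \<open>The substitution w = 3 x - 2 completes the square in 3 (x^2 - 1) / 8 + (1 - x) /
    2 and maps the odd x onto the class of 1 modulo 6.\<close>
  moreover have "of_int (chi4 (3 * x - 2)) * q ^ nat (((3 * x - 2)\<^sup>2 - 1) div 24) =
      p * (th_coeff (q ^ 3) x * (1 / p) powi x)" if "odd x" for x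
  proof -
    note ox = that
    have w: "odd (3 * x - 2)" "\<not> 3 dvd 3 * x - 2" using that by auto presburger
    obtain m where m: "x\<^sup>2 - 1 = 8 * m" "(x\<^sup>2 - 1) div 8 = m" "m \<ge> 0"
      using odd_square_mod8[OF ox] by metis
    obtain m' where m': "(3 * x - 2)\<^sup>2 - 1 = 24 * m'" "((3 * x - 2)\<^sup>2 - 1) div 24 = m'" "m' \<ge> 0"
      using odd_mod6_coprime3 w by blast
    have "2 * m' = 6 * m + 1 - x"
      using m(1) m'(1) by (simp add: power2_eq_square algebra_simps)
    then have "q ^ nat m' = p powi (6 * m + 1 - x)"
      unfolding power_nat_eq_powi[OF m'(3)] q_powi by simp
    also have "\<dots> = p powi (6 * m) * p * (1 / p) powi x"
      using p0 by (simp add: power_int_add power_int_diff power_int_divide_distrib)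
    also have "p powi (6 * m) = (q ^ 3) ^ nat m"
      using q_powi[of "3 * m"] by (simp add: power_nat_eq_powi m(3) power_int_mult)
    finally have "q ^ nat m' = (q ^ 3) ^ nat m * p * (1 / p) powi x" .
    moreover have "(3 * x - 2) mod 4 = x mod 4"
      using ox by (auto simp: mod_eq_dvd_iff elim!: oddE)
    then have "chi4 (3 * x - 2) = chi4 x" by (simp add: chi4_def)
    ultimately show ?thesis using m(2) m'(2) by (simp add: th_coeff_def)
  qed
  ultimately have "((\<lambda>x. of_int (chi4 (3 * x - 2)) * q ^ nat (((3 * x - 2)\<^sup>2 - 1) div 24)) has_sum qpoch q q) {x. odd x}"
    by (subst has_sum_cong) auto
  moreover have "bij_betw (\<lambda>x. 3 * x - 2) {x. odd x} {w :: int. w mod 6 = 1}"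
  proof (rule bij_betwI[of _ _ _ "\<lambda>w. (w + 2) div 3"])
    show "(\<lambda>x. 3 * x - 2) \<in> {x. odd x} \<rightarrow> {w :: int. w mod 6 = 1}"
      by (rule funcsetI; simp; presburger)
    show "(\<lambda>w. (w + 2) div 3) \<in> {w :: int. w mod 6 = 1} \<rightarrow> {x. odd x}"
      by (rule funcsetI; simp; presburger)
    show "3 * ((w + 2) div 3) - 2 = w" if "w \<in> {w. w mod 6 = 1}" for w :: int
      using that by simp presburger
  qed auto
  ultimately show ?thesis
    using has_sum_reindex_bij_betw[where g = "\<lambda>x. 3 * x - 2"] by blast
qed

end

section \<open>Zeros of theta and the addition formula\<close>

context nome
begin

lemma p_powi_shift:
  assumes m: "\<And>u. u \<noteq> 0 \<Longrightarrow> m u \<noteq> 0"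
    and fp: "\<And>u. u \<noteq> 0 \<Longrightarrow> f (p * u) = m u * (f u :: complex)"
    and u: "u \<noteq> 0"
  shows "f (p powi n * u) = 0 \<longleftrightarrow> f u = 0"
proof (induction n rule: int_induct[where k = 0])
  case (step1 i)
  have nz: "p powi i * u \<noteq> 0" using u p0 by simp
  have "f (p powi (i + 1) * u) = m (p powi i * u) * f (p powi i * u)"
    using fp[OF nz] p0 by (simp add: power_int_add mult_ac)
  then show ?case using step1 m[OF nz] by simp
next
  case (step2 i)
  have nz: "p powi (i - 1) * u \<noteq> 0" using u p0 by simp
  have "f (p powi i * u) = m (p powi (i - 1) * u) * f (p powi (i - 1) * u)"
    using fp[OF nz] p0 by (simp add: power_int_diff mult_ac)
  then show ?case using step2 m[OF nz] by simp
qed simp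

text \<open>Whichever factor of the triple product vanishes, u^2 is a power of q = p^2.\<close>

lemma th_zero_cases:
  assumes u: "u \<noteq> 0" and z: "th q u = 0"
  obtains n \<epsilon> where "u = p powi n * \<epsilon>" "\<epsilon> = 1 \<or> \<epsilon> = -1"
proof -
  have fac: "u - 1 / u = 0 \<or> qpoch q (q * u\<^sup>2) = 0 \<or> qpoch q (q / u\<^sup>2) = 0"
    using z qpoch_nonzero'[OF q q] unfolding triple_product[OF q q0 u] by simp
  have "\<exists>n. (u / p powi n)\<^sup>2 = 1"
    using fac
  proof (elim disjE)
    assume "u - 1 / u = 0"
    then have "u\<^sup>2 = 1" using u by (simp add: field_simps power2_eq_square)
    then show ?thesis by (intro exI[of _ 0]) simp
  next
    assume "qpoch q (q * u\<^sup>2) = 0"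
    then obtain n where "q * u\<^sup>2 * q ^ n = 1" using qpoch_nonzero[OF q] by blast
    then have "(u * p ^ Suc n)\<^sup>2 = 1" by (simp add: qp power_mult_distrib mult_ac flip: power_mult)
    moreover have "u / p powi (- int (Suc n)) = u * p ^ Suc n"
      by (simp only: power_int_minus power_int_of_nat divide_inverse inverse_inverse_eq)
    ultimately show ?thesis by metis
  next
    assume "qpoch q (q / u\<^sup>2) = 0"
    then obtain n where "q / u\<^sup>2 * q ^ n = 1" using qpoch_nonzero[OF q] by blast
    then have "(u / p ^ Suc n)\<^sup>2 = 1"
      using u p0 by (simp add: qp power_divide power_mult_distrib field_simps flip: power_mult)
    moreover have "u / p powi (int (Suc n)) = u / p ^ Suc n"
      by (simp only: power_int_of_nat)
    ultimately show ?thesis by metis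
  qed
  then obtain n where n: "(u / p powi n)\<^sup>2 = 1" by blast
  then have "u / p powi n = 1 \<or> u / p powi n = -1" by (simp add: power2_eq_1_iff)
  moreover have "u = p powi n * (u / p powi n)" using p0 by simp
  ultimately show ?thesis using that by blast
qed

lemma th_multiplier_nonzero: "u \<noteq> 0 \<Longrightarrow> - 1 / (p * u\<^sup>2) \<noteq> 0"
  using p0 by simp

lemma th_zero_iff:
  assumes u: "u \<noteq> 0"
  shows "th q u = 0 \<longleftrightarrow> (\<exists>n \<epsilon>. u = p powi n * \<epsilon> \<and> (\<epsilon> = 1 \<or> \<epsilon> = -1))"
proof
  assume "\<exists>n \<epsilon>. u = p powi n * \<epsilon> \<and> (\<epsilon> = 1 \<or> \<epsilon> = -1)"
  then obtain n \<epsilon> where e: "u = p powi n * \<epsilon>" "\<epsilon> = 1 \<or> \<epsilon> = -1" by blast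
  then have "th q \<epsilon> = 0" using th_minus[of 1] by auto
  moreover have "\<epsilon> \<noteq> 0" using e by auto
  ultimately show "th q u = 0"
    unfolding e(1) using p_powi_shift[of "\<lambda>u. - 1 / (p * u\<^sup>2)" "th q" \<epsilon> n, OF th_multiplier_nonzero th_shift] by blast
qed (use th_zero_cases[OF u] in metis)

lemma th_unit_nonzero:
  assumes "norm u = 1" "u\<^sup>2 \<noteq> 1"
  shows "th q u \<noteq> 0"
proof
  assume z: "th q u = 0"
  have u: "u \<noteq> 0" using assms by auto
  obtain n \<epsilon> where e: "u = p powi n * \<epsilon>" "\<epsilon> = 1 \<or> \<epsilon> = -1" using th_zero_cases[OF u z] by blast
  have "norm p powi n = 1" using e assms(1) by (auto simp: norm_mult norm_power_int)
  moreover have "norm p powi n \<noteq> 1" if "n > 0"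
    using p that power_less_one_iff[of "norm p" "nat n"] by (simp add: power_int_def)
  moreover have "norm p powi n \<noteq> 1" if "n < 0"
    using p that power_less_one_iff[of "norm p" "nat (- n)"] by (simp add: power_int_def power_inverse)
  ultimately have "n = 0" by (meson linorder_neqE_linordered_idom)
  then show False using e assms by auto
qed

text \<open>All zeros are simple: at 1 by Jacobi's derivative formula, at -1 by oddness, elsewhere
  by \<open>dth_shift\<close>, which at a zero of theta is mere multiplication by a nonzero
  factor.\<close>

lemma dth_at_zero:
  assumes u: "u \<noteq> 0" and z: "th q u = 0"
  shows "dth u \<noteq> 0"
proof -
  obtain n \<epsilon> where e: "u = p powi n * \<epsilon>" "\<epsilon> = 1 \<or> \<epsilon> = -1" using th_zero_cases[OF u z] by blast
  have \<epsilon>: "\<epsilon> \<noteq> 0" "th q \<epsilon> = 0" "dth \<epsilon> \<noteq> 0"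
    using e th_minus[of 1] dth_minus[of 1] dth_1_nonzero by auto
  have "dth (p powi n * \<epsilon>) \<noteq> 0 \<and> th q (p powi n * \<epsilon>) = 0"
  proof (induction n rule: int_induct[where k = 0])
    case (step1 i)
    have nz: "p powi i * \<epsilon> \<noteq> 0" using \<epsilon> p0 by simp
    have e1: "p powi (i + 1) * \<epsilon> = p * (p powi i * \<epsilon>)" using p0 by (simp add: power_int_add mult_ac)
    show ?case unfolding e1 using step1 dth_shift[OF nz] th_shift[OF nz] nz p0 by simp
  next
    case (step2 i)
    have nz: "p powi (i - 1) * \<epsilon> \<noteq> 0" using \<epsilon> p0 by simp
    have e1: "p powi i * \<epsilon> = p * (p powi (i - 1) * \<epsilon>)" using p0 by (simp add: power_int_diff mult_ac)
    show ?case using step2(2)[unfolded e1] dth_shift[OF nz] th_shift[OF nz] nz p0 by auto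
  qed (use \<epsilon> in simp)
  then show ?thesis using e by simp
qed

lemma th_mult_const_deriv:
  assumes "a \<noteq> 0" "b \<noteq> 0"
  shows "((\<lambda>a. th q (a * b)) has_field_derivative dth (a * b) / a) (at a)"
  by (rule DERIV_chain2[of "th q" "dth (a * b) / (a * b)" "\<lambda>a. a * b" a b, THEN DERIV_cong])
     (use assms in \<open>auto intro!: derivative_eq_intros th_deriv\<close>)

lemma th_mult_holo:
  assumes b: "b \<noteq> 0"
  shows "(\<lambda>a. th q (a * b)) holomorphic_on - {0}" "(\<lambda>a. dth (a * b)) holomorphic_on - {0}"
  by (rule holomorphic_on_compose_gen[unfolded o_def, OF _ th_holo]
           holomorphic_on_compose_gen[unfolded o_def, OF _ dth_holo];
      use b in \<open>auto intro!: holomorphic_intros\<close>)+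

lemma th_div_common_zero:
  assumes "a \<noteq> 0" "b \<noteq> 0" "c \<noteq> 0" "th q (a * b) = 0" "th q (a * c) = 0"
  shows "th q (b / c) = 0"
proof -
  have ab: "a * b \<noteq> 0" and ac: "a * c \<noteq> 0" and bc: "b / c \<noteq> 0" using assms by auto
  obtain n \<epsilon> where e: "a * b = p powi n * \<epsilon>" "\<epsilon> = 1 \<or> \<epsilon> = -1" using th_zero_cases[OF ab assms(4)] by blast
  obtain m \<delta> where d: "a * c = p powi m * \<delta>" "\<delta> = 1 \<or> \<delta> = -1" using th_zero_cases[OF ac assms(5)] by blast
  have "b / c = (a * b) / (a * c)" using assms by simp
  also have "\<dots> = p powi (n - m) * (\<epsilon> * \<delta>)"
    unfolding e(1) d(1) using d(2) p0 by (auto simp: power_int_diff)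
  finally have "b / c = p powi (n - m) * (\<epsilon> * \<delta>)" .
  moreover have "\<epsilon> * \<delta> = 1 \<or> \<epsilon> * \<delta> = -1" using e(2) d(2) by auto
  ultimately show ?thesis unfolding th_zero_iff[OF bc] by blast
qed

text \<open>As functions of a, the left side times th(a) th(a b c), called \<open>f\<close>, and the
  product \<open>g\<close> have the same multiplier, because the inhomogeneous terms of
  \<open>dth_shift\<close> cancel in \<open>f\<close>. Oddness of theta makes \<open>f\<close>
  vanish at 1/b and 1/c, where the zeros of \<open>g\<close> lie. At a = 1 only the term with
  \<open>dth 1\<close> survives and gives the constant.\<close>

theorem theta_addition:
  assumes bc: "b \<noteq> 0" "c \<noteq> 0" "th q b \<noteq> 0" "th q c \<noteq> 0" "th q (b / c) \<noteq> 0" and a: "a \<noteq> 0"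
    and nz: "th q a \<noteq> 0" "th q (a * b * c) \<noteq> 0"
  shows "dth a / th q a + dth b / th q b + dth c / th q c - dth (a * b * c) / th q (a * b * c) =
    2 * qpoch q q ^ 3 * (th q (a * b) * th q (b * c) * th q (a * c)) /
      (th q a * th q b * th q c * th q (a * b * c))"
proof -
  define s where "s = dth b / th q b + dth c / th q c"
  define f where "f = (\<lambda>a. dth a * th q (a * (b * c)) + th q a * th q (a * (b * c)) * s - th q a * dth (a * (b * c)))"
  define g where "g = (\<lambda>a. th q (a * b) * th q (a * c))"
  define m where "m = (\<lambda>u. 1 / (p\<^sup>2 * u ^ 4 * b\<^sup>2 * c\<^sup>2))"
  have bc0: "b * c \<noteq> 0" using bc by simp
  have m0: "m u \<noteq> 0" if "u \<noteq> 0" for u using that bc p0 by (simp add: m_def)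
  have fp: "f (p * u) = m u * f u" if u: "u \<noteq> 0" for u
  proof -
    have ub: "u * (b * c) \<noteq> 0" using u bc by simp
    define M1 M2 where "M1 = - 1 / (p * u\<^sup>2)" and "M2 = - 1 / (p * (u * (b * c))\<^sup>2)"
    have e: "p * u * (b * c) = p * (u * (b * c))" by simp
    have "f (p * u) = M1 * M2 * f u"
      unfolding f_def e th_shift[OF u] th_shift[OF ub] dth_shift[OF u] dth_shift[OF ub]
        M1_def[symmetric] M2_def[symmetric] by (simp add: algebra_simps)
    moreover have "M1 * M2 = m u"
      by (simp add: M1_def M2_def m_def power_mult_distrib eval_nat_numeral mult_ac)
    ultimately show ?thesis by simp
  qed
  have gp: "g (p * u) = m u * g u" if u: "u \<noteq> 0" for u
  proof -
    have ub: "u * b \<noteq> 0" "u * c \<noteq> 0" using u bc by auto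
    have e: "p * u * b = p * (u * b)" "p * u * c = p * (u * c)" by simp_all
    show ?thesis
      unfolding g_def e th_shift[OF ub(1)] th_shift[OF ub(2)]
      by (simp add: m_def power_mult_distrib eval_nat_numeral mult_ac)
  qed
  have fneg: "f (- u) = f u" if u: "u \<noteq> 0" for u
    using u bc0 th_minus[of u] th_minus[of "u * (b * c)"] dth_minus[of u] dth_minus[of "u * (b * c)"]
    by (simp add: f_def algebra_simps)
  have f1: "f (1 / b) = 0" "f (1 / c) = 0"
    using bc th_inverse[of b] th_inverse[of c] dth_inverse[of b] dth_inverse[of c]
    by (simp_all add: f_def s_def field_simps)
  have fzero: "f u = 0" if u: "u \<noteq> 0" and d: "d \<noteq> 0" "th q (u * d) = 0" and fd: "f (1 / d) = 0" for u d
  proof -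
    have "u * d \<noteq> 0" using u d by simp
    then obtain n \<epsilon> where e: "u * d = p powi n * \<epsilon>" "\<epsilon> = 1 \<or> \<epsilon> = -1" using th_zero_cases d by blast
    have "u = p powi n * (\<epsilon> / d)" using e d by (simp add: field_simps)
    moreover have "f (\<epsilon> / d) = 0" using e(2) fd fneg[of "1 / d"] d by auto
    moreover have "\<epsilon> / d \<noteq> 0" using e(2) d by auto
    ultimately show ?thesis using p_powi_shift[of m f "\<epsilon> / d" n] m0 fp by blast
  qed
  have gd: "(g has_field_derivative (dth (u * b) / u * th q (u * c) + dth (u * c) / u * th q (u * b))) (at u)"
    if "u \<noteq> 0" for u
    unfolding g_def by (rule DERIV_mult[OF th_mult_const_deriv th_mult_const_deriv]) (use that bc in auto)
  have "\<exists>K. \<forall>u. u \<noteq> 0 \<longrightarrow> f u = K * g u"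
  proof (rule quotient_of_quasiperiodic_is_const[OF p])
    show "f holomorphic_on - {0}"
      unfolding f_def by (intro holomorphic_intros th_holo dth_holo th_mult_holo bc0)
    show "g holomorphic_on - {0}"
      unfolding g_def by (intro holomorphic_intros th_mult_holo bc)
    show "f u = 0 \<and> deriv g u \<noteq> 0" if u: "u \<noteq> 0" and z: "g u = 0" for u
    proof -
      have "u * b \<noteq> 0" "u * c \<noteq> 0" using u bc by auto
      have not_both: "\<not> (th q (u * b) = 0 \<and> th q (u * c) = 0)"
        using th_div_common_zero[OF u bc(1,2)] bc(5) by blast
      have "f u = 0" using z fzero[OF u bc(1) _ f1(1)] fzero[OF u bc(2) _ f1(2)] by (auto simp: g_def)
      moreover have "deriv g u \<noteq> 0"
        unfolding DERIV_imp_deriv[OF gd[OF u]]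
        using z not_both u dth_at_zero[OF \<open>u * b \<noteq> 0\<close>] dth_at_zero[OF \<open>u * c \<noteq> 0\<close>] by (auto simp: g_def)
      ultimately show ?thesis by simp
    qed
  qed (rule m0 fp gp; assumption)+
  then obtain K where K: "\<And>u. u \<noteq> 0 \<Longrightarrow> f u = K * g u" by blast
  have "dth 1 * th q (b * c) = K * (th q b * th q c)"
    using K[of 1] by (simp add: f_def g_def)
  then have K': "K = 2 * qpoch q q ^ 3 * th q (b * c) / (th q b * th q c)"
    using bc by (simp add: dth_1 field_simps)
  have "f a = K * g a" by (rule K[OF a])
  then have "f a / (th q a * th q (a * b * c)) = K * g a / (th q a * th q (a * b * c))" by simp
  moreover have "f a / (th q a * th q (a * b * c)) = dth a / th q a + s - dth (a * b * c) / th q (a * b * c)"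
    using nz by (simp add: f_def field_simps)
  ultimately show ?thesis unfolding K' g_def s_def using nz bc by (simp add: field_simps)
qed

end

subsection \<open>Winquist's identity\<close>

lemma cube_root_of_unity:
  obtains \<omega> :: complex where "\<omega> ^ 3 = 1" "\<omega> \<noteq> 1" "norm \<omega> = 1" "\<omega> \<noteq> 0" "1 + \<omega> + \<omega>\<^sup>2 = 0" "\<omega> - 1 / \<omega> \<noteq> 0"
proof -
  define \<omega> where "\<omega> = cis (2 * pi / 3)"
  have 3: "\<omega> ^ 3 = 1" unfolding \<omega>_def Complex.DeMoivre by simp
  have "cos (2 * pi / 3) = - 1 / 2" by (simp add: cos_120)
  then have 1: "\<omega> \<noteq> 1" by (auto simp: \<omega>_def complex_eq_iff)
  have n: "norm \<omega> = 1" by (simp add: \<omega>_def)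
  then have 0: "\<omega> \<noteq> 0" by auto
  have "(\<omega> - 1) * (1 + \<omega> + \<omega>\<^sup>2) = 0"
    using 3 by (simp add: algebra_simps power2_eq_square power3_eq_cube)
  then have s: "1 + \<omega> + \<omega>\<^sup>2 = 0" using 1 by simp
  have "\<omega> - 1 / \<omega> \<noteq> 0"
  proof
    assume "\<omega> - 1 / \<omega> = 0"
    then have "\<omega>\<^sup>2 = 1" using 0 by (simp add: field_simps power2_eq_square)
    then have "\<omega> ^ 3 = \<omega>" by (simp add: power3_eq_cube power2_eq_square)
    then show False using 3 1 by simp
  qed
  then show ?thesis using that[OF 3 1 n 0 s] by blast
qed

context nome
begin

definition al :: "complex \<Rightarrow> complex" where
  "al a = th (q ^ 3) (a ^ 3)"

lemma al_shift:
  assumes "a \<noteq> 0"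
  shows "al (p * a) = - 1 / (p ^ 3 * a ^ 6) * al a"
proof -
  interpret n3: nome "p ^ 3" "q ^ 3" by (rule nome_power) simp
  have "(a ^ 3)\<^sup>2 = a ^ 6" by (simp flip: power_mult)
  then show ?thesis
    using n3.th_shift[of "a ^ 3"] assms by (simp add: al_def power_mult_distrib)
qed

lemma al_minus: "a \<noteq> 0 \<Longrightarrow> al (- a) = - al a"
  and al_inverse: "a \<noteq> 0 \<Longrightarrow> al (1 / a) = - al a"
  and al_1: "a ^ 3 = 1 \<Longrightarrow> al a = 0"
proof -
  interpret n3: nome "p ^ 3" "q ^ 3" by (rule nome_power) simp
  show "a \<noteq> 0 \<Longrightarrow> al (- a) = - al a"
    using n3.th_minus[of "a ^ 3"] by (simp add: al_def power3_eq_cube)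
  show "a \<noteq> 0 \<Longrightarrow> al (1 / a) = - al a"
    using n3.th_inverse[of "a ^ 3"] by (simp add: al_def power_one_over)
  show "a ^ 3 = 1 \<Longrightarrow> al a = 0"
    using n3.th_1 by (simp add: al_def)
qed

lemma al_holo: "al holomorphic_on - {0}"
proof -
  interpret n3: nome "p ^ 3" "q ^ 3" by (rule nome_power) simp
  show ?thesis unfolding al_def[abs_def]
    by (rule holomorphic_on_compose_gen[unfolded o_def, OF _ n3.th_holo]) (auto intro!: holomorphic_intros)
qed

text \<open>The power \<omega>^x depends only on x modulo 3, so the classes 1 and 5 modulo 6 each
  reproduce the pentagonal series, with opposite signs.\<close>

lemma be_at_cube_root:
  assumes \<omega>: "\<omega> ^ 3 = 1" "\<omega> \<noteq> 0"
  shows "be q \<omega> = (\<omega> - 1 / \<omega>) * qpoch q q"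
proof -
  let ?b = "\<lambda>x. be_coeff q x * \<omega> powi x"
  have p3: "\<omega> powi (3 * m) = 1" for m
  proof -
    have "\<omega> powi (3 * m) = (\<omega> powi 3) powi m" by (rule power_int_mult)
    then show ?thesis using \<omega> by simp
  qed
  have w1: "\<omega> powi x = \<omega>" if "x mod 6 = 1" for x
  proof -
    have "x = 3 * (x div 3) + 1" using that by presburger
    then have "\<omega> powi x = \<omega> powi (3 * (x div 3) + 1)" by simp
    then show ?thesis using \<omega> p3 by (simp add: power_int_add)
  qed
  have t: "?b x = \<omega> * (of_int (chi4 x) * q ^ nat ((x\<^sup>2 - 1) div 24))" if "x mod 6 = 1" for x
  proof -
    have "\<not> 3 dvd x" using that by presburger
    then show ?thesis using w1[OF that] by (simp add: be_coeff_def)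
  qed
  have "((\<lambda>x. \<omega> * (of_int (chi4 x) * q ^ nat ((x\<^sup>2 - 1) div 24))) has_sum \<omega> * qpoch q q) {x. x mod 6 = 1}"
    by (rule has_sum_cmult_right[OF pentagonal])
  then have s1: "(?b has_sum \<omega> * qpoch q q) {x. x mod 6 = 1}"
    by (rule has_sum_cong[THEN iffD1, rotated]) (simp add: t)
  have t2: "?b (- x) = - 1 / \<omega> * (of_int (chi4 x) * q ^ nat ((x\<^sup>2 - 1) div 24))" if "x mod 6 = 1" for x
  proof -
    have "\<not> 3 dvd x" using that by presburger
    then show ?thesis using w1[OF that] by (simp add: be_coeff_def chi4_neg power_int_minus divide_inverse)
  qed
  have "((\<lambda>x. - 1 / \<omega> * (of_int (chi4 x) * q ^ nat ((x\<^sup>2 - 1) div 24))) has_sum - 1 / \<omega> * qpoch q q) {x. x mod 6 = 1}"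
    by (rule has_sum_cmult_right[OF pentagonal])
  then have "((\<lambda>x. ?b (- x)) has_sum - 1 / \<omega> * qpoch q q) {x. x mod 6 = 1}"
    by (rule has_sum_cong[THEN iffD1, rotated]) (simp add: t2)
  moreover have "bij_betw uminus {x :: int. x mod 6 = 1} {x. x mod 6 = 5}"
    by (rule bij_betwI[of _ _ _ uminus]; simp?; (rule funcsetI; simp; presburger)?)
  ultimately have s2: "(?b has_sum - 1 / \<omega> * qpoch q q) {x. x mod 6 = 5}"
    using has_sum_reindex_bij_betw[where g = uminus and f = ?b] by blast
  have "(?b has_sum (\<omega> * qpoch q q + - 1 / \<omega> * qpoch q q)) ({x. x mod 6 = 1} \<union> {x. x mod 6 = 5})"
    by (rule has_sum_Un_disjoint[OF s1 s2]) auto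
  then have "(?b has_sum (\<omega> * qpoch q q + - 1 / \<omega> * qpoch q q)) UNIV"
  proof (rule iffD1[OF has_sum_cong_neutral, rotated -1])
    fix x :: int assume x: "x \<in> UNIV - ({x. x mod 6 = 1} \<union> {x. x mod 6 = 5})"
    then have "even x \<or> 3 dvd x" by simp presburger
    then show "?b x = 0" by (auto simp: be_coeff_def chi4_even)
  qed auto
  with be_has_sum[OF \<omega>(2)] have "be q \<omega> = \<omega> * qpoch q q + - 1 / \<omega> * qpoch q q"
    by (rule has_sum_unique)
  then show ?thesis by (simp add: algebra_simps)
qed

text \<open>The factors at the three cube roots of unity multiply to products in q^3. Both values
  serve to normalise Winquist's identity at a = \<omega>.\<close>

lemma cube_root_products:
  assumes \<omega>: "\<omega> ^ 3 = 1" "\<omega> \<noteq> 1" "norm \<omega> = 1" "\<omega> \<noteq> 0" "1 + \<omega> + \<omega>\<^sup>2 = 0"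
  shows "b \<noteq> 0 \<Longrightarrow> qpoch (q ^ 3) (q ^ 3) * (th q b * th q (b * \<omega>) * th q (b * \<omega>\<^sup>2)) = qpoch q q ^ 3 * al b"
    and "th q \<omega> = (\<omega> - 1 / \<omega>) * qpoch (q ^ 3) (q ^ 3)"
proof -
  interpret n3: nome "p ^ 3" "q ^ 3" by (rule nome_power) simp
  have "\<omega>\<^sup>2 = (1 + \<omega> + \<omega>\<^sup>2) - 1 - \<omega>" by simp
  then have s: "\<omega>\<^sup>2 = - 1 - \<omega>" unfolding \<omega>(5) by simp
  then have s': "\<omega> + \<omega>\<^sup>2 = - 1" by simp
  have w4: "\<omega> * \<omega>\<^sup>2 = 1" using \<omega>(1) by (simp add: power3_eq_cube power2_eq_square mult.assoc)
  have root: "(\<Prod>j<3. 1 - \<omega> ^ j * y) = 1 - y ^ 3" for y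
  proof -
    have "(\<Prod>j<3. 1 - \<omega> ^ j * y) = (1 - y) * (1 - \<omega> * y) * (1 - \<omega>\<^sup>2 * y)"
      by (simp add: eval_nat_numeral lessThan_Suc)
    also have "\<dots> = (1 - y) * (1 - (\<omega> + \<omega>\<^sup>2) * y + (\<omega> * \<omega>\<^sup>2) * y * y)"
      by (simp add: algebra_simps)
    also have "\<dots> = (1 - y) * (1 + y + y * y)" unfolding w4 s' by simp
    also have "\<dots> = 1 - y ^ 3" by (simp add: algebra_simps power3_eq_cube)
    finally show ?thesis .
  qed
  have Q3: "qpoch q x * qpoch q (\<omega> * x) * qpoch q (\<omega>\<^sup>2 * x) = qpoch (q ^ 3) (x ^ 3)" for x
    using qpoch_prod_roots[OF q _ root, of x] by (simp add: eval_nat_numeral lessThan_Suc mult_ac)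
  show "th q \<omega> = (\<omega> - 1 / \<omega>) * qpoch (q ^ 3) (q ^ 3)"
  proof -
    have "1 / \<omega>\<^sup>2 = \<omega>" using w4 \<omega>(4) by (simp add: field_simps)
    moreover have "q / \<omega>\<^sup>2 = (1 / \<omega>\<^sup>2) * q" by simp
    ultimately have e: "q / \<omega>\<^sup>2 = \<omega> * q" by (simp only:)
    show ?thesis
      unfolding triple_product[OF q q0 \<omega>(4)] e Q3[of q, symmetric] by (simp add: mult_ac)
  qed
  assume b: "b \<noteq> 0"
  then have nz: "b * \<omega> \<noteq> 0" "b * \<omega>\<^sup>2 \<noteq> 0" "b ^ 3 \<noteq> 0" using \<omega> by auto
  define E where "E = qpoch q q"
  define x where "x = q * b\<^sup>2"
  define y where "y = q / b\<^sup>2"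
  have i: "1 / \<omega> = \<omega>\<^sup>2" "1 / \<omega>\<^sup>2 = \<omega>" using w4 \<omega>(4) by (simp_all add: field_simps)
  have ww: "(\<omega>\<^sup>2)\<^sup>2 = \<omega>" using w4 by (simp add: power2_eq_square mult_ac)
  have w4': "\<omega> ^ 4 = \<omega>" using \<omega>(1) by (simp add: eval_nat_numeral)
  have e1: "q * (b * \<omega>)\<^sup>2 = \<omega>\<^sup>2 * x" "q * (b * \<omega>\<^sup>2)\<^sup>2 = \<omega> * x"
    by (simp_all add: x_def power_mult_distrib w4' mult_ac)
  have e2: "q / (b * \<omega>)\<^sup>2 = \<omega> * y" "q / (b * \<omega>\<^sup>2)\<^sup>2 = \<omega>\<^sup>2 * y"
    unfolding y_def power_mult_distrib ww using i by (simp_all add: divide_inverse mult_ac)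
  have lin: "(b - 1 / b) * (b * \<omega> - 1 / (b * \<omega>)) * (b * \<omega>\<^sup>2 - 1 / (b * \<omega>\<^sup>2)) = b ^ 3 - 1 / b ^ 3"
  proof -
    have j: "1 / (b * \<omega>) = \<omega>\<^sup>2 / b" "1 / (b * \<omega>\<^sup>2) = \<omega> / b"
      using i by (simp_all add: divide_inverse mult_ac)
    have "(b * \<omega> - \<omega>\<^sup>2 / b) * (b * \<omega>\<^sup>2 - \<omega> / b) = (\<omega> * \<omega>\<^sup>2) * b\<^sup>2 - (\<omega>\<^sup>2 + (\<omega>\<^sup>2)\<^sup>2) + (\<omega> * \<omega>\<^sup>2) / b\<^sup>2"
      using b by (simp add: field_simps power2_eq_square)
    also have "\<dots> = b\<^sup>2 + 1 + 1 / b\<^sup>2" unfolding w4 ww s'[unfolded add.commute[of \<omega>]] by simp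
    finally have "(b * \<omega> - \<omega>\<^sup>2 / b) * (b * \<omega>\<^sup>2 - \<omega> / b) = b\<^sup>2 + 1 + 1 / b\<^sup>2" .
    then have "(b - 1 / b) * ((b * \<omega> - \<omega>\<^sup>2 / b) * (b * \<omega>\<^sup>2 - \<omega> / b)) = b ^ 3 - 1 / b ^ 3"
      using b by (simp add: field_simps power2_eq_square power3_eq_cube)
    then show ?thesis unfolding j by (simp add: mult.assoc)
  qed
  have x3: "x ^ 3 = q ^ 3 * (b ^ 3)\<^sup>2" "y ^ 3 = q ^ 3 / (b ^ 3)\<^sup>2"
    by (simp_all add: x_def y_def power_mult_distrib power_divide flip: power_mult)
  have "th q b * th q (b * \<omega>) * th q (b * \<omega>\<^sup>2) =
     E ^ 3 * ((b - 1 / b) * (b * \<omega> - 1 / (b * \<omega>)) * (b * \<omega>\<^sup>2 - 1 / (b * \<omega>\<^sup>2)))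
     * (qpoch q x * qpoch q (\<omega> * x) * qpoch q (\<omega>\<^sup>2 * x)) * (qpoch q y * qpoch q (\<omega> * y) * qpoch q (\<omega>\<^sup>2 * y))"
    unfolding triple_product[OF q q0 b] triple_product[OF q q0 nz(1)] triple_product[OF q q0 nz(2)] e1 e2
      x_def[symmetric] y_def[symmetric] E_def[symmetric] by (simp only: power3_eq_cube mult_ac)
  also have "\<dots> = E ^ 3 * (b ^ 3 - 1 / b ^ 3) * qpoch (q ^ 3) (x ^ 3) * qpoch (q ^ 3) (y ^ 3)"
    unfolding lin Q3 by (simp only: mult_ac)
  finally show "qpoch (q ^ 3) (q ^ 3) * (th q b * th q (b * \<omega>) * th q (b * \<omega>\<^sup>2)) = qpoch q q ^ 3 * al b"
    unfolding al_def triple_product[OF n3.q n3.q0 nz(3)] x3 E_def by (simp only: mult_ac)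
qed

text \<open>In the variable a both sides have the multiplier -1 / (p^3 a^6). The right side has
  simple zeros at 1, b and 1/b up to sign and powers of p; the assumption on th(b^2) keeps b and 1/b
  apart. There the left side vanishes by antisymmetry.\<close>

theorem winquist:
  assumes b: "b \<noteq> 0" "th q b \<noteq> 0" "th q (b * b) \<noteq> 0" "al b \<noteq> 0" and a: "a \<noteq> 0"
  shows "qpoch q q ^ 2 * (al a * be q b - be q a * al b) = th q a * th q b * th q (a * b) * th q (a / b)"
proof -
  define f where "f = (\<lambda>a. al a * be q b - be q a * al b)"
  define g where "g = (\<lambda>a. th q a * (th q (a * b) * th q (a * (1 / b))))"
  define m where "m = (\<lambda>u. - 1 / (p ^ 3 * u ^ 6))"
  have b': "1 / b \<noteq> 0" using b by simp
  have m0: "m u \<noteq> 0" if "u \<noteq> 0" for u using that p0 by (simp add: m_def)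
  have fp: "f (p * u) = m u * f u" if u: "u \<noteq> 0" for u
  proof -
    have e: "- 1 / (p ^ 3 * u ^ 6) = m u" by (simp add: m_def)
    show ?thesis unfolding f_def al_shift[OF u] be_shift[OF u] e by (simp add: algebra_simps)
  qed
  have gp: "g (p * u) = m u * g u" if u: "u \<noteq> 0" for u
  proof -
    have ub: "u * b \<noteq> 0" "u * (1 / b) \<noteq> 0" using u b by auto
    have e: "p * u * b = p * (u * b)" "p * u * (1 / b) = p * (u * (1 / b))" by simp_all
    have k: "(- 1 / (p * u\<^sup>2)) * ((- 1 / (p * (u * b)\<^sup>2)) * (- 1 / (p * (u * (1 / b))\<^sup>2))) = m u"
      using b by (simp add: m_def power_mult_distrib power_divide eval_nat_numeral mult_ac)
    show ?thesis
      unfolding g_def e th_shift[OF u] th_shift[OF ub(1)] th_shift[OF ub(2)] k[symmetric]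
      by (simp only: mult_ac)
  qed
  have fneg: "f (- u) = - f u" if u: "u \<noteq> 0" for u
    unfolding f_def al_minus[OF u] be_minus[OF u] by simp
  have f1: "f 1 = 0" "f b = 0" "f (1 / b) = 0"
    unfolding f_def using al_1[of 1] be_inverse[of 1] al_inverse[of b] be_inverse[of b] b by auto
  have fzero: "f u = 0" if u: "u \<noteq> 0" and d: "d \<noteq> 0" "th q (u * d) = 0" and fd: "f (1 / d) = 0" for u d
  proof -
    have "u * d \<noteq> 0" using u d by simp
    then obtain n \<epsilon> where e: "u * d = p powi n * \<epsilon>" "\<epsilon> = 1 \<or> \<epsilon> = -1" using th_zero_cases d by blast
    have "u = p powi n * (\<epsilon> / d)" using e d by (simp add: field_simps)
    moreover have "f (\<epsilon> / d) = 0" using e(2) fd fneg[of "1 / d"] d by auto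
    moreover have "\<epsilon> / d \<noteq> 0" using e(2) d by auto
    ultimately show ?thesis using p_powi_shift[of m f "\<epsilon> / d" n] m0 fp by blast
  qed
  have gd: "(g has_field_derivative (dth u / u * (th q (u * b) * th q (u * (1 / b))) +
      (dth (u * b) / u * th q (u * (1 / b)) + dth (u * (1 / b)) / u * th q (u * b)) * th q u)) (at u)"
    if "u \<noteq> 0" for u
    unfolding g_def by (rule DERIV_mult[OF th_deriv DERIV_mult[OF th_mult_const_deriv th_mult_const_deriv]])
      (use that b in auto)
  have "\<exists>K. \<forall>u. u \<noteq> 0 \<longrightarrow> f u = K * g u"
  proof (rule quotient_of_quasiperiodic_is_const[OF p])
    show "f holomorphic_on - {0}"
      unfolding f_def by (intro holomorphic_intros al_holo be_holo)
    show "g holomorphic_on - {0}"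
      unfolding g_def by (intro holomorphic_intros th_holo th_mult_holo b b')
    show "f u = 0 \<and> deriv g u \<noteq> 0" if u: "u \<noteq> 0" and z: "g u = 0" for u
    proof -
      have nz: "u * b \<noteq> 0" "u * (1 / b) \<noteq> 0" using u b by auto
      have 1: "\<not> (th q (u * 1) = 0 \<and> th q (u * b) = 0)" "\<not> (th q (u * 1) = 0 \<and> th q (u * (1 / b)) = 0)"
        "\<not> (th q (u * b) = 0 \<and> th q (u * (1 / b)) = 0)"
        using th_div_common_zero[OF u _ b(1), of 1] th_div_common_zero[OF u _ b', of 1]
          th_div_common_zero[OF u b(1) b'] b th_inverse[of b] by auto
      have "f u = 0"
        using z fzero[OF u, of 1] fzero[OF u b(1)] fzero[OF u b'] f1 by (auto simp: g_def)
      moreover have "deriv g u \<noteq> 0"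
        unfolding DERIV_imp_deriv[OF gd[OF u]]
        using z 1 u dth_at_zero[OF nz(1)] dth_at_zero[OF nz(2)] dth_at_zero[OF u] by (auto simp: g_def)
      ultimately show ?thesis by simp
    qed
  qed (rule m0 fp gp; assumption)+
  then obtain K where K: "\<And>u. u \<noteq> 0 \<Longrightarrow> f u = K * g u" by blast
  \<comment> \<open>The constant may still depend on b. It is read off at a primitive cube root of
    unity, where \<open>al\<close> vanishes and all other values are known products.\<close>
  obtain \<omega> :: complex where \<omega>: "\<omega> ^ 3 = 1" "\<omega> \<noteq> 1" "norm \<omega> = 1" "\<omega> \<noteq> 0" "1 + \<omega> + \<omega>\<^sup>2 = 0" "\<omega> - 1 / \<omega> \<noteq> 0"
    by (rule cube_root_of_unity)
  define E E3 where "E = qpoch q q" and "E3 = qpoch (q ^ 3) (q ^ 3)"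
  interpret n3: nome "p ^ 3" "q ^ 3" by (rule nome_power) simp
  have E: "E \<noteq> 0" "E3 \<noteq> 0" unfolding E_def E3_def by (rule qpoch_nonzero'[OF q q] qpoch_nonzero'[OF n3.q n3.q])+
  have fw: "f \<omega> = - (\<omega> - 1 / \<omega>) * E * al b"
    unfolding f_def al_1[OF \<omega>(1)] be_at_cube_root[OF \<omega>(1,4)] E_def
    by (simp only: mult_zero_left diff_0 mult_minus_left)
  have "1 / \<omega> = \<omega>\<^sup>2" using \<omega>(1,4) by (simp add: field_simps power3_eq_cube power2_eq_square)
  then have bw: "b / \<omega> = b * \<omega>\<^sup>2" by (simp add: divide_inverse)
  have "\<omega> * (1 / b) = 1 / (b * \<omega>\<^sup>2)" unfolding bw[symmetric] by simp
  then have wb: "th q (\<omega> * (1 / b)) = - th q (b * \<omega>\<^sup>2)"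
    using th_inverse[of "b * \<omega>\<^sup>2"] b \<omega>(4) by (simp only: mult_eq_0_iff) simp
  have gw: "g \<omega> = - (\<omega> - 1 / \<omega>) * E3 * (th q (b * \<omega>) * th q (b * \<omega>\<^sup>2))"
    unfolding g_def wb cube_root_products(2)[OF \<omega>(1-5)] E3_def
    by (simp only: mult_minus_left mult_minus_right mult_ac)
  have "f \<omega> * th q b = K * (g \<omega> * th q b)" using K[OF \<omega>(4)] by simp
  also have "g \<omega> * th q b = - (\<omega> - 1 / \<omega>) * (E ^ 3 * al b)"
    unfolding gw using cube_root_products(1)[OF \<omega>(1-5) b(1)] by (simp add: E_def E3_def mult_ac)
  finally have "(\<omega> - 1 / \<omega>) * (E * al b * th q b) = (\<omega> - 1 / \<omega>) * (K * (E ^ 3 * al b))"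
    unfolding fw by (simp add: algebra_simps)
  then have "E * al b * th q b = K * (E ^ 3 * al b)" using mult_left_cancel[OF \<omega>(6)] by blast
  then have K': "th q b = E\<^sup>2 * K" using b(4) E by (simp add: eval_nat_numeral)
  have "E\<^sup>2 * f a = th q b * g a" unfolding K[OF a] K' by (simp only: mult_ac)
  then show ?thesis by (simp add: f_def g_def E_def mult_ac)
qed

end

subsection \<open>The quaternary lattice sum\<close>

text \<open>The Legendre symbol modulo 11, by an explicit list of the squares so that it can be
  evaluated.\<close>

definition chi11 :: "int \<Rightarrow> int" where
  "chi11 a = (let r = a mod 11 in
     if r = 0 then 0 else if r \<in> {1, 3, 4, 5, 9} then 1 else -1)"

lemma chi11_mod [simp]: "chi11 (a mod 11) = chi11 a"
  by (simp add: chi11_def)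

lemma chi11_cong: "a mod 11 = b mod 11 \<Longrightarrow> chi11 a = chi11 b"
  by (simp add: chi11_def)

lemma mod11_cases:
  fixes a :: int
  obtains "a mod 11 = 0" | "a mod 11 = 1" | "a mod 11 = 2" | "a mod 11 = 3" | "a mod 11 = 4"
    | "a mod 11 = 5" | "a mod 11 = 6" | "a mod 11 = 7" | "a mod 11 = 8" | "a mod 11 = 9"
    | "a mod 11 = 10"
proof -
  have "a mod 11 \<in> {0..10}" by auto
  also have "{0..10::int} = {0,1,2,3,4,5,6,7,8,9,10}" by (simp add: simp_from_to)
  finally show ?thesis using that by (elim insertE) auto
qed

lemma chi11_mult: "chi11 (a * b) = chi11 a * chi11 b"
proof -
  have "chi11 (a * b) = chi11 ((a mod 11) * (b mod 11))"
    by (rule chi11_cong) (simp add: mod_mult_eq)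
  also have "\<dots> = chi11 (a mod 11) * chi11 (b mod 11)"
    by (rule mod11_cases[of a]; rule mod11_cases[of b]; simp add: chi11_def)
  finally show ?thesis by simp
qed

text \<open>The three linear forms and the constants 2, 2, 3 are those of \<open>T3\<close>, with
  square factors modulo 11 removed and z replaced by -z in the last two; see
  \<open>lattice_sum_twisted\<close>.\<close>

definition lin_char :: "int \<Rightarrow> int \<Rightarrow> int \<Rightarrow> int" where
  "lin_char x y z = 2 * chi11 (x + 2 * y + 4 * z) - 2 * chi11 (x + y + 2 * z) - 3 * chi11 (x + y + 4 * z)"

text \<open>Since the weight is odd in each of x, y, z, only the part of \<open>lin_char\<close>
  that is odd in each of them contributes.\<close>

definition alt_char :: "int \<Rightarrow> int \<Rightarrow> int \<Rightarrow> int" where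
  "alt_char x y z = lin_char x y z - lin_char (-x) y z - lin_char x (-y) z + lin_char (-x) (-y) z
            - lin_char x y (-z) + lin_char (-x) y (-z) + lin_char x (-y) (-z) - lin_char (-x) (-y) (-z)"

text \<open>Antisymmetrised in y and z only, because the reflection acts on w and x.\<close>

definition refl_char :: "int \<Rightarrow> int \<Rightarrow> int \<Rightarrow> int" where
  "refl_char x y z = chi11 (x + y + z) - chi11 (x - y + z) - chi11 (x + y - z) + chi11 (x - y - z)"

text \<open>Both \<open>refl_char\<close> terms have the same weighted sum, by reflection. The factor \<open>6\<close> is the one for which the
  symmetrisation in \<open>x, y, z\<close> vanishes on the cone \<open>w\<^sup>2 + 3 (x\<^sup>2 + y\<^sup>2 + z\<^sup>2) \<equiv> 0\<close>.\<close>

definition refl_defect :: "int \<Rightarrow> int \<Rightarrow> int \<Rightarrow> int \<Rightarrow> int" where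
  "refl_defect w x y z = alt_char x y z + 6 * (refl_char (4 * x) y z - refl_char (2 * (x - w)) y z)"

definition sym_defect :: "int \<Rightarrow> int \<Rightarrow> int \<Rightarrow> int \<Rightarrow> int" where
  "sym_defect w x y z = refl_defect w x y z + refl_defect w x z y + refl_defect w y x z + refl_defect w y z x + refl_defect w z x y + refl_defect w z y x"

text \<open>Scaling by the inverse of \<open>w\<close> and permuting \<open>x, y, z\<close> reduce the general case to these residues.\<close>

lemma sym_defect_check:
  "\<forall>w\<in>set [0,1]. \<forall>x\<in>set [0..10]. \<forall>y\<in>set [x..10]. \<forall>z\<in>set [y..10].
   if (w\<^sup>2 + 3 * (x\<^sup>2 + y\<^sup>2 + z\<^sup>2)) mod 11 = 0 then sym_defect w x y z = 0 else True"
  by code_simp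

lemma sym_defect_perm: "sym_defect w x y z = sym_defect w y x z" "sym_defect w x y z = sym_defect w x z y"
  by (simp_all add: sym_defect_def)

lemma sym_defect_cong:
  assumes "w mod 11 = w' mod 11" "x mod 11 = x' mod 11" "y mod 11 = y' mod 11" "z mod 11 = z' mod 11"
  shows "sym_defect w x y z = sym_defect w' x' y' z'"
proof -
  note c = assms[folded Cong.cong_def]
  have chi: "chi11 a = chi11 b" if "[a = b] (mod 11)" for a b
    using that unfolding Cong.cong_def by (rule chi11_cong)
  have refl_char: "refl_char a b c = refl_char a' b' c'" if "[a = a'] (mod 11)" "[b = b'] (mod 11)" "[c = c'] (mod 11)" for a b c a' b' c'
    unfolding refl_char_def
    by (intro arg_cong2[of _ _ _ _ "(-)"] arg_cong2[of _ _ _ _ "(+)"] chi cong_add cong_diff that)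
  have alt_char: "alt_char a b c = alt_char a' b' c'" if "[a = a'] (mod 11)" "[b = b'] (mod 11)" "[c = c'] (mod 11)" for a b c a' b' c'
    unfolding alt_char_def lin_char_def
    by (intro arg_cong2[of _ _ _ _ "(-)"] arg_cong2[of _ _ _ _ "(+)"] arg_cong2[of _ _ _ _ "(*)"] refl chi
        cong_refl cong_add cong_mult cong_diff cong_minus_minus_iff[THEN iffD2] that)
  have R: "refl_defect w a b c = refl_defect w' a' b' c'" if "[a = a'] (mod 11)" "[b = b'] (mod 11)" "[c = c'] (mod 11)" for a b c a' b' c'
    unfolding refl_defect_def
    by (intro arg_cong2[of _ _ _ _ "(-)"] arg_cong2[of _ _ _ _ "(+)"] arg_cong2[of _ _ _ _ "(*)"] refl
        cong_mult cong_diff cong_refl that c(1) alt_char refl_char)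
  show ?thesis unfolding sym_defect_def
    by (intro arg_cong2[of _ _ _ _ "(+)"] R c)
qed

lemma sym_defect_scale: "sym_defect (k * w) (k * x) (k * y) (k * z) = chi11 k * sym_defect w x y z"
proof -
  have "lin_char (k * a) (k * b) (k * c) = chi11 k * lin_char a b c" for a b c
  proof -
    have "k * a + 2 * (k * b) + 4 * (k * c) = k * (a + 2 * b + 4 * c)"
      "k * a + k * b + 2 * (k * c) = k * (a + b + 2 * c)"
      "k * a + k * b + 4 * (k * c) = k * (a + b + 4 * c)"
      by (simp_all add: algebra_simps)
    then show ?thesis unfolding lin_char_def by (simp add: chi11_mult right_diff_distrib mult_ac)
  qed
  from this[of "- _"] this this[of _ "- _"] this[of "- _" "- _"]
    this[of _ _ "- _"] this[of "- _" _ "- _"] this[of _ "- _" "- _"] this[of "- _" "- _" "- _"]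
  have alt_char: "alt_char (k * a) (k * b) (k * c) = chi11 k * alt_char a b c" for a b c
    by (simp add: alt_char_def algebra_simps)
  have refl_char: "refl_char (k * a) (k * b) (k * c) = chi11 k * refl_char a b c" for a b c
    by (simp add: refl_char_def chi11_mult flip: distrib_left right_diff_distrib)
  have R: "refl_defect (k * w) (k * a) (k * b) (k * c) = chi11 k * refl_defect w a b c" for a b c
  proof -
    have e: "4 * (k * a) = k * (4 * a)" "2 * (k * a - k * w) = k * (2 * (a - w))"
      by (simp_all add: algebra_simps)
    show ?thesis unfolding refl_defect_def e alt_char refl_char by (simp add: algebra_simps)
  qed
  show ?thesis unfolding sym_defect_def R by (simp add: distrib_left)
qed

lemma sym_defect_eq_0:
  assumes "(w\<^sup>2 + 3 * (x\<^sup>2 + y\<^sup>2 + z\<^sup>2)) mod 11 = 0"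
  shows "sym_defect w x y z = 0"
proof -
  define N where "N = (\<lambda>w x y z :: int. (w\<^sup>2 + 3 * (x\<^sup>2 + y\<^sup>2 + z\<^sup>2)) mod 11)"
  have Ncong: "N w x y z = N (w mod 11) (x mod 11) (y mod 11) (z mod 11)" for w x y z
    unfolding N_def Cong.cong_def[symmetric]
    by (intro cong_add cong_mult cong_pow cong_refl) (simp_all add: Cong.cong_def)
  have Nperm: "N w x y z = N w y x z" "N w x y z = N w x z y" for w x y z
    by (simp_all add: N_def algebra_simps)
  have main: "sym_defect w x y z = 0" if "w \<in> {0, 1}" "N w x y z = 0" for w x y z
  proof -
    define P where "P = (\<lambda>x y z. N w x y z = 0 \<longrightarrow> sym_defect w x y z = 0)"
    have P1: "P x y z \<longleftrightarrow> P y x z" and P2: "P x y z \<longleftrightarrow> P x z y" for x y z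
      unfolding P_def by (metis sym_defect_perm Nperm)+
    have Pcong: "P x y z \<longleftrightarrow> P (x mod 11) (y mod 11) (z mod 11)" for x y z
      unfolding P_def using sym_defect_cong[of w w x "x mod 11" y "y mod 11" z "z mod 11"]
        Ncong[of w x y z] Ncong[of w "x mod 11" "y mod 11" "z mod 11"] by simp
    have srt: "P x y z" if "0 \<le> x" "x \<le> y" "y \<le> z" "z \<le> 10" for x y z
    proof -
      have mem: "w \<in> set [0, 1]" "x \<in> set [0..10]" "y \<in> set [x..10]" "z \<in> set [y..10]"
        using that \<open>w \<in> {0, 1}\<close> by auto
      show ?thesis
        using sym_defect_check[THEN bspec, OF mem(1), THEN bspec, OF mem(2), THEN bspec, OF mem(3),
          THEN bspec, OF mem(4)] by (auto simp: P_def N_def split: if_splits)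
    qed
    have "P (x mod 11) (y mod 11) (z mod 11)"
    proof -
      have *: "P a b c" if "0 \<le> a" "0 \<le> b" "0 \<le> c" "a \<le> 10" "b \<le> 10" "c \<le> 10" for a b c
        using that srt P1 P2 by (metis linear)
      have "a mod 11 \<le> 10" for a :: int using pos_mod_bound[of 11 a] by simp
      then show ?thesis by (intro *) auto
    qed
    then show ?thesis using Pcong that(2) unfolding P_def by blast
  qed
  have N0: "N w x y z = 0" using assms by (simp add: N_def)
  show ?thesis
  proof (cases "w mod 11 = 0")
    case True
    have "sym_defect 0 x y z = 0"
      using main[of 0 x y z] N0 Ncong[of w x y z] Ncong[of 0 x y z] True by simp
    then show ?thesis using sym_defect_cong[of w 0 x x y y z z] True by simp
  next
    case False
    have "\<exists>k. (k * w) mod 11 = 1 \<and> chi11 k \<noteq> 0"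
    proof -
      have "\<exists>k\<in>{1..10}. (k * (w mod 11)) mod 11 = 1 \<and> chi11 k \<noteq> 0"
        by (rule mod11_cases[of w]; (use False in simp; fail)?; simp add: chi11_def; simp add: simp_from_to)
      then show ?thesis by (auto simp: mod_mult_right_eq)
    qed
    then obtain k where k: "(k * w) mod 11 = 1" "chi11 k \<noteq> 0" by blast
    have "N (k * w) (k * x) (k * y) (k * z) = (k\<^sup>2 * (w\<^sup>2 + 3 * (x\<^sup>2 + y\<^sup>2 + z\<^sup>2))) mod 11"
      unfolding N_def by (simp add: algebra_simps power_mult_distrib)
    also have "\<dots> = 0" using assms by (auto simp: mod_eq_0_iff_dvd)
    finally have "N 1 (k * x) (k * y) (k * z) = 0"
      using Ncong[of "k * w" "k * x" "k * y" "k * z"] Ncong[of 1 "k * x" "k * y" "k * z"] k by simp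
    then have "sym_defect 1 (k * x) (k * y) (k * z) = 0" by (intro main) auto
    then have "sym_defect (k * w) (k * x) (k * y) (k * z) = 0"
      using sym_defect_cong[of "k * w" 1 "k * x" "k * x" "k * y" "k * y" "k * z" "k * z"] k by simp
    then show ?thesis using k by (simp add: sym_defect_scale)
  qed
qed

lemma sum_involution_split:
  fixes f :: "'a \<Rightarrow> 'b::comm_monoid_add"
  assumes "finite S" "\<And>v. v \<in> S \<Longrightarrow> \<phi> v \<in> S" "\<And>v. v \<in> S \<Longrightarrow> \<phi> (\<phi> v) = v"
    "\<And>v. v \<in> S \<Longrightarrow> P (\<phi> v) \<longleftrightarrow> \<not> P v"
  shows "sum f S = (\<Sum>v | v \<in> S \<and> P v. f v + f (\<phi> v))"
proof -
  have "sum f S = sum f ({v \<in> S. P v} \<union> {v \<in> S. \<not> P v})"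
    by (rule sum.cong) auto
  also have "\<dots> = sum f {v \<in> S. P v} + sum f {v \<in> S. \<not> P v}"
    using assms(1) by (intro sum.union_disjoint) auto
  also have "sum f {v \<in> S. \<not> P v} = (\<Sum>v | v \<in> S \<and> P v. f (\<phi> v))"
    by (rule sum.reindex_bij_witness[of _ \<phi> \<phi>]) (use assms in auto)
  finally show ?thesis by (simp add: sum.distrib)
qed

lemma chi4_odd_neg: "odd w \<Longrightarrow> (w + x) mod 4 = 0 \<Longrightarrow> chi4 w * chi4 x = -1"
proof -
  assume a: "odd w" "(w + x) mod 4 = 0"
  then have "w mod 4 = 1 \<and> x mod 4 = 3 \<or> w mod 4 = 3 \<and> x mod 4 = 1" by presburger
  then show ?thesis by (auto simp: chi4_def)
qed

text \<open>The index set of one coefficient of (q;q) times three theta values: w comes from the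
  pentagonal series, and M = 24 n + 10 at exponent n.\<close>

definition shell :: "int \<Rightarrow> (int \<times> int \<times> int \<times> int) set" where
  "shell M = {(w, x, y, z). w mod 6 = 1 \<and> odd x \<and> odd y \<and> odd z \<and> w\<^sup>2 + 3 * (x\<^sup>2 + y\<^sup>2 + z\<^sup>2) = M}"

definition shell_weight :: "int \<times> int \<times> int \<times> int \<Rightarrow> int" where
  "shell_weight = (\<lambda>(w, x, y, z). chi4 w * chi4 x * chi4 y * chi4 z)"

lemma finite_shell: "finite (shell M)"
proof -
  have "abs a \<le> M" if "a\<^sup>2 \<le> M" for a :: int
  proof (cases "a = 0")
    case False
    then have "abs a * 1 \<le> abs a * abs a" by (intro mult_left_mono) auto
    then show ?thesis using that by (simp add: power2_eq_square)
  qed (use that in simp)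
  then have b: "a \<in> {-M..M}" if "a\<^sup>2 \<le> M" for a :: int
    using that by fastforce
  have "shell M \<subseteq> {-M..M} \<times> {-M..M} \<times> {-M..M} \<times> {-M..M}"
  proof
    fix v assume "v \<in> shell M"
    then obtain w x y z where v: "v = (w, x, y, z)" "w\<^sup>2 + 3 * (x\<^sup>2 + y\<^sup>2 + z\<^sup>2) = M"
      by (auto simp: shell_def)
    have "a \<le> M \<and> b \<le> M \<and> c \<le> M \<and> d \<le> M"
      if "a + 3 * (b + c + d) = M" "a \<ge> 0" "b \<ge> 0" "c \<ge> 0" "d \<ge> 0" for a b c d :: int
      using that by auto
    from this[OF v(2)] have "w\<^sup>2 \<le> M \<and> x\<^sup>2 \<le> M \<and> y\<^sup>2 \<le> M \<and> z\<^sup>2 \<le> M" by simp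
    then show "v \<in> {-M..M} \<times> {-M..M} \<times> {-M..M} \<times> {-M..M}" using v(1) b by blast
  qed
  then show ?thesis by (rule finite_subset) auto
qed

theorem lattice_sum_zero:
  assumes "M mod 11 = 0"
  shows "(\<Sum>(w, x, y, z)\<in>shell M. shell_weight (w, x, y, z) * lin_char x y z) = 0"
proof -
  \<comment> \<open>Of x and -x exactly one makes w + x divisible by 4. On this half (w + x) / 2 is
    even, so the reflection preserves integrality, parity and the class of w modulo 6.\<close>
  define Hx where "Hx = {v \<in> shell M. case v of (w, x, y, z) \<Rightarrow> (w + x) mod 4 = 0}"
  define Hy where "Hy = {v \<in> Hx. case v of (w, x, y, z) \<Rightarrow> (w + y) mod 4 = 0}"
  define B where "B = {v \<in> Hy. case v of (w, x, y, z) \<Rightarrow> (w + z) mod 4 = 0}"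
  have fin: "finite Hx" "finite Hy" "finite B"
    by (simp_all add: Hx_def Hy_def B_def finite_shell)
  have odd: "odd w" if "w mod 6 = 1" for w :: int using that by presburger
  have flip: "(4 dvd w - x \<longleftrightarrow> \<not> 4 dvd w + x) \<and> ((w - x) mod 4 = 0 \<longleftrightarrow> (w + x) mod 4 \<noteq> 0)"
    if "w mod 6 = 1" "odd x" for w x :: int
    using that by presburger
  have sx: "(\<Sum>v\<in>shell M. case v of (w, x, y, z) \<Rightarrow> shell_weight v * F w x y z) =
      (\<Sum>v\<in>Hx. case v of (w, x, y, z) \<Rightarrow> shell_weight v * (F w x y z - F w (-x) y z))" for F
    unfolding Hx_def
    by (subst sum_involution_split[OF finite_shell, where \<phi> = "\<lambda>(w, x, y, z). (w, -x, y, z)"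
          and P = "\<lambda>(w, x, y, z). (w + x) mod 4 = 0"])
       (auto simp: shell_def shell_weight_def chi4_neg flip algebra_simps intro!: sum.cong)
  have sy: "(\<Sum>v\<in>Hx. case v of (w, x, y, z) \<Rightarrow> shell_weight v * F w x y z) =
      (\<Sum>v\<in>Hy. case v of (w, x, y, z) \<Rightarrow> shell_weight v * (F w x y z - F w x (-y) z))" for F
    unfolding Hy_def
    by (subst sum_involution_split[OF fin(1), where \<phi> = "\<lambda>(w, x, y, z). (w, x, -y, z)"
          and P = "\<lambda>(w, x, y, z). (w + y) mod 4 = 0"])
       (auto simp: Hx_def shell_def shell_weight_def chi4_neg flip algebra_simps intro!: sum.cong)
  have sz: "(\<Sum>v\<in>Hy. case v of (w, x, y, z) \<Rightarrow> shell_weight v * F w x y z) =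
      (\<Sum>v\<in>B. case v of (w, x, y, z) \<Rightarrow> shell_weight v * (F w x y z - F w x y (-z)))" for F
    unfolding B_def
    by (subst sum_involution_split[OF fin(2), where \<phi> = "\<lambda>(w, x, y, z). (w, x, y, -z)"
          and P = "\<lambda>(w, x, y, z). (w + z) mod 4 = 0"])
       (auto simp: Hy_def Hx_def shell_def shell_weight_def chi4_neg flip algebra_simps intro!: sum.cong)
  have sG: "(\<Sum>v\<in>shell M. case v of (w, x, y, z) \<Rightarrow> shell_weight v * lin_char x y z) =
      (\<Sum>v\<in>B. case v of (w, x, y, z) \<Rightarrow> shell_weight v * alt_char x y z)"
    by (subst sx, subst sy, subst sz) (simp add: alt_char_def algebra_simps)
  have sK: "(\<Sum>v\<in>Hx. case v of (w, x, y, z) \<Rightarrow> shell_weight v * chi11 (a w x + y + z)) =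
      (\<Sum>v\<in>B. case v of (w, x, y, z) \<Rightarrow> shell_weight v * refl_char (a w x) y z)" for a
    by (subst sy, subst sz) (simp add: refl_char_def algebra_simps)
  \<comment> \<open>The reflection carries 2 (x - w) to 4 x; this is the origin of the two first
    arguments in \<open>refl_defect\<close>.\<close>
  have refl: "(\<Sum>v\<in>Hx. case v of (w, x, y, z) \<Rightarrow> shell_weight v * chi11 (4 * x + y + z)) =
      (\<Sum>v\<in>Hx. case v of (w, x, y, z) \<Rightarrow> shell_weight v * chi11 (2 * (x - w) + y + z))"
  proof -
    \<comment> \<open>The reflection of w^2 + 3 x^2 along the vector (3, 1). On \<open>Hx\<close>
      the product of the two characters at w and x is always -1, so the weight is preserved.\<close>
    define r where "r = (\<lambda>(w, x, y, z). let k = (w + x) div 2 in (w - 3 * k, x - k, y, z :: int) :: int \<times> int \<times> int \<times> int)"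
    have key: "r (w, x, y, z) \<in> Hx \<and> r (r (w, x, y, z)) = (w, x, y, z) \<and> shell_weight (r (w, x, y, z)) = shell_weight (w, x, y, z)
        \<and> 2 * ((x - (w + x) div 2) - (w - 3 * ((w + x) div 2))) = 4 * x"
      if "(w, x, y, z) \<in> Hx" for w x y z
    proof -
      from that have h: "w mod 6 = 1" "odd x" "odd y" "odd z" "w\<^sup>2 + 3 * (x\<^sup>2 + y\<^sup>2 + z\<^sup>2) = M"
        "(w + x) mod 4 = 0" by (auto simp: Hx_def shell_def)
      obtain m where m: "w + x = 4 * m" using h(6) by (auto elim: dvdE simp: mod_eq_0_iff_dvd)
      have k: "(w + x) div 2 = 2 * m" using m by simp
      have x: "x = 4 * m - w" using m by simp
      have w': "(w - 6 * m) mod 6 = 1" using h(1) by presburger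
      have n: "(w - 6 * m)\<^sup>2 + 3 * ((x - 2 * m)\<^sup>2 + y\<^sup>2 + z\<^sup>2) = M"
        unfolding h(5)[symmetric] x by (simp add: power2_eq_square algebra_simps)
      have s: "((w - 6 * m) + (x - 2 * m)) mod 4 = 0" using m by presburger
      have c: "chi4 (w - 6 * m) * chi4 (x - 2 * m) = chi4 w * chi4 x"
        using chi4_odd_neg[OF odd[OF w'] s] chi4_odd_neg[OF odd[OF h(1)] h(6)] by simp
      have k2: "(w - 6 * m + (x - 2 * m)) div 2 = - 2 * m" using m by simp
      show ?thesis
        using h w' n s c k k2 x by (simp add: r_def Let_def Hx_def shell_def shell_weight_def)
    qed
    have val: "(case r v of (w, x, y, z) \<Rightarrow> shell_weight (r v) * chi11 (2 * (x - w) + y + z)) =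
        (case v of (w, x, y, z) \<Rightarrow> shell_weight v * chi11 (4 * x + y + z))" if "v \<in> Hx" for v
    proof -
      obtain w x y z where v: "v = (w, x, y, z)" by (cases v) auto
      define k where "k = (w + x) div 2"
      have rv: "r v = (w - 3 * k, x - k, y, z)" by (simp add: r_def v k_def Let_def)
      have *: "shell_weight (r v) = shell_weight v" "2 * ((x - k) - (w - 3 * k)) = 4 * x"
        using key[of w x y z] that by (simp_all add: v k_def)
      have "(case r v of (w, x, y, z) \<Rightarrow> shell_weight (r v) * chi11 (2 * (x - w) + y + z)) =
          shell_weight (r v) * chi11 (2 * ((x - k) - (w - 3 * k)) + y + z)"
        by (simp only: rv prod.case)
      also have "\<dots> = (case v of (w, x, y, z) \<Rightarrow> shell_weight v * chi11 (4 * x + y + z))"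
        unfolding * by (simp add: v)
      finally show ?thesis .
    qed
    show ?thesis
      by (rule sum.reindex_bij_witness[of _ r r]) (use key val in auto)
  qed
  \<comment> \<open>The passage to \<open>refl_defect\<close> adds six times the difference of two
    sums that \<open>refl\<close> shows to be equal.\<close>
  have R: "(\<Sum>v\<in>B. case v of (w, x, y, z) \<Rightarrow> shell_weight v * alt_char x y z) =
      (\<Sum>v\<in>B. case v of (w, x, y, z) \<Rightarrow> shell_weight v * refl_defect w x y z)"
  proof -
    have "(\<Sum>v\<in>B. case v of (w, x, y, z) \<Rightarrow> shell_weight v * refl_defect w x y z) =
        (\<Sum>v\<in>B. case v of (w, x, y, z) \<Rightarrow> shell_weight v * alt_char x y z) +
        6 * ((\<Sum>v\<in>B. case v of (w, x, y, z) \<Rightarrow> shell_weight v * refl_char (4 * x) y z) -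
             (\<Sum>v\<in>B. case v of (w, x, y, z) \<Rightarrow> shell_weight v * refl_char (2 * (x - w)) y z))"
      unfolding sum_distrib_left sum_subtractf[symmetric] sum.distrib[symmetric]
      by (rule sum.cong) (auto simp: refl_defect_def algebra_simps)
    then show ?thesis
      unfolding sK[of "\<lambda>w x. 4 * x", symmetric] sK[of "\<lambda>w x. 2 * (x - w)", symmetric] refl by simp
  qed
  have perm: "(\<Sum>v\<in>B. case v of (w, x, y, z) \<Rightarrow> shell_weight v * F w x y z) =
              (\<Sum>v\<in>B. case v of (w, x, y, z) \<Rightarrow> shell_weight v * F w y x z)"
             "(\<Sum>v\<in>B. case v of (w, x, y, z) \<Rightarrow> shell_weight v * F w x y z) =
              (\<Sum>v\<in>B. case v of (w, x, y, z) \<Rightarrow> shell_weight v * F w x z y)" for F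
    by (rule sum.reindex_bij_witness[of _ "\<lambda>(w, x, y, z). (w, y, x, z)" "\<lambda>(w, x, y, z). (w, y, x, z)"];
        auto simp: B_def Hy_def Hx_def shell_def shell_weight_def algebra_simps)
       (rule sum.reindex_bij_witness[of _ "\<lambda>(w, x, y, z). (w, x, z, y)" "\<lambda>(w, x, y, z). (w, x, z, y)"];
        auto simp: B_def Hy_def Hx_def shell_def shell_weight_def algebra_simps)
  define T where "T = (\<lambda>F. \<Sum>v\<in>B. case v of (w, x, y, z) \<Rightarrow> shell_weight v * F w x y z)"
  have "T (\<lambda>w x y z. sym_defect w x y z) = T (\<lambda>w x y z. refl_defect w x y z) + T (\<lambda>w x y z. refl_defect w x z y)
     + T (\<lambda>w x y z. refl_defect w y x z) + T (\<lambda>w x y z. refl_defect w y z x) + T (\<lambda>w x y z. refl_defect w z x y) + T (\<lambda>w x y z. refl_defect w z y x)"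
    unfolding T_def sym_defect_def sum.distrib[symmetric] by (rule sum.cong) (auto simp: algebra_simps)
  also have "\<dots> = 6 * T refl_defect"
  proof -
    have p1: "T (\<lambda>w x y z. F w y x z) = T F" and p2: "T (\<lambda>w x y z. F w x z y) = T F" for F
      unfolding T_def by (rule perm(1)[symmetric], rule perm(2)[symmetric])
    have "T (\<lambda>w x y z. refl_defect w x z y) = T refl_defect" "T (\<lambda>w x y z. refl_defect w y x z) = T refl_defect"
      by (rule p2 p1)+
    moreover have "T (\<lambda>w x y z. refl_defect w y z x) = T refl_defect"
      using p1[of "\<lambda>w x y z. refl_defect w x z y"] p2[of refl_defect] by (rule trans)
    moreover have "T (\<lambda>w x y z. refl_defect w z x y) = T refl_defect"
      using p2[of "\<lambda>w x y z. refl_defect w y x z"] p1[of refl_defect] by (rule trans)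
    moreover have "T (\<lambda>w x y z. refl_defect w z y x) = T (\<lambda>w x y z. refl_defect w y z x)"
      by (rule p2)
    ultimately show ?thesis by presburger
  qed
  also have "T (\<lambda>w x y z. sym_defect w x y z) = 0"
    unfolding T_def
  proof (rule sum.neutral, safe)
    fix w x y z assume "(w, x, y, z) \<in> B"
    then have "w\<^sup>2 + 3 * (x\<^sup>2 + y\<^sup>2 + z\<^sup>2) = M" by (auto simp: B_def Hy_def Hx_def shell_def)
    then show "shell_weight (w, x, y, z) * sym_defect w x y z = 0" using sym_defect_eq_0 assms by simp
  qed
  finally have "T refl_defect = 0" by simp
  then show ?thesis using sG R by (simp add: T_def case_prod_unfold)
qed

subsection \<open>Theta values at eleventh roots of unity\<close>

definition om :: complex where
  "om = cis (2 * pi / 11)"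

lemma om_nonzero [simp]: "om \<noteq> 0"
  by (simp add: om_def)

lemma norm_om [simp]: "norm om = 1"
  by (simp add: om_def)

lemma om_11: "om ^ 11 = 1"
  unfolding om_def Complex.DeMoivre by simp

lemma om_inj: "inj_on (\<lambda>j. om ^ j) {..<11}"
proof -
  have "bij_betw (\<lambda>k. cis (2 * pi * real k / real 11)) {..<11} {z. z ^ 11 = 1}"
    by (rule Complex.bij_betw_roots_unity) simp
  then have "inj_on (\<lambda>k. cis (2 * pi * real k / real 11)) {..<11}" by (rule bij_betw_imp_inj_on)
  moreover have "cis (2 * pi * real k / real 11) = om ^ k" for k
    unfolding om_def Complex.DeMoivre by (simp add: mult_ac)
  ultimately show ?thesis by simp
qed

definition rt :: "int \<Rightarrow> complex" where
  "rt k = om powi k"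

lemma rt_add: "rt (a + b) = rt a * rt b"
  by (simp add: rt_def power_int_add)

lemma rt_minus: "rt (- a) = 1 / rt a"
  by (simp add: rt_def power_int_minus divide_inverse)

lemma rt_diff: "rt (a - b) = rt a / rt b"
  by (simp add: rt_def power_int_diff)

lemma rt_double: "rt (2 * k) = rt k * rt k"
  using rt_add[of k k] by simp

lemma rt_nonzero [simp]: "rt a \<noteq> 0"
  by (simp add: rt_def)

lemma norm_rt [simp]: "norm (rt a) = 1"
  by (simp add: rt_def norm_power_int)

lemma rt_mult: "rt (a * b) = rt a powi b"
  by (simp add: rt_def power_int_mult)

lemma rt_nat: "rt (int n) = om ^ n"
  by (simp add: rt_def)

lemma rt_0 [simp]: "rt 0 = 1"
  by (simp add: rt_def)

lemma rt_11 [simp]: "rt 11 = 1"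
  using rt_nat[of 11] om_11 by simp

lemma rt_mod: "rt (k mod 11) = rt k"
proof -
  have "rt k = rt (11 * (k div 11) + k mod 11)" by simp
  also have "\<dots> = rt (k mod 11)" by (simp only: rt_add rt_mult rt_11) simp
  finally show ?thesis ..
qed

lemma rt_cong: "a mod 11 = b mod 11 \<Longrightarrow> rt a = rt b"
  by (metis rt_mod)

lemma rt_eq_1_iff: "rt k = 1 \<longleftrightarrow> 11 dvd k"
proof
  assume "rt k = 1"
  then have "om ^ nat (k mod 11) = om ^ 0"
    using rt_mod[of k] rt_nat[of "nat (k mod 11)"] by simp
  moreover have "nat (k mod 11) < 11" by simp
  ultimately have "nat (k mod 11) = 0"
    using inj_onD[OF om_inj, of "nat (k mod 11)" 0] by simp
  moreover have "k mod 11 \<ge> 0" by simp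
  ultimately show "11 dvd k" by (simp add: mod_eq_0_iff_dvd[symmetric] del: mod_eq_0_iff_dvd)
next
  assume "11 dvd k"
  then show "rt k = 1" using rt_mod[of k] by (simp add: mod_eq_0_iff_dvd)
qed

lemma rt_square_neq_1: "\<not> 11 dvd k \<Longrightarrow> (rt k)\<^sup>2 \<noteq> 1"
proof
  assume k: "\<not> 11 dvd k" "(rt k)\<^sup>2 = 1"
  have "rt (2 * k) = (rt k)\<^sup>2" by (simp add: rt_double power2_eq_square)
  then have "11 dvd 2 * k" using k rt_eq_1_iff by simp
  then show False using k(1) by presburger
qed

lemma rt_minus_inverse_nonzero: "\<not> 11 dvd k \<Longrightarrow> rt k - 1 / rt k \<noteq> 0"
  using rt_square_neq_1[of k] by (simp add: field_simps power2_eq_square)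

lemma sum_rt: "(\<Sum>k=1..10. rt (int k * n)) = (if 11 dvd n then 10 else -1)"
proof (cases "11 dvd n")
  case True
  then have "rt (int k * n) = 1" for k by (simp add: rt_eq_1_iff)
  then show ?thesis using True by simp
next
  case False
  have "(\<Sum>k<11. rt n ^ k) = (1 - rt n ^ 11) / (1 - rt n)"
    using False rt_eq_1_iff by (subst sum_gp_strict) auto
  also have "rt n ^ 11 = 1"
    using rt_mult[of 11 n] rt_mult[of n 11] by (simp add: mult.commute)
  finally have "(\<Sum>k<11. rt n ^ k) = 0" by simp
  moreover have "{..<11} = insert 0 {1..10 :: nat}" by auto
  moreover have "rt (int k * n) = rt n ^ k" for k
    using rt_mult[of n "int k"] by (simp add: mult.commute)
  ultimately show ?thesis using False by (simp add: add_eq_0_iff)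
qed

lemma sum_reflect11: "(\<Sum>k=1..10. f (int k)) = (\<Sum>k=1..10. f (11 - int k))"
  by (rule sum.reindex_bij_witness[of _ "\<lambda>k. 11 - k" "\<lambda>k. 11 - k"]) (auto simp: of_nat_diff)

definition residue :: "int \<Rightarrow> int" where
  "residue c = (c + 5) mod 11 - 5"

definition residue_hat :: "int \<Rightarrow> complex" where
  "residue_hat k = - 1 / (rt k - 1 / rt k)"

lemma residue_hat_reflect: "residue_hat (11 - k) = - residue_hat k"
proof -
  have "rt (11 - k) = 1 / rt k" by (simp add: rt_diff)
  then have "rt (11 - k) - 1 / rt (11 - k) = - (rt k - 1 / rt k)" by simp
  then show ?thesis unfolding residue_hat_def by (simp only: divide_minus_right)
qed

text \<open>Passing from c to c + 1 multiplies the k-th term by (rt k)^2, and (rt k)^2 - 1 cancels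
  the denominator of \<open>residue_hat\<close>. What remains is a sum of roots of unity: the step
  is 1, except for the jump from 5 to -5 when 11 divides 2 c + 1. Oddness in k gives the value 0 at
  c = 0.\<close>

lemma residue_hat_transform: "(\<Sum>k=1..10. residue_hat (int k) * rt (2 * int k * c)) = of_int (residue c)"
proof -
  define g where "g = (\<lambda>c. \<Sum>k=1..10. residue_hat (int k) * rt (2 * int k * c))"
  have step: "g (c + 1) = g c + (if 11 dvd 2 * c + 1 then -10 else 1)" for c
  proof -
    have "residue_hat (int k) * rt (2 * int k * (c + 1)) - residue_hat (int k) * rt (2 * int k * c) = - rt (int k * (2 * c + 1))"
      if "k \<in> {1..10}" for k
    proof -
      have "\<not> 11 dvd int k" using that zdvd_not_zless[of "int k" 11] by auto
      then have nz: "rt (int k) - 1 / rt (int k) \<noteq> 0" by (rule rt_minus_inverse_nonzero)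
      have "rt (2 * int k * (c + 1)) = rt (2 * int k * c) * (rt (int k) * rt (int k))"
        by (simp add: rt_add distrib_left rt_double)
      moreover have "rt (int k * (2 * c + 1)) = rt (2 * int k * c) * rt (int k)"
        by (simp add: rt_add distrib_left mult_ac)
      moreover have "rt (int k) * rt (int k) - 1 = rt (int k) * (rt (int k) - 1 / rt (int k))"
        by (simp add: right_diff_distrib)
      ultimately have "rt (2 * int k * (c + 1)) - rt (2 * int k * c) = rt (int k * (2 * c + 1)) * (rt (int k) - 1 / rt (int k))"
        by (simp add: algebra_simps)
      moreover have "- 1 / D * A - - 1 / D * B = - C" if "A - B = C * D" "D \<noteq> 0" for A B C D :: complex
      proof -
        have "- 1 / D * A - - 1 / D * B = - ((A - B) / D)" by (simp add: diff_divide_distrib)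
        then show ?thesis using that by simp
      qed
      ultimately show ?thesis using nz unfolding residue_hat_def by blast
    qed
    then have "g (c + 1) - g c = (\<Sum>k=1..10. - rt (int k * (2 * c + 1)))"
      unfolding g_def sum_subtractf[symmetric] by (intro sum.cong) auto
    also have "\<dots> = (if 11 dvd 2 * c + 1 then -10 else 1)"
      using sum_rt[of "2 * c + 1"] by (simp add: sum_negf)
    finally show ?thesis by (simp add: algebra_simps)
  qed
  have "g 0 = (\<Sum>k=1..10. residue_hat (int k))" by (simp add: g_def)
  also have "\<dots> = (\<Sum>k=1..10. residue_hat (11 - int k))" by (rule sum_reflect11)
  also have "\<dots> = - (\<Sum>k=1..10. residue_hat (int k))" unfolding residue_hat_reflect by (simp add: sum_negf)
  also have "(\<Sum>k=1..10. residue_hat (int k)) = g 0" by (simp add: g_def)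
  finally have g0: "g 0 = 0" by simp
  have g: "g 1 = 1" "g 2 = 2" "g 3 = 3" "g 4 = 4" "g 5 = 5" "g 6 = -5" "g 7 = -4" "g 8 = -3" "g 9 = -2" "g 10 = -1"
    using g0 step[of 0] step[of 1] step[of 2] step[of 3] step[of 4] step[of 5] step[of 6] step[of 7] step[of 8] step[of 9]
    by simp_all
  have "g c = g (c mod 11)"
    unfolding g_def by (intro sum.cong refl arg_cong2[of _ _ _ _ "(*)"] rt_cong) (simp add: mod_mult_right_eq)
  also have "\<dots> = of_int (residue (c mod 11))"
    by (rule mod11_cases[of c]) (simp_all add: g g0 residue_def)
  also have "residue (c mod 11) = residue c" by (simp add: residue_def mod_add_left_eq)
  finally show ?thesis by (simp add: g_def)
qed

definition gauss :: complex where
  "gauss = (\<Sum>k=1..10. of_int (chi11 (int k)) * rt (int k))"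

lemma gauss_sum: "(\<Sum>k=1..10. of_int (chi11 (int k)) * rt (int k * m)) = of_int (chi11 m) * gauss"
proof -
  have e: "(\<Sum>k=1..10. F k) = F 1 + F 2 + F 3 + F 4 + F 5 + F 6 + F 7 + F 8 + F 9 + F (10::nat)" for F :: "nat \<Rightarrow> complex"
    by (simp add: eval_nat_numeral)
  have c: "rt (int k * m) = rt ((int k * (m mod 11)) mod 11)" for k
    by (rule rt_cong) (simp add: mod_mult_right_eq)
  show ?thesis
    unfolding e gauss_def chi11_mod[of m, symmetric] c
    by (rule mod11_cases[of m]) (simp_all add: chi11_def)
qed

definition sine_product :: "int \<Rightarrow> complex" where
  "sine_product k = (\<Prod>j\<in>{1, 2, 3, 4, 5}. rt (j * k) - 1 / rt (j * k))"

text \<open>This is Gauss's lemma: multiplication by k permutes 1, ..., 5 up to signs modulo 11, and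
  the product of the signs is the Legendre symbol.\<close>

lemma sine_product_chi: "sine_product k = of_int (chi11 k) * sine_product 1" if "\<not> 11 dvd k"
proof -
  define s where "s = (\<lambda>j. rt j - 1 / rt j)"
  have sm: "s (- j) = - s j" for j by (simp add: s_def rt_minus)
  have sc: "s j = s (j mod 11)" for j by (simp add: s_def rt_mod)
  have r: "s 10 = - s 1" "s 9 = - s 2" "s 8 = - s 3" "s 7 = - s 4" "s 6 = - s 5"
    using sm[of 1] sm[of 2] sm[of 3] sm[of 4] sm[of 5] sc[of "-1"] sc[of "-2"] sc[of "-3"] sc[of "-4"] sc[of "-5"]
    by simp_all
  have c: "s (j * k) = s ((j * (k mod 11)) mod 11)" for j
    by (subst sc) (simp add: mod_mult_right_eq)
  have "k mod 11 \<noteq> 0" using that by (simp add: mod_eq_0_iff_dvd)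
  then have "s (1 * k) * s (2 * k) * s (3 * k) * s (4 * k) * s (5 * k)
      = of_int (chi11 (k mod 11)) * (s 1 * s 2 * s 3 * s 4 * s 5)"
    unfolding c by - (rule mod11_cases[of k], simp_all add: r chi11_def mult_ac)
  then show ?thesis unfolding sine_product_def s_def by (simp add: mult_ac)
qed

lemma sine_product_nonzero: "\<not> 11 dvd k \<Longrightarrow> sine_product k \<noteq> 0"
proof -
  assume k: "\<not> 11 dvd k"
  have "rt (j * k) - 1 / rt (j * k) \<noteq> 0" if "j \<in> {1, 2, 3, 4, 5}" for j
  proof -
    have "\<not> 11 dvd j * k" using k that by auto presburger+
    then show ?thesis by (rule rt_minus_inverse_nonzero)
  qed
  then show ?thesis unfolding sine_product_def by (subst prod_zero_iff) (simp, blast)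
qed

text \<open>The logarithmic derivative in the q-binomial theorem at a = 0, stated for x D so that x
  = 0 is covered.\<close>

lemma qpoch_deriv:
  assumes q: "norm q < 1" and x: "norm x < 1"
  shows "\<exists>D. (qpoch q has_field_derivative D) (at x) \<and> x * D = - lambert q x * qpoch q x"
proof -
  have z: "qpoch q 0 = 1" by (simp add: qpoch_def)
  have e: "qpoch q t = 1 / qbin_series q 0 t" if "norm t < 1" for t
    using qbin_series_eq[OF q that, of 0] by (simp add: z)
  have nz: "qbin_series q 0 x \<noteq> 0" by (rule qbin_series_nonzero[OF q x]) simp
  have "((\<lambda>t. 1 / qbin_series q 0 t) has_field_derivative - qbin_series' q 0 x / (qbin_series q 0 x * qbin_series q 0 x)) (at x)"
    using nz by (auto intro!: derivative_eq_intros qbin_series_deriv[OF q x] simp: field_simps)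
  then have "(qpoch q has_field_derivative - qbin_series' q 0 x / (qbin_series q 0 x * qbin_series q 0 x)) (at x)"
    by (rule has_field_derivative_transform_within_open[of _ _ _ "ball 0 1"]) (use x e in auto)
  moreover have "x * (- qbin_series' q 0 x / (qbin_series q 0 x * qbin_series q 0 x)) = - lambert q x * qpoch q x"
  proof -
    have "x * qbin_series' q 0 x = qbin_series q 0 x * lambert q x" using qbin_series_logderiv[OF q x, of 0] lambert_0[OF q] by simp
    then have "x * (- qbin_series' q 0 x / (qbin_series q 0 x * qbin_series q 0 x)) = - (qbin_series q 0 x * lambert q x) / (qbin_series q 0 x * qbin_series q 0 x)"
      by simp
    then show ?thesis using nz by (simp add: e[OF x])
  qed
  ultimately show ?thesis by blast
qed

context nome
begin

text \<open>Logarithmic differentiation of the triple product. For |u| = 1 both q u^2 and q / u^2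
  lie in the unit disc, and the Lambert series are those of the crank generating function at z = u^2
  and its inverse.\<close>

lemma th_logderiv:
  assumes u: "norm u = 1" "u\<^sup>2 \<noteq> 1"
  shows "dth u / th q u = (u\<^sup>2 + 1) / (u\<^sup>2 - 1) + 2 * (lambert q (q / u\<^sup>2) - lambert q (q * u\<^sup>2))"
proof -
  have u0: "u \<noteq> 0" using u by auto
  have n: "norm (q * u\<^sup>2) < 1" "norm (q / u\<^sup>2) < 1"
    using q u by (simp_all add: norm_mult norm_divide norm_power)
  obtain D1 where D1: "(qpoch q has_field_derivative D1) (at (q * u\<^sup>2))"
      "q * u\<^sup>2 * D1 = - lambert q (q * u\<^sup>2) * qpoch q (q * u\<^sup>2)"
    using qpoch_deriv[OF q n(1)] by blast
  obtain D2 where D2: "(qpoch q has_field_derivative D2) (at (q / u\<^sup>2))"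
      "q / u\<^sup>2 * D2 = - lambert q (q / u\<^sup>2) * qpoch q (q / u\<^sup>2)"
    using qpoch_deriv[OF q n(2)] by blast
  define E P1 P2 where "E = qpoch q q" and "P1 = qpoch q (q * u\<^sup>2)" and "P2 = qpoch q (q / u\<^sup>2)"
  have d0: "((\<lambda>v. (v - 1 / v) * E) has_field_derivative (1 + 1 / u\<^sup>2) * E) (at u)"
    using u0 by (auto intro!: derivative_eq_intros simp: power2_eq_square divide_inverse)
  have d1: "((\<lambda>v. qpoch q (q * v\<^sup>2)) has_field_derivative D1 * (q * (2 * u))) (at u)"
    by (rule DERIV_chain2[of "qpoch q" D1 "\<lambda>v. q * v\<^sup>2" u]) (use D1 in \<open>auto intro!: derivative_eq_intros\<close>)
  have d2: "((\<lambda>v. qpoch q (q / v\<^sup>2)) has_field_derivative D2 * (- 2 * q / u ^ 3)) (at u)"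
    by (rule DERIV_chain2[of "qpoch q" D2 "\<lambda>v. q / v\<^sup>2" u])
       (use u0 D2 in \<open>auto intro!: derivative_eq_intros simp: field_simps power2_eq_square power3_eq_cube\<close>)
  have "((\<lambda>v. (v - 1 / v) * E * qpoch q (q * v\<^sup>2) * qpoch q (q / v\<^sup>2)) has_field_derivative
     ((1 + 1 / u\<^sup>2) * E * P1 + D1 * (q * (2 * u)) * ((u - 1 / u) * E)) * P2
       + D2 * (- 2 * q / u ^ 3) * ((u - 1 / u) * E * P1)) (at u)"
    unfolding P1_def P2_def by (intro DERIV_mult d0 d1 d2)
  then have "(th q has_field_derivative
     ((1 + 1 / u\<^sup>2) * E * P1 + D1 * (q * (2 * u)) * ((u - 1 / u) * E)) * P2
       + D2 * (- 2 * q / u ^ 3) * ((u - 1 / u) * E * P1)) (at u)"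
    by (rule has_field_derivative_transform_within_open[of _ _ _ "- {0}"])
       (use u0 triple_product[OF q q0] in \<open>auto simp: E_def mult_ac\<close>)
  then have "dth u / u = ((1 + 1 / u\<^sup>2) * E * P1 + D1 * (q * (2 * u)) * ((u - 1 / u) * E)) * P2
       + D2 * (- 2 * q / u ^ 3) * ((u - 1 / u) * E * P1)"
    using th_deriv[OF u0] DERIV_unique by blast
  then have "u * (dth u / u) = u * (((1 + 1 / u\<^sup>2) * E * P1 + D1 * (q * (2 * u)) * ((u - 1 / u) * E)) * P2
       + D2 * (- 2 * q / u ^ 3) * ((u - 1 / u) * E * P1))" by (simp only:)
  also have "\<dots> = (u + 1 / u) * E * P1 * P2 + 2 * (q * u\<^sup>2 * D1) * ((u - 1 / u) * E * P2)
       - 2 * (q / u\<^sup>2 * D2) * ((u - 1 / u) * E * P1)"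
    using u0 by (simp add: field_simps power2_eq_square power3_eq_cube)
  also have "\<dots> = ((u + 1 / u) + 2 * (lambert q (q / u\<^sup>2) - lambert q (q * u\<^sup>2)) * (u - 1 / u)) * (E * P1 * P2)"
    unfolding D1(2) D2(2) P1_def[symmetric] P2_def[symmetric] by (simp add: algebra_simps)
  finally have d: "dth u = ((u + 1 / u) + 2 * (lambert q (q / u\<^sup>2) - lambert q (q * u\<^sup>2)) * (u - 1 / u)) * (E * P1 * P2)"
    using u0 by simp
  have t: "th q u = (u - 1 / u) * (E * P1 * P2)"
    unfolding triple_product[OF q q0 u0] E_def P1_def P2_def by simp
  have nz: "u - 1 / u \<noteq> 0" "E * P1 * P2 \<noteq> 0"
    using th_unit_nonzero[OF u] t by auto
  have "dth u / th q u = (u + 1 / u) / (u - 1 / u) + 2 * (lambert q (q / u\<^sup>2) - lambert q (q * u\<^sup>2))"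
  proof -
    have "((x + l * y) * e) / (y * e) = x / y + l" if "y \<noteq> 0" "e \<noteq> 0" for x y l e :: complex
      using that by (simp add: field_simps)
    from this[OF nz] show ?thesis unfolding d t .
  qed
  moreover have "(u + 1 / u) / (u - 1 / u) = (u * (u + 1 / u)) / (u * (u - 1 / u))"
    using u0 by simp
  moreover have "u * (u + 1 / u) = u\<^sup>2 + 1" "u * (u - 1 / u) = u\<^sup>2 - 1"
    using u0 by (simp_all add: algebra_simps power2_eq_square)
  ultimately show ?thesis by simp
qed

definition t :: "int \<Rightarrow> complex" where "t k = th q (rt k)"
text \<open>Half the logarithmic Euler derivative of theta; it is odd and 11-periodic, so for a
  given k only the five values Z(k), ..., Z(5 k) occur.\<close>

definition Z :: "int \<Rightarrow> complex" where "Z k = dth (rt k) / (2 * t k)"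

lemma t_minus: "t (- k) = - t k"
  unfolding t_def rt_minus by (rule th_inverse) simp

lemma Z_minus: "Z (- k) = - Z k"
  using dth_inverse[of "rt k"] t_minus[of k] by (simp add: Z_def rt_minus)

lemma t_cong: "a mod 11 = b mod 11 \<Longrightarrow> t a = t b"
  unfolding t_def using rt_cong by metis

lemma Z_cong: "a mod 11 = b mod 11 \<Longrightarrow> Z a = Z b"
  unfolding Z_def using rt_cong t_cong by metis

lemma t_neg_cong: "(a + b) mod 11 = 0 \<Longrightarrow> t a = - t b"
  using t_cong[of a "- b"] t_minus[of b] by (metis add_diff_cancel_right' diff_0 mod_diff_left_eq)

lemma Z_neg_cong: "(a + b) mod 11 = 0 \<Longrightarrow> Z a = - Z b"
  using Z_cong[of a "- b"] Z_minus[of b] by (metis add_diff_cancel_right' diff_0 mod_diff_left_eq)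

lemma t_nonzero: "\<not> 11 dvd k \<Longrightarrow> t k \<noteq> 0"
  unfolding t_def by (intro th_unit_nonzero rt_square_neq_1) auto

abbreviation "E \<equiv> qpoch q q"

text \<open>The addition formula at 5 k, -3 k and 2 k, whose sum is 4 k. Modulo 11 one has 7 k = -4
  k, so two factors cancel on the right and three theta values remain.\<close>

lemma Z_relation:
  assumes k: "\<not> 11 dvd k"
  shows "Z (2 * k) + Z (5 * k) - Z (3 * k) - Z (4 * k) = - (E ^ 3) * t k / (t (3 * k) * t (5 * k))"
proof -
  have nd: "\<not> 11 dvd 2 * k" "\<not> 11 dvd 3 * k" "\<not> 11 dvd 4 * k" "\<not> 11 dvd 5 * k" "\<not> 11 dvd 8 * k" "\<not> 11 dvd - (3 * k)"
    using k by (simp_all add: prime_dvd_mult_iff)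
  have r: "rt (2 * k) * rt (5 * k) = rt (7 * k)" "rt (5 * k) * rt (- (3 * k)) = rt (2 * k)"
    "rt (2 * k) * rt (- (3 * k)) = rt (- k)" "rt (2 * k) * rt (5 * k) * rt (- (3 * k)) = rt (4 * k)"
    "rt (5 * k) / rt (- (3 * k)) = rt (8 * k)" "rt (7 * k) * rt (- (3 * k)) = rt (4 * k)"
    unfolding rt_add[symmetric] rt_diff[symmetric] by (simp_all add: algebra_simps)
  have dZ: "dth (rt m) / t m = 2 * Z m" for m by (simp add: Z_def)
  have "2 * (Z (2 * k) + Z (5 * k) + Z (- (3 * k)) - Z (4 * k)) =
      2 * E ^ 3 * (t (7 * k) * t (2 * k) * t (- k)) / (t (2 * k) * t (5 * k) * t (- (3 * k)) * t (4 * k))"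
    using theta_addition[of "rt (5 * k)" "rt (- (3 * k))" "rt (2 * k)", unfolded r, folded t_def, unfolded dZ]
      t_nonzero[OF nd(1)] t_nonzero[OF nd(3)] t_nonzero[OF nd(4)] t_nonzero[OF nd(5)] t_nonzero[OF nd(6)]
    by (simp add: algebra_simps)
  also have "t (7 * k) = - t (4 * k)" by (rule t_neg_cong) (simp add: mod_eq_dvd_iff)
  finally have "2 * (Z (2 * k) + Z (5 * k) - Z (3 * k) - Z (4 * k)) = 2 * (- (E ^ 3) * t k / (t (3 * k) * t (5 * k)))"
    unfolding Z_minus t_minus
    using t_nonzero[OF nd(1)] t_nonzero[OF nd(2)] t_nonzero[OF nd(3)] t_nonzero[OF nd(4)] by (simp add: field_simps)
  then show ?thesis by (rule iffD1[OF mult_left_cancel[of 2], rotated]) simp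
qed

text \<open>For j = 1, ..., 5 the factors \<open>P j\<close> and \<open>P (- j)\<close>, completed
  by \<open>P 0\<close>, run over all eleventh roots of unity and multiply to (q^11;q^11). One of
  the five factors E serves as \<open>P 0\<close>, hence the fourth power.\<close>

lemma t_product:
  assumes k: "\<not> 11 dvd k"
  shows "t k * t (2 * k) * t (3 * k) * t (4 * k) * t (5 * k) = sine_product k * E ^ 4 * qpoch (q ^ 11) (q ^ 11)"
proof -
  define P where "P = (\<lambda>j. qpoch q (q * rt (2 * j * k)))"
  have tj: "t (j * k) = (rt (j * k) - 1 / rt (j * k)) * E * P j * P (- j)" for j
  proof -
    have "(rt (j * k))\<^sup>2 = rt (2 * j * k)" by (simp add: power2_eq_square rt_double mult.assoc)
    moreover have "q / rt (2 * j * k) = q * rt (2 * (- j) * k)" by (simp add: rt_minus)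
    ultimately show ?thesis unfolding t_def P_def using triple_product[OF q q0, of "rt (j * k)"] by simp
  qed
  have Pc: "P j = P (j mod 11)" for j
    unfolding P_def by (intro arg_cong[of _ _ "\<lambda>z. qpoch q (q * z)"] rt_cong) (metis mod_mult_left_eq mod_mult_right_eq)
  have "(\<Prod>j<11. qpoch q (rt (2 * k) ^ j * q)) = qpoch (q ^ 11) (q ^ 11)"
  proof (rule qpoch_prod_roots[OF q])
    fix y
    show "(\<Prod>j<11. 1 - rt (2 * k) ^ j * y) = 1 - y ^ 11"
    proof (rule prod_roots_of_unity)
      show "rt (2 * k) ^ 11 = 1"
        using rt_mult[of 11 "2 * k"] rt_mult[of "2 * k" 11] by (simp add: mult.commute)
      show "inj_on (\<lambda>j. rt (2 * k) ^ j) {..<11}"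
      proof (rule inj_onI)
        fix i j :: nat assume ij: "i \<in> {..<11}" "j \<in> {..<11}" "rt (2 * k) ^ i = rt (2 * k) ^ j"
        have "rt (2 * k * (int i - int j)) = 1"
          using ij(3) by (simp add: rt_mult power_int_diff)
        then have "11 dvd 2 * k * (int i - int j)" by (simp add: rt_eq_1_iff)
        moreover have "prime (11 :: int)" by simp
        ultimately have "11 dvd int i - int j" using k
          by (auto simp: prime_dvd_mult_iff zdvd_not_zless)
        then show "i = j" using ij by (auto dest: zdvd_imp_le) presburger
      qed
    qed simp
  qed simp
  moreover have "qpoch q (rt (2 * k) ^ j * q) = P (int j)" for j
    using rt_mult[of "2 * k" "int j"] by (simp add: P_def mult_ac)
  ultimately have "(\<Prod>j<11. P (int j)) = qpoch (q ^ 11) (q ^ 11)" by simp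
  moreover have "(\<Prod>j<11. P (int j)) = P 0 * P 1 * P 2 * P 3 * P 4 * P 5 * P 6 * P 7 * P 8 * P 9 * P 10"
    by (simp add: eval_nat_numeral lessThan_Suc mult_ac)
  ultimately have pr: "P 0 * P 1 * P 2 * P 3 * P 4 * P 5 * P 6 * P 7 * P 8 * P 9 * P 10 = qpoch (q ^ 11) (q ^ 11)"
    by (simp only:)
  have n: "P (- 1) = P 10" "P (- 2) = P 9" "P (- 3) = P 8" "P (- 4) = P 7" "P (- 5) = P 6"
    by (subst Pc, simp)+
  have P0: "P 0 = E" by (simp add: P_def)
  show ?thesis
    using tj[of 1] tj[of 2] tj[of 3] tj[of 4] tj[of 5] unfolding n pr[symmetric] P0 sine_product_def
    by (simp add: eval_nat_numeral mult_ac)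
qed

section \<open>Winquist's identity at roots of unity and the key identity\<close>

definition dal :: "complex \<Rightarrow> complex" where
  "dal a = 3 * bil (\<lambda>x. of_int x * th_coeff (q ^ 3) x) (a ^ 3)"

definition dbe :: "complex \<Rightarrow> complex" where
  "dbe = bil (\<lambda>x. of_int x * be_coeff q x)"

lemma be_deriv: "a \<noteq> 0 \<Longrightarrow> (be q has_field_derivative dbe a / a) (at a)"
  unfolding be_def dbe_def by (rule bil_deriv[OF rapid_be[OF q]])

lemma al_deriv: "a \<noteq> 0 \<Longrightarrow> (al has_field_derivative dal a / a) (at a)"
proof -
  assume a: "a \<noteq> 0"
  interpret n3: nome "p ^ 3" "q ^ 3" by (rule nome_power) simp
  have "((\<lambda>a. th (q ^ 3) (a ^ 3)) has_field_derivative (n3.dth (a ^ 3) / a ^ 3 * (3 * a\<^sup>2))) (at a)"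
    by (rule DERIV_chain2[of "th (q ^ 3)" _ "\<lambda>a. a ^ 3" a, OF n3.th_deriv]) (use a in \<open>auto intro!: derivative_eq_intros\<close>)
  moreover have "n3.dth (a ^ 3) / a ^ 3 * (3 * a\<^sup>2) = dal a / a"
    unfolding dal_def n3.dth_def using a by (simp add: field_simps power2_eq_square power3_eq_cube)
  ultimately show ?thesis by (simp add: al_def[abs_def])
qed

lemma al_rt_nonzero: "\<not> 11 dvd k \<Longrightarrow> al (rt k) \<noteq> 0"
proof -
  assume k: "\<not> 11 dvd k"
  interpret n3: nome "p ^ 3" "q ^ 3" by (rule nome_power) simp
  have "\<not> 11 dvd k * 3" using k by (simp add: prime_dvd_mult_iff)
  moreover have "rt k ^ 3 = rt (k * 3)" using rt_mult[of k 3] by simp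
  ultimately show ?thesis unfolding al_def
    using rt_square_neq_1[of "k * 3"] by (intro n3.th_unit_nonzero) auto
qed

text \<open>The second claim is the logarithmic derivative of the first in its first variable: the
  factors th(a), th(a b) and th(a / b) contribute one Z each, while th(b) is constant.\<close>

lemma winquist_derivative:
  assumes jk: "\<not> 11 dvd j" "\<not> 11 dvd k" "\<not> 11 dvd j + k" "\<not> 11 dvd j - k"
  defines "D \<equiv> al (rt j) * be q (rt k) - be q (rt j) * al (rt k)"
  shows "E\<^sup>2 * D = t j * t k * t (j + k) * t (j - k)"
    and "dal (rt j) * be q (rt k) - dbe (rt j) * al (rt k) = 2 * D * (Z j + Z (j + k) + Z (j - k))"
proof -
  define a b where "a = rt j" and "b = rt k"
  have ab0: "a \<noteq> 0" "b \<noteq> 0" "1 / b \<noteq> 0" by (simp_all add: a_def b_def)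
  have bb: "th q b \<noteq> 0" "th q (b * b) \<noteq> 0" "al b \<noteq> 0"
  proof -
    have "\<not> 11 dvd 2 * k" using jk by (simp add: prime_dvd_mult_iff)
    then show "th q b \<noteq> 0" "th q (b * b) \<noteq> 0" "al b \<noteq> 0"
      using t_nonzero[of k] t_nonzero[of "2 * k"] al_rt_nonzero[of k] jk by (simp_all add: b_def t_def rt_double)
  qed
  note W = winquist[OF ab0(2) bb]
  have r: "a * b = rt (j + k)" "a * (1 / b) = rt (j - k)" "a / b = rt (j - k)"
    by (simp_all add: a_def b_def rt_add rt_diff)
  show 1: "E\<^sup>2 * D = t j * t k * t (j + k) * t (j - k)"
    using W[OF ab0(1)] unfolding r unfolding D_def t_def a_def b_def .
  have "((\<lambda>v. E\<^sup>2 * (al v * be q b - be q v * al b)) has_field_derivative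
      E\<^sup>2 * (dal a / a * be q b - dbe a / a * al b)) (at a)"
    by (intro DERIV_cmult DERIV_diff DERIV_cmult_right al_deriv be_deriv ab0)
  moreover have "((\<lambda>v. th q v * (th q (v * b) * th q (v * (1 / b))) * th q b) has_field_derivative
     (dth a / a * (th q (a * b) * th q (a * (1 / b))) +
      (dth (a * b) / a * th q (a * (1 / b)) + dth (a * (1 / b)) / a * th q (a * b)) * th q a) * th q b) (at a)"
    by (intro DERIV_cmult_right DERIV_mult th_deriv th_mult_const_deriv ab0)
  then have "((\<lambda>v. E\<^sup>2 * (al v * be q b - be q v * al b)) has_field_derivative
     (dth a / a * (th q (a * b) * th q (a * (1 / b))) +
      (dth (a * b) / a * th q (a * (1 / b)) + dth (a * (1 / b)) / a * th q (a * b)) * th q a) * th q b) (at a)"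
    by (rule has_field_derivative_transform_within_open[of _ _ _ "- {0}"]) (use ab0 W in \<open>auto simp: mult_ac\<close>)
  ultimately have "E\<^sup>2 * (dal a / a * be q b - dbe a / a * al b) =
     (dth a / a * (th q (a * b) * th q (a * (1 / b))) +
      (dth (a * b) / a * th q (a * (1 / b)) + dth (a * (1 / b)) / a * th q (a * b)) * th q a) * th q b"
    using DERIV_unique by blast
  then have eqn: "a * (E\<^sup>2 * (dal a / a * be q b - dbe a / a * al b)) =
     a * ((dth a / a * (th q (a * b) * th q (a * (1 / b))) +
      (dth (a * b) / a * th q (a * (1 / b)) + dth (a * (1 / b)) / a * th q (a * b)) * th q a) * th q b)"
    by (simp only:)
  have "E\<^sup>2 * (dal a * be q b - dbe a * al b) =
     (dth a * (th q (a * b) * th q (a * (1 / b))) +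
      (dth (a * b) * th q (a * (1 / b)) + dth (a * (1 / b)) * th q (a * b)) * th q a) * th q b"
  proof -
    have 1: "a * (E\<^sup>2 * (X / a * B - Y / a * A)) = E\<^sup>2 * (X * B - Y * A)" for X Y A B
      using ab0(1) by (simp add: right_diff_distrib)
    have 2: "a * ((X / a * A + (Y / a * B + V / a * A') * B') * C) = (X * A + (Y * B + V * A') * B') * C"
      for X Y V A B A' B' C
      using ab0(1) by (simp add: distrib_left distrib_right)
    show ?thesis using eqn unfolding 1 2 .
  qed
  also have "\<dots> = 2 * (t j * t k * t (j + k) * t (j - k)) * (Z j + Z (j + k) + Z (j - k))"
    unfolding r unfolding a_def b_def t_def[symmetric] Z_def
    using t_nonzero[OF jk(1)] t_nonzero[OF jk(3)] t_nonzero[OF jk(4)] by (simp add: field_simps)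
  also have "\<dots> = E\<^sup>2 * (2 * D * (Z j + Z (j + k) + Z (j - k)))"
    unfolding 1[symmetric] by simp
  finally show "dal (rt j) * be q (rt k) - dbe (rt j) * al (rt k) = 2 * D * (Z j + Z (j + k) + Z (j - k))"
    using qpoch_nonzero'[OF q q] by (simp add: a_def b_def)
qed

text \<open>With \<open>(5 k, 2 k)\<close>, the arguments \<open>5 k, 2 k, 5 k \<plusminus> 2 k\<close> of Winquist's product are, up to sign and modulo \<open>11\<close>,
  all of \<open>2 k, \<dots>, 5 k\<close>: the product complementary to \<open>t k\<close>.\<close>

definition W0 :: "int \<Rightarrow> complex" where
  "W0 k = al (rt (5 * k)) * be q (rt (2 * k)) - be q (rt (5 * k)) * al (rt (2 * k))"

definition W1 :: "int \<Rightarrow> complex" where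
  "W1 k = dal (rt (5 * k)) * be q (rt (2 * k)) - dbe (rt (5 * k)) * al (rt (2 * k))"

definition W2 :: "int \<Rightarrow> complex" where
  "W2 k = al (rt (5 * k)) * dbe (rt (2 * k)) - be q (rt (5 * k)) * dal (rt (2 * k))"

definition T3 :: "int \<Rightarrow> complex" where
  "T3 k = 2 * (t k * t (2 * k) * t (4 * k)) + 2 * (t (3 * k) * t (3 * k) * t (5 * k)) + 3 * (t (5 * k) * t (5 * k) * t (2 * k))"

text \<open>Up to an elementary term the Lambert series is Z(k), and by V the prefactor is -W0(k).
  Since W1 and W2 are 2 W0 times the combinations multiplied by 4 and 3 in \<open>Zk\<close>, they
  appear with coefficients -2 and -3/2; each quotient supplied by \<open>Z_relation\<close> becomes
  E times three theta values.\<close>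

theorem key_identity:
  assumes k: "\<not> 11 dvd k"
  shows "sine_product k * qpoch (q ^ 11) (q ^ 11) * (E\<^sup>2 / t k * (lambert q (q / (rt k)\<^sup>2) - lambert q (q * (rt k)\<^sup>2))) =
    E * T3 k - 2 * W1 k - 3 / 2 * W2 k + ((rt k)\<^sup>2 + 1) / ((rt k)\<^sup>2 - 1) / 2 * W0 k"
proof -
  define s where "s = ((rt k)\<^sup>2 + 1) / ((rt k)\<^sup>2 - 1) / 2"
  define F where "F = sine_product k * qpoch (q ^ 11) (q ^ 11)"
  have nd: "\<not> 11 dvd 2 * k" "\<not> 11 dvd 3 * k" "\<not> 11 dvd 4 * k" "\<not> 11 dvd 5 * k" "\<not> 11 dvd 5 * k + 2 * k" "\<not> 11 dvd 5 * k - 2 * k"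
    "\<not> 11 dvd 2 * k + 5 * k" "\<not> 11 dvd 2 * k - 5 * k"
    using k by (simp_all add: prime_dvd_mult_iff)
  note tn = t_nonzero[OF k] t_nonzero[OF nd(1)] t_nonzero[OF nd(2)] t_nonzero[OF nd(3)] t_nonzero[OF nd(4)]
  have E0: "E \<noteq> 0" by (rule qpoch_nonzero'[OF q q])
  have D: "t k * t (2 * k) * t (3 * k) * t (4 * k) * t (5 * k) = F * E ^ 4"
    using t_product[OF k] by (simp add: F_def mult_ac)
  have tc: "t (5 * k + 2 * k) = - t (4 * k)" "t (5 * k - 2 * k) = t (3 * k)"
    "t (9 * k) = - t (2 * k)" "t (15 * k) = t (4 * k)" "t (25 * k) = t (3 * k)"
    by ((rule t_neg_cong | rule t_cong), simp add: mod_eq_dvd_iff; fail)+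
  have zc: "Z (5 * k + 2 * k) = - Z (4 * k)" "Z (5 * k - 2 * k) = Z (3 * k)"
    "Z (2 * k + 5 * k) = - Z (4 * k)" "Z (2 * k - 5 * k) = - Z (3 * k)"
    "Z (6 * k) = - Z (5 * k)" "Z (15 * k) = Z (4 * k)" "Z (9 * k) = - Z (2 * k)" "Z (12 * k) = Z k"
    "Z (10 * k) = - Z k" "Z (25 * k) = Z (3 * k)" "Z (20 * k) = - Z (2 * k)"
    by ((rule Z_neg_cong | rule Z_cong), simp add: mod_eq_dvd_iff; fail)+
  have W0: "E\<^sup>2 * W0 k = - (t (2 * k) * t (3 * k) * t (4 * k) * t (5 * k))"
    unfolding W0_def using winquist_derivative(1)[OF nd(4,1,5,6), unfolded tc] by (simp add: mult_ac)
  have W1: "W1 k = 2 * W0 k * (Z (5 * k) - Z (4 * k) + Z (3 * k))"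
    unfolding W0_def W1_def using winquist_derivative(2)[OF nd(4,1,5,6), unfolded zc] by simp
  have W2: "W2 k = 2 * W0 k * (Z (2 * k) - Z (4 * k) - Z (3 * k))"
  proof -
    have "- W2 k = 2 * (- W0 k) * (Z (2 * k) - Z (4 * k) - Z (3 * k))"
      unfolding W0_def W2_def using winquist_derivative(2)[OF nd(1,4,7,8), unfolded zc] by (simp add: algebra_simps)
    then show ?thesis by (simp add: algebra_simps)
  qed
  \<comment> \<open>The division by t(k) disappears here: by \<open>t_product\<close>, the
    complementary product of four theta values replaces it.\<close>
  have V: "F * (E\<^sup>2 / t k) = - W0 k"
  proof -
    have "E\<^sup>2 * (F * E\<^sup>2) = t k * (- (E\<^sup>2 * W0 k))"
      unfolding W0 using D by (simp add: eval_nat_numeral mult_ac)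
    then have "E\<^sup>2 * (F * E\<^sup>2) = E\<^sup>2 * (t k * - W0 k)" by (simp add: mult_ac)
    then have "F * E\<^sup>2 = t k * - W0 k"
      by (rule iffD1[OF mult_left_cancel, rotated]) (use E0 in simp)
    then show ?thesis using tn by (simp add: field_simps)
  qed
  have r1: "Z (2 * k) + Z (5 * k) - Z (3 * k) - Z (4 * k) = - (E ^ 3) * t k / (t (3 * k) * t (5 * k))"
    by (rule Z_relation[OF k])
  have r2: "- Z (5 * k) + Z (4 * k) + Z (2 * k) - Z k = E ^ 3 * t (3 * k) / (t (2 * k) * t (4 * k))"
    using Z_relation[OF nd(2)] by (simp add: tc zc)
  have r3: "- Z k + Z (3 * k) + Z (2 * k) - Z (4 * k) = - (E ^ 3) * t (5 * k) / (t (4 * k) * t (3 * k))"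
  proof -
    have "Z (3 * k) - Z k - Z (4 * k) + Z (2 * k) = - (E ^ 3) * t (5 * k) / (t (4 * k) * t (3 * k))"
      using Z_relation[OF nd(4)] by (simp add: tc zc)
    then show ?thesis by (simp only: diff_conv_add_uminus add_ac)
  qed
  \<comment> \<open>The coefficients -2, 2, -3 of the addition relations at k, 3 k, 5 k and 4, 3 of
    the two Winquist combinations are chosen so that Z(2 k), ..., Z(5 k) cancel.\<close>
  have Zk: "Z k = 2 * (E ^ 3 * t k / (t (3 * k) * t (5 * k))) + 2 * (E ^ 3 * t (3 * k) / (t (2 * k) * t (4 * k)))
      + 3 * (E ^ 3 * t (5 * k) / (t (4 * k) * t (3 * k)))
      + 4 * (Z (5 * k) - Z (4 * k) + Z (3 * k)) + 3 * (Z (2 * k) - Z (4 * k) - Z (3 * k))"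
  proof -
    have "Z k = - 2 * (Z (2 * k) + Z (5 * k) - Z (3 * k) - Z (4 * k)) + 2 * (- Z (5 * k) + Z (4 * k) + Z (2 * k) - Z k)
       - 3 * (- Z k + Z (3 * k) + Z (2 * k) - Z (4 * k))
       + 4 * (Z (5 * k) - Z (4 * k) + Z (3 * k)) + 3 * (Z (2 * k) - Z (4 * k) - Z (3 * k))"
      by (simp add: algebra_simps)
    then show ?thesis unfolding r1 r2 r3 by simp
  qed
  have l: "lambert q (q / (rt k)\<^sup>2) - lambert q (q * (rt k)\<^sup>2) = Z k - s"
  proof -
    have "Z k = dth (rt k) / th q (rt k) / 2" by (simp add: Z_def t_def)
    also have "\<dots> = s + (lambert q (q / (rt k)\<^sup>2) - lambert q (q * (rt k)\<^sup>2))"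
      unfolding th_logderiv[OF norm_rt rt_square_neq_1[OF k]] s_def add_divide_distrib by simp
    finally show ?thesis by simp
  qed
  have x1: "F * (E\<^sup>2 / t k) * (E ^ 3 * t k / (t (3 * k) * t (5 * k))) = E * (t k * t (2 * k) * t (4 * k))"
  proof -
    have "F * (E\<^sup>2 / t k) * (E ^ 3 * t k / (t (3 * k) * t (5 * k))) = E * (F * E ^ 4) / (t (3 * k) * t (5 * k))"
      using tn by (simp add: field_simps eval_nat_numeral)
    then show ?thesis unfolding D[symmetric] using tn by (simp add: field_simps)
  qed
  have x2: "F * (E\<^sup>2 / t k) * (E ^ 3 * t (3 * k) / (t (2 * k) * t (4 * k))) = E * (t (3 * k) * t (3 * k) * t (5 * k))"
  proof -
    have "F * (E\<^sup>2 / t k) * (E ^ 3 * t (3 * k) / (t (2 * k) * t (4 * k))) = E * (F * E ^ 4) * t (3 * k) / (t k * t (2 * k) * t (4 * k))"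
      using tn by (simp add: field_simps eval_nat_numeral)
    then show ?thesis unfolding D[symmetric] using tn by (simp add: field_simps)
  qed
  have x3: "F * (E\<^sup>2 / t k) * (E ^ 3 * t (5 * k) / (t (4 * k) * t (3 * k))) = E * (t (5 * k) * t (5 * k) * t (2 * k))"
  proof -
    have "F * (E\<^sup>2 / t k) * (E ^ 3 * t (5 * k) / (t (4 * k) * t (3 * k))) = E * (F * E ^ 4) * t (5 * k) / (t k * t (4 * k) * t (3 * k))"
      using tn by (simp add: field_simps eval_nat_numeral)
    then show ?thesis unfolding D[symmetric] using tn by (simp add: field_simps)
  qed
  define V where "V = F * (E\<^sup>2 / t k)"
  have "F * (E\<^sup>2 / t k * (lambert q (q / (rt k)\<^sup>2) - lambert q (q * (rt k)\<^sup>2))) = V * (Z k - s)"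
    unfolding l V_def by simp
  also have "\<dots> = 2 * (V * (E ^ 3 * t k / (t (3 * k) * t (5 * k)))) + 2 * (V * (E ^ 3 * t (3 * k) / (t (2 * k) * t (4 * k))))
      + 3 * (V * (E ^ 3 * t (5 * k) / (t (4 * k) * t (3 * k))))
      + V * (4 * (Z (5 * k) - Z (4 * k) + Z (3 * k)) + 3 * (Z (2 * k) - Z (4 * k) - Z (3 * k)) - s)"
  proof -
    have "V * ((2 * a + 2 * b + 3 * c + d + e) - s) = 2 * (V * a) + 2 * (V * b) + 3 * (V * c) + V * (d + e - s)"
      for a b c d e by (simp add: algebra_simps)
    then show ?thesis by (subst Zk)
  qed
  also have "V * (4 * (Z (5 * k) - Z (4 * k) + Z (3 * k)) + 3 * (Z (2 * k) - Z (4 * k) - Z (3 * k)) - s) =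
      - 2 * W1 k - 3 / 2 * W2 k + s * W0 k"
    unfolding V_def V W1 W2 by (simp add: algebra_simps)
  finally show ?thesis
    unfolding V_def x1 x2 x3 T3_def F_def[symmetric] s_def[symmetric] by (simp add: algebra_simps)
qed

end

subsection \<open>Exponents congruent to 6 modulo 11\<close>

lemma has_sum_finite_sum:
  fixes f :: "'i \<Rightarrow> 'a \<Rightarrow> complex"
  assumes "finite I" "\<And>i. i \<in> I \<Longrightarrow> (f i has_sum S i) A"
  shows "((\<lambda>x. \<Sum>i\<in>I. f i x) has_sum (\<Sum>i\<in>I. S i)) A"
  using assms by (induction I rule: finite_induct) (auto intro!: has_sum_add)

text \<open>The theta identities need a nonzero nome, so the two sums are compared on the punctured
  disc only; continuity supplies q = 0, and a nonzero power series has isolated zeros.\<close>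

lemma power_series_unique:
  fixes a b :: "nat \<Rightarrow> complex"
  assumes a: "\<And>q. 0 < norm q \<Longrightarrow> norm q < 1 \<Longrightarrow> ((\<lambda>n. a n * q ^ n) has_sum f q) UNIV"
    and b: "\<And>q. 0 < norm q \<Longrightarrow> norm q < 1 \<Longrightarrow> ((\<lambda>n. b n * q ^ n) has_sum f q) UNIV"
  shows "a n = b n"
proof -
  define d where "d = (\<lambda>n. a n - b n)"
  have s: "(\<lambda>n. d n * q ^ n) sums 0" if "0 < norm q" "norm q < 1" for q
    using sums_diff[OF has_sum_imp_sums[OF a[OF that]] has_sum_imp_sums[OF b[OF that]]]
    by (simp add: d_def left_diff_distrib)
  define h where "h = (\<lambda>q. \<Sum>n. d n * q ^ n)"
  have h0: "h q = 0" if "0 < norm q" "norm q < 1" for q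
    using s[OF that] by (simp add: h_def sums_iff)
  have sm: "summable (\<lambda>n. d n * q ^ n)" if "norm q < 1" for q
    using s[of q] that by (cases "q = 0") (auto simp: summable_def)
  have "isCont h 0"
    unfolding h_def by (rule isCont_powser[OF sm[of "1/2"]]) auto
  then have "(h \<longlongrightarrow> h 0) (at 0)" by (simp add: isCont_def)
  moreover have "eventually (\<lambda>q. h q = 0) (at 0)"
    unfolding eventually_at by (intro exI[of _ 1]) (auto intro: h0)
  then have "(h \<longlongrightarrow> 0) (at 0)" by (rule tendsto_eventually)
  ultimately have hz: "h 0 = 0" using tendsto_unique[OF at_neq_bot] by blast
  then have d0: "d 0 = 0" by (simp add: h_def)
  show ?thesis
  proof (rule ccontr)
    assume "a n \<noteq> b n"
    then have dn: "d n \<noteq> 0" by (simp add: d_def)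
    then have "n > 0" using d0 by (cases n) auto
    have "(\<lambda>n. d n * (x - 0) ^ n) sums h x" if "norm (x - 0) < 1" for x
      using sm[of x] that by (simp add: h_def summable_sums)
    then obtain r where r: "0 < r" "\<And>x. x \<in> cball 0 r - {0} \<Longrightarrow> h x \<noteq> 0"
      using powser_0_nonzero[of 1 0 d h n] hz dn \<open>n > 0\<close> by (metis zero_less_one)
    define x where "x = complex_of_real (min r (1/2))"
    have "norm x = min r (1/2)" using r(1) by (simp add: x_def)
    then have "x \<in> cball 0 r - {0}" "0 < norm x" "norm x < 1" using r(1) by auto
    then show False using r(2) h0 by blast
  qed
qed

text \<open>Asking only for some coefficient sequence makes closure under linear combinations
  immediate; \<open>power_series_unique\<close> later identifies the sequence with the actual
  coefficients.\<close>

definition sixth_free :: "(complex \<Rightarrow> complex) \<Rightarrow> bool" where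
  "sixth_free f \<longleftrightarrow> (\<exists>a. (\<forall>n. a (11 * n + 6) = 0) \<and>
     (\<forall>q. 0 < norm q \<longrightarrow> norm q < 1 \<longrightarrow> ((\<lambda>n. a n * q ^ n) has_sum f q) UNIV))"

lemma sixth_free_add:
  assumes "sixth_free f" "sixth_free g"
  shows "sixth_free (\<lambda>q. f q + g q)"
proof -
  obtain a b where a: "\<forall>n. a (11 * n + 6) = 0" "\<forall>q. 0 < norm q \<longrightarrow> norm q < 1 \<longrightarrow> ((\<lambda>n. a n * q ^ n) has_sum f q) UNIV"
    and b: "\<forall>n. b (11 * n + 6) = 0" "\<forall>q. 0 < norm q \<longrightarrow> norm q < 1 \<longrightarrow> ((\<lambda>n. b n * q ^ n) has_sum g q) UNIV"
    using assms unfolding sixth_free_def by blast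
  have "((\<lambda>n. (a n + b n) * q ^ n) has_sum (f q + g q)) UNIV" if "0 < norm q" "norm q < 1" for q
    using has_sum_add[OF a(2)[rule_format, OF that] b(2)[rule_format, OF that]] by (simp add: distrib_right)
  then show ?thesis unfolding sixth_free_def using a(1) b(1) by (intro exI[of _ "\<lambda>n. a n + b n"]) auto
qed

lemma sixth_free_cmult:
  assumes "sixth_free f"
  shows "sixth_free (\<lambda>q. c * f q)"
proof -
  obtain a where a: "\<forall>n. a (11 * n + 6) = 0" "\<forall>q. 0 < norm q \<longrightarrow> norm q < 1 \<longrightarrow> ((\<lambda>n. a n * q ^ n) has_sum f q) UNIV"
    using assms unfolding sixth_free_def by blast
  have "((\<lambda>n. (c * a n) * q ^ n) has_sum (c * f q)) UNIV" if "0 < norm q" "norm q < 1" for q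
    using has_sum_cmult_right[OF a(2)[rule_format, OF that], of c] by (simp add: mult.assoc)
  then show ?thesis unfolding sixth_free_def using a(1) by (intro exI[of _ "\<lambda>n. c * a n"]) auto
qed

lemma sixth_free_sum:
  assumes "finite I" "\<And>i. i \<in> I \<Longrightarrow> sixth_free (f i)"
  shows "sixth_free (\<lambda>q. \<Sum>i\<in>I. f i q)"
  using assms
proof (induction I rule: finite_induct)
  case empty
  have "((\<lambda>n. 0 * q ^ n) has_sum 0) UNIV" for q :: complex by simp
  then show ?case unfolding sixth_free_def by (intro exI[of _ "\<lambda>_. 0"]) auto
qed (auto intro!: sixth_free_add)

lemma sixth_free_cong:
  assumes "sixth_free f" "\<And>q. 0 < norm q \<Longrightarrow> norm q < 1 \<Longrightarrow> f q = g q"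
  shows "sixth_free g"
  using assms unfolding sixth_free_def by metis

lemma sixth_free_by_degree:
  assumes s: "\<And>q. 0 < norm q \<Longrightarrow> norm q < 1 \<Longrightarrow> ((\<lambda>v. c v * q ^ e v) has_sum f q) A"
    and fin: "\<And>n. finite {v \<in> A. e v = n}"
    and z: "\<And>n. (\<Sum>v | v \<in> A \<and> e v = 11 * n + 6. c v) = 0"
  shows "sixth_free f"
  unfolding sixth_free_def
  by (rule exI[of _ "\<lambda>n. \<Sum>v | v \<in> A \<and> e v = n. c v"]) (use z has_sum_by_degree[OF s fin] in auto)

lemma finite_bounded_square: "finite {x :: int. x\<^sup>2 \<le> B}"
proof (rule finite_subset)
  show "{x :: int. x\<^sup>2 \<le> B} \<subseteq> {- B..B}"
  proof
    fix x :: int assume "x \<in> {x. x\<^sup>2 \<le> B}"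
    then have x: "x\<^sup>2 \<le> B" by simp
    have "\<bar>x\<bar> \<le> x\<^sup>2"
    proof (cases "x = 0")
      case False
      then have "\<bar>x\<bar> * 1 \<le> \<bar>x\<bar> * \<bar>x\<bar>" by (intro mult_left_mono) auto
      then show ?thesis by (simp add: power2_eq_square)
    qed simp
    then show "x \<in> {- B..B}" using x by auto
  qed
qed simp

text \<open>The degree-two forms produced by Winquist's identity: as \<open>-1\<close> is not a square modulo \<open>11\<close>, exponents
  \<open>\<equiv> 6\<close> force both variables to vanish modulo \<open>11\<close>, where the summand is odd in one of them.\<close>

lemma sixth_free_binary:
  fixes c d :: "int \<Rightarrow> complex"
  assumes f: "\<And>q. 0 < norm q \<Longrightarrow> norm q < 1 \<Longrightarrow> ((\<lambda>x. c x * th_coeff (q ^ 3) x) has_sum f q) UNIV"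
    and g: "\<And>q. 0 < norm q \<Longrightarrow> norm q < 1 \<Longrightarrow> ((\<lambda>y. d y * be_coeff q y) has_sum g q) UNIV"
    and sym: "(\<forall>x. 11 dvd x \<longrightarrow> c (- x) = c x) \<or> (\<forall>y. 11 dvd y \<longrightarrow> d (- y) = d y)"
  shows "sixth_free (\<lambda>q. f q * g q)"
proof -
  define X where "X = {x :: int. odd x}"
  define Y where "Y = {y :: int. odd y \<and> \<not> 3 dvd y}"
  define C where "C = (\<lambda>(x, y). c x * of_int (chi4 x) * (d y * of_int (chi4 y)))"
  define e where "e = (\<lambda>(x, y). 3 * nat ((x\<^sup>2 - 1) div 8) + nat (((y :: int)\<^sup>2 - 1) div 24))"
  \<comment> \<open>Modulo 11 the right side is 2 e + 10, which vanishes exactly for e congruent to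
    6.\<close>
  have e: "9 * x\<^sup>2 + y\<^sup>2 = 24 * int (e (x, y)) + 10" if "x \<in> X" "y \<in> Y" for x y
  proof -
    have o: "odd x" "odd y" "\<not> 3 dvd y" using that by (auto simp: X_def Y_def)
    obtain m where m: "x\<^sup>2 - 1 = 8 * m" "(x\<^sup>2 - 1) div 8 = m" "m \<ge> 0" using odd_square_mod8[OF o(1)] by metis
    obtain m' where m': "y\<^sup>2 - 1 = 24 * m'" "(y\<^sup>2 - 1) div 24 = m'" "m' \<ge> 0" using odd_mod6_coprime3[OF o(2,3)] by metis
    show ?thesis using m m' by (simp add: e_def)
  qed
  show ?thesis
  proof (rule sixth_free_by_degree[where A = "X \<times> Y" and c = C and e = e])
    fix q :: complex assume q: "0 < norm q" "norm q < 1"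
    have "((\<lambda>x. c x * th_coeff (q ^ 3) x) has_sum f q) X"
      using f[OF q] by (rule iffD1[OF has_sum_cong_neutral, rotated -1]) (auto simp: X_def th_coeff_def chi4_even)
    moreover have "((\<lambda>y. d y * be_coeff q y) has_sum g q) Y"
      using g[OF q] by (rule iffD1[OF has_sum_cong_neutral, rotated -1]) (auto simp: Y_def be_coeff_def chi4_even)
    ultimately have "((\<lambda>(x, y). c x * th_coeff (q ^ 3) x * (d y * be_coeff q y)) has_sum (f q * g q)) (X \<times> Y)"
      by (rule has_sum_mult_product)
    then show "((\<lambda>v. C v * q ^ e v) has_sum (f q * g q)) (X \<times> Y)"
      by (rule has_sum_cong[THEN iffD1, rotated])
         (auto simp: C_def e_def Y_def th_coeff_def be_coeff_def power_add power_mult)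
  next
    fix n
    have "{v \<in> X \<times> Y. e v = n} \<subseteq> {x. x\<^sup>2 \<le> 24 * int n + 10} \<times> {y. y\<^sup>2 \<le> 24 * int n + 10}"
    proof
      fix v assume "v \<in> {v \<in> X \<times> Y. e v = n}"
      then obtain x y where v: "v = (x, y)" "x \<in> X" "y \<in> Y" "e (x, y) = n" by auto
      have "a \<le> M \<and> b \<le> M" if "9 * a + b = M" "0 \<le> a" "0 \<le> b" for a b M :: int using that by auto
      from this[OF e[OF v(2,3)]] show "v \<in> {x. x\<^sup>2 \<le> 24 * int n + 10} \<times> {y. y\<^sup>2 \<le> 24 * int n + 10}"
        using v by simp
    qed
    then show "finite {v \<in> X \<times> Y. e v = n}"
      by (rule finite_subset) (intro finite_cartesian_product finite_bounded_square)
  next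
    fix n
    let ?V = "{v. v \<in> X \<times> Y \<and> e v = 11 * n + 6}"
    have dvd: "11 dvd x \<and> 11 dvd y" if "(x, y) \<in> ?V" for x y
    proof -
      have "9 * x\<^sup>2 + y\<^sup>2 = 24 * int (11 * n + 6) + 10" using e that by auto
      then have "9 * x\<^sup>2 + y\<^sup>2 = 11 * (24 * int n + 14)" by simp
      then have "(9 * x\<^sup>2 + y\<^sup>2) mod 11 = 0" by simp
      moreover have "(9 * x\<^sup>2 + y\<^sup>2) mod 11 = (9 * (x mod 11)\<^sup>2 + (y mod 11)\<^sup>2) mod 11"
        unfolding Cong.cong_def[symmetric] by (intro cong_add cong_mult cong_pow cong_refl) (simp_all add: Cong.cong_def)
      ultimately have "(9 * (x mod 11)\<^sup>2 + (y mod 11)\<^sup>2) mod 11 = 0" by simp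
      then have "x mod 11 = 0 \<and> y mod 11 = 0"
        by - (rule mod11_cases[of x]; rule mod11_cases[of y]; simp)
      then show ?thesis by (simp add: mod_eq_0_iff_dvd)
    qed
    from sym show "sum C ?V = 0"
    proof
      assume c: "\<forall>x. 11 dvd x \<longrightarrow> c (- x) = c x"
      have nv: "(- x, y) \<in> ?V \<and> C (- x, y) = - C (x, y)" if "(x, y) \<in> ?V" for x y
        using that c dvd[OF that] by (simp add: X_def e_def C_def chi4_neg)
      have "sum C ?V = (\<Sum>v\<in>?V. - C v)"
        by (rule sum.reindex_bij_witness[of _ "\<lambda>v. (- fst v, snd v)" "\<lambda>v. (- fst v, snd v)"])
           (use nv in \<open>simp_all add: prod_eq_iff split_paired_all del: mem_Collect_eq\<close>)
      then show ?thesis by (simp add: sum_negf)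
    next
      assume d: "\<forall>y. 11 dvd y \<longrightarrow> d (- y) = d y"
      have nv: "(x, - y) \<in> ?V \<and> C (x, - y) = - C (x, y)" if "(x, y) \<in> ?V" for x y
        using that d dvd[OF that] by (simp add: Y_def e_def C_def chi4_neg)
      have "sum C ?V = (\<Sum>v\<in>?V. - C v)"
        by (rule sum.reindex_bij_witness[of _ "\<lambda>v. (fst v, - snd v)" "\<lambda>v. (fst v, - snd v)"])
           (use nv in \<open>simp_all add: prod_eq_iff split_paired_all del: mem_Collect_eq\<close>)
      then show ?thesis by (simp add: sum_negf)
    qed
  qed
qed

lemma nome_csqrt: "0 < norm q \<Longrightarrow> norm q < 1 \<Longrightarrow> nome (csqrt q) q"
  by unfold_locales (auto simp: norm_csqrt)

lemma rt_powi: "rt k powi x = rt (k * x)"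
  by (simp add: rt_mult)

lemma winquist_series:
  assumes q: "0 < norm q" "norm q < 1"
  shows "((\<lambda>x. rt (3 * k * x) * th_coeff (q ^ 3) x) has_sum nome.al q (rt k)) UNIV"
    and "((\<lambda>x. 3 * of_int x * rt (3 * k * x) * th_coeff (q ^ 3) x) has_sum nome.dal q (rt k)) UNIV"
    and "((\<lambda>y. rt (k * y) * be_coeff q y) has_sum be q (rt k)) UNIV"
    and "((\<lambda>y. of_int y * rt (k * y) * be_coeff q y) has_sum nome.dbe q (rt k)) UNIV"
proof -
  interpret nome "csqrt q" q using nome_csqrt[OF q] .
  interpret n3: nome "csqrt q ^ 3" "q ^ 3" by (rule nome_power) simp
  have r: "rt k ^ 3 = rt (3 * k)" using rt_mult[of k 3] by (simp add: mult.commute)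
  show "((\<lambda>x. rt (3 * k * x) * th_coeff (q ^ 3) x) has_sum al (rt k)) UNIV"
    using bil_has_sum[OF rapid_th[OF n3.q], of "rt (3 * k)"] by (simp add: al_def th_def r rt_powi mult.commute)
  show "((\<lambda>x. 3 * of_int x * rt (3 * k * x) * th_coeff (q ^ 3) x) has_sum dal (rt k)) UNIV"
    using has_sum_cmult_right[OF bil_has_sum[OF rapid_weight[OF rapid_th[OF n3.q]], of "rt (3 * k)"], of 3]
    by (simp add: dal_def r rt_powi mult_ac)
  show "((\<lambda>y. rt (k * y) * be_coeff q y) has_sum be q (rt k)) UNIV"
    using be_has_sum[of "rt k"] by (simp add: rt_powi mult.commute)
  show "((\<lambda>y. of_int y * rt (k * y) * be_coeff q y) has_sum dbe (rt k)) UNIV"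
    using bil_has_sum[OF rapid_weight[OF rapid_be[OF local.q]], of "rt k"]
    by (simp add: dbe_def rt_powi mult_ac)
qed

lemma rt_multiple: "11 dvd x \<Longrightarrow> rt (k * x) = 1"
  by (simp add: rt_eq_1_iff)

text \<open>Each product contains a factor that is not differentiated. At multiples of 11 its root
  of unity is 1, so its coefficient is even there, as \<open>sixth_free_binary\<close> requires of
  one factor.\<close>

lemma sixth_free_W:
  "sixth_free (\<lambda>q. nome.W0 q k)" "sixth_free (\<lambda>q. nome.W1 q k)" "sixth_free (\<lambda>q. nome.W2 q k)"
proof -
  have aa: "sixth_free (\<lambda>q. nome.al q (rt i) * be q (rt j))" for i j
    by (rule sixth_free_binary[OF winquist_series(1,3)]) (auto simp: rt_minus rt_multiple)
  have da: "sixth_free (\<lambda>q. nome.dal q (rt i) * be q (rt j))" for i j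
    by (rule sixth_free_binary[OF winquist_series(2,3)]) (auto simp: rt_minus rt_multiple)
  have ad: "sixth_free (\<lambda>q. nome.al q (rt i) * nome.dbe q (rt j))" for i j
    by (rule sixth_free_binary[OF winquist_series(1,4)]) (auto simp: rt_minus rt_multiple)
  have diff: "sixth_free (\<lambda>q. f q + (-1) * g q)" if "sixth_free f" "sixth_free g" for f g
    by (intro sixth_free_add sixth_free_cmult that)
  show "sixth_free (\<lambda>q. nome.W0 q k)"
    by (rule sixth_free_cong[OF diff[OF aa[of "5 * k" "2 * k"] aa[of "2 * k" "5 * k"]]])
       (simp add: nome.W0_def[OF nome_csqrt])
  show "sixth_free (\<lambda>q. nome.W1 q k)"
    by (rule sixth_free_cong[OF diff[OF da[of "5 * k" "2 * k"] ad[of "2 * k" "5 * k"]]])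
       (simp add: nome.W1_def[OF nome_csqrt])
  show "sixth_free (\<lambda>q. nome.W2 q k)"
    by (rule sixth_free_cong[OF diff[OF ad[of "5 * k" "2 * k"] da[of "2 * k" "5 * k"]]])
       (simp add: nome.W2_def[OF nome_csqrt])
qed

section \<open>Products of Euler's product with three theta values\<close>

definition lat :: "(int \<times> int \<times> int \<times> int) set" where
  "lat = {w. w mod 6 = 1} \<times> {x. odd x} \<times> {y. odd y} \<times> {z. odd z}"

definition lat_deg :: "int \<times> int \<times> int \<times> int \<Rightarrow> nat" where
  "lat_deg = (\<lambda>(w, x, y, z). nat ((w\<^sup>2 - 1) div 24) + (nat ((x\<^sup>2 - 1) div 8) + (nat ((y\<^sup>2 - 1) div 8) + nat ((z\<^sup>2 - 1) div 8))))"

lemma lat_deg_shell: "{v. v \<in> lat \<and> lat_deg v = N} = shell (24 * int N + 10)"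
proof -
  have "lat_deg (w, x, y, z) = N \<longleftrightarrow> w\<^sup>2 + 3 * (x\<^sup>2 + y\<^sup>2 + z\<^sup>2) = 24 * int N + 10"
    if "(w, x, y, z) \<in> lat" for w x y z
  proof -
    have o: "w mod 6 = 1" "odd x" "odd y" "odd z" using that by (auto simp: lat_def)
    then have ow: "odd w" "\<not> 3 dvd w" by presburger+
    obtain a where a: "w\<^sup>2 - 1 = 24 * a" "(w\<^sup>2 - 1) div 24 = a" "a \<ge> 0" using odd_mod6_coprime3[OF ow] by metis
    obtain b where b: "x\<^sup>2 - 1 = 8 * b" "(x\<^sup>2 - 1) div 8 = b" "b \<ge> 0" using odd_square_mod8[OF o(2)] by metis
    obtain c where c: "y\<^sup>2 - 1 = 8 * c" "(y\<^sup>2 - 1) div 8 = c" "c \<ge> 0" using odd_square_mod8[OF o(3)] by metis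
    obtain d where d: "z\<^sup>2 - 1 = 8 * d" "(z\<^sup>2 - 1) div 8 = d" "d \<ge> 0" using odd_square_mod8[OF o(4)] by metis
    have "w\<^sup>2 + 3 * (x\<^sup>2 + y\<^sup>2 + z\<^sup>2) = 24 * (a + b + c + d) + 10"
      using a(1) b(1) c(1) d(1) by simp
    moreover have "int (lat_deg (w, x, y, z)) = a + b + c + d"
      using a b c d by (simp add: lat_deg_def)
    ultimately show ?thesis by auto
  qed
  then show ?thesis by (auto simp: lat_def shell_def)
qed

text \<open>Euler's product supplies the variable w through the pentagonal series, the three theta
  values supply x, y and z.\<close>

lemma theta_product_series:
  assumes hq: "0 < norm q" "norm q < 1"
  shows "((\<lambda>v. (case v of (w, x, y, z) \<Rightarrow> of_int (shell_weight v) * rt (a * x + b * y + c * z)) * q ^ lat_deg v) has_sum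
     qpoch q q * (nome.t q a * nome.t q b * nome.t q c)) lat"
proof -
  interpret nome "csqrt q" q using nome_csqrt[OF hq] .
  have th: "((\<lambda>x. of_int (chi4 x) * q ^ nat ((x\<^sup>2 - 1) div 8) * rt (a * x)) has_sum t a) {x. odd x}" for a
  proof -
    have "((\<lambda>x. th_coeff q x * rt a powi x) has_sum t a) UNIV"
      unfolding t_def th_def by (rule bil_has_sum[OF rapid_th[OF q]]) simp
    then have "((\<lambda>x. th_coeff q x * rt a powi x) has_sum t a) {x. odd x}"
      by (rule iffD1[OF has_sum_cong_neutral, rotated -1]) (auto simp: th_coeff_def chi4_even)
    then show ?thesis by (simp add: th_coeff_def rt_powi)
  qed
  have "((\<lambda>(w, v). (of_int (chi4 w) * q ^ nat ((w\<^sup>2 - 1) div 24)) * (case v of (x, v) \<Rightarrow>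
      (of_int (chi4 x) * q ^ nat ((x\<^sup>2 - 1) div 8) * rt (a * x)) * (case v of (y, z) \<Rightarrow>
      (of_int (chi4 y) * q ^ nat ((y\<^sup>2 - 1) div 8) * rt (b * y)) *
      (of_int (chi4 z) * q ^ nat ((z\<^sup>2 - 1) div 8) * rt (c * z))))) has_sum (E * (t a * (t b * t c)))) lat"
    unfolding lat_def
    by (intro has_sum_mult_product pentagonal th has_sum_mult_product[where f = "\<lambda>x. _ x"])
  then show ?thesis
    unfolding mult.assoc
    by (rule has_sum_cong[THEN iffD1, rotated])
       (auto simp: shell_weight_def lat_deg_def power_add rt_add mult_ac)
qed

text \<open>Modulo 11 the last two forms are 3 (x + y - 2 z) and 5 (x + y - 4 z). As 3 and 5 are
  squares, only the signs of z differ from \<open>lin_char\<close>, and replacing z by -z changes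
  the sign of the weight.\<close>

lemma lattice_sum_twisted:
  assumes M: "M mod 11 = 0"
  shows "(\<Sum>(w, x, y, z)\<in>shell M. shell_weight (w, x, y, z) *
     (2 * chi11 (1 * x + 2 * y + 4 * z) + 2 * chi11 (3 * x + 3 * y + 5 * z) + 3 * chi11 (5 * x + 5 * y + 2 * z))) = 0"
proof -
  define T where "T = (\<lambda>F. \<Sum>(w, x, y, z)\<in>shell M. shell_weight (w, x, y, z) * (F x y z :: int))"
  have flip: "T (\<lambda>x y z. F x y (- z)) = - T F" for F
    unfolding T_def sum_negf[symmetric]
    by (rule sum.reindex_bij_witness[of _ "\<lambda>(w, x, y, z). (w, x, y, - z)" "\<lambda>(w, x, y, z). (w, x, y, - z)"])
       (simp_all add: split_paired_all shell_def shell_weight_def chi4_neg)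
  have lin: "T (\<lambda>x y z. a * F x y z + b * G x y z + c * H x y z) = a * T F + b * T G + c * T H" for F G H a b c
    unfolding T_def sum_distrib_left sum.distrib[symmetric] by (rule sum.cong) (auto simp: algebra_simps)
  have c3: "chi11 (3 * x + 3 * y + 5 * z) = chi11 (x + y + 2 * (- z))" for x y z
  proof -
    have "chi11 (3 * x + 3 * y + 5 * z) = chi11 (3 * (x + y + 2 * (- z)) + 11 * z)"
      by (rule arg_cong[of _ _ chi11]) simp
    also have "\<dots> = chi11 (3 * (x + y + 2 * (- z)))"
      by (rule chi11_cong) (simp only: mod_mult_self2)
    finally have "chi11 (3 * x + 3 * y + 5 * z) = chi11 (3 * (x + y + 2 * (- z)))" .
    then show ?thesis unfolding chi11_mult by (simp add: chi11_def)
  qed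
  have c5: "chi11 (5 * x + 5 * y + 2 * z) = chi11 (x + y + 4 * (- z))" for x y z
  proof -
    have "chi11 (5 * x + 5 * y + 2 * z) = chi11 (5 * (x + y + 4 * (- z)) + 11 * (2 * z))"
      by (rule arg_cong[of _ _ chi11]) simp
    also have "\<dots> = chi11 (5 * (x + y + 4 * (- z)))"
      by (rule chi11_cong) (simp only: mod_mult_self2)
    finally have "chi11 (5 * x + 5 * y + 2 * z) = chi11 (5 * (x + y + 4 * (- z)))" .
    then show ?thesis unfolding chi11_mult by (simp add: chi11_def)
  qed
  have "T (\<lambda>x y z. 2 * chi11 (1 * x + 2 * y + 4 * z) + 2 * chi11 (3 * x + 3 * y + 5 * z) + 3 * chi11 (5 * x + 5 * y + 2 * z)) =
      2 * T (\<lambda>x y z. chi11 (x + 2 * y + 4 * z)) + 2 * (- T (\<lambda>x y z. chi11 (x + y + 2 * z))) + 3 * (- T (\<lambda>x y z. chi11 (x + y + 4 * z)))"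
    unfolding lin c3 c5 flip[of "\<lambda>x y z. chi11 (x + y + 2 * z)"] flip[of "\<lambda>x y z. chi11 (x + y + 4 * z)"] by simp
  also have "\<dots> = T lin_char"
    using lin[of 2 "\<lambda>x y z. chi11 (x + 2 * y + 4 * z)" "-2" "\<lambda>x y z. chi11 (x + y + 2 * z)" "-3" "\<lambda>x y z. chi11 (x + y + 4 * z)"]
    by (simp add: lin_char_def[abs_def])
  also have "\<dots> = 0" unfolding T_def by (rule lattice_sum_zero[OF M])
  finally show ?thesis by (simp add: T_def)
qed

text \<open>Summing over k against the character turns each root of unity into the character of its
  exponent times the Gauss sum, so the coefficients become integer lattice sums.\<close>

lemma sixth_free_T3:
  "sixth_free (\<lambda>q. \<Sum>k=1..10. of_int (chi11 (int k)) * (qpoch q q * nome.T3 q (int k)))"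
proof (rule sixth_free_by_degree[where A = lat and e = lat_deg])
  define L where "L = (\<lambda>(w, x, y, z). shell_weight (w, x, y, z) *
     (2 * chi11 (1 * x + 2 * y + 4 * z) + 2 * chi11 (3 * x + 3 * y + 5 * z) + 3 * chi11 (5 * x + 5 * y + 2 * z)))"
  fix q :: complex assume hq: "0 < norm q" "norm q < 1"
  interpret nome "csqrt q" q using nome_csqrt[OF hq] .
  define F where "F = (\<lambda>a b c v. (case v of (w, x, y, z) \<Rightarrow> of_int (shell_weight v) * rt (a * x + b * y + c * z)) * q ^ lat_deg v)"
  have F: "(F a b c has_sum E * (t a * t b * t c)) lat" for a b c
    unfolding F_def by (rule theta_product_series[OF hq])
  have k: "((\<lambda>v. of_int (chi11 (int k)) * (2 * F (int k) (2 * int k) (4 * int k) v + 2 * F (3 * int k) (3 * int k) (5 * int k) v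
       + 3 * F (5 * int k) (5 * int k) (2 * int k) v)) has_sum of_int (chi11 (int k)) * (E * T3 (int k))) lat" for k
  proof -
    have "((\<lambda>v. of_int (chi11 (int k)) * (2 * F (int k) (2 * int k) (4 * int k) v + 2 * F (3 * int k) (3 * int k) (5 * int k) v
       + 3 * F (5 * int k) (5 * int k) (2 * int k) v)) has_sum of_int (chi11 (int k)) *
       (2 * (E * (t (int k) * t (2 * int k) * t (4 * int k))) + 2 * (E * (t (3 * int k) * t (3 * int k) * t (5 * int k)))
        + 3 * (E * (t (5 * int k) * t (5 * int k) * t (2 * int k))))) lat"
      by (intro has_sum_cmult_right has_sum_add F)
    then show ?thesis by (simp add: T3_def distrib_left mult_ac)
  qed
  have "((\<lambda>v. \<Sum>k=1..10. of_int (chi11 (int k)) * (2 * F (int k) (2 * int k) (4 * int k) v + 2 * F (3 * int k) (3 * int k) (5 * int k) v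
       + 3 * F (5 * int k) (5 * int k) (2 * int k) v)) has_sum (\<Sum>k=1..10. of_int (chi11 (int k)) * (E * T3 (int k)))) lat"
    by (intro has_sum_finite_sum k) auto
  moreover have "(\<Sum>k=1..10. of_int (chi11 (int k)) * (2 * F (int k) (2 * int k) (4 * int k) v + 2 * F (3 * int k) (3 * int k) (5 * int k) v
       + 3 * F (5 * int k) (5 * int k) (2 * int k) v)) = gauss * of_int (L v) * q ^ lat_deg v" for v
  proof -
    obtain w x y z where v: "v = (w, x, y, z)" by (cases v) auto
    define u where "u = of_int (shell_weight v) * q ^ lat_deg v"
    have Fe: "F (a * int k) (b * int k) (c * int k) v = u * rt (int k * (a * x + b * y + c * z))" for a b c k
      by (simp add: F_def v u_def algebra_simps)
    have one: "F (int k) b c v = F (1 * int k) b c v" for k b c by simp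
    have "(\<Sum>k=1..10. of_int (chi11 (int k)) * (2 * F (int k) (2 * int k) (4 * int k) v + 2 * F (3 * int k) (3 * int k) (5 * int k) v
       + 3 * F (5 * int k) (5 * int k) (2 * int k) v)) =
      2 * u * (\<Sum>k=1..10. of_int (chi11 (int k)) * rt (int k * (1 * x + 2 * y + 4 * z))) +
      2 * u * (\<Sum>k=1..10. of_int (chi11 (int k)) * rt (int k * (3 * x + 3 * y + 5 * z))) +
      3 * u * (\<Sum>k=1..10. of_int (chi11 (int k)) * rt (int k * (5 * x + 5 * y + 2 * z)))"
      unfolding one Fe sum_distrib_left sum.distrib[symmetric] by (rule sum.cong) (simp_all only: distrib_left mult_ac)
    also have "\<dots> = gauss * of_int (L v) * q ^ lat_deg v"
      unfolding gauss_sum by (simp add: L_def v u_def algebra_simps)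
    finally show ?thesis .
  qed
  ultimately show "((\<lambda>v. (gauss * of_int ((\<lambda>(w, x, y, z). shell_weight (w, x, y, z) *
     (2 * chi11 (1 * x + 2 * y + 4 * z) + 2 * chi11 (3 * x + 3 * y + 5 * z) + 3 * chi11 (5 * x + 5 * y + 2 * z))) v)) * q ^ lat_deg v) has_sum
       (\<Sum>k=1..10. of_int (chi11 (int k)) * (E * T3 (int k)))) lat"
    by (simp add: L_def)
next
  fix n
  show "finite {v \<in> lat. lat_deg v = n}"
    using lat_deg_shell[of n] finite_shell by simp
  have M: "(24 * int (11 * n + 6) + 10) mod 11 = 0" by (simp add: mod_eq_dvd_iff)
  show "(\<Sum>v | v \<in> lat \<and> lat_deg v = 11 * n + 6. gauss * of_int ((\<lambda>(w, x, y, z). shell_weight (w, x, y, z) *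
     (2 * chi11 (1 * x + 2 * y + 4 * z) + 2 * chi11 (3 * x + 3 * y + 5 * z) + 3 * chi11 (5 * x + 5 * y + 2 * z))) v)) = 0"
    unfolding lat_deg_shell sum_distrib_left[symmetric] of_int_sum[symmetric] lattice_sum_twisted[OF M] by simp
qed

section \<open>The crank generating function and its coefficients\<close>

definition crank_weight :: "nat \<Rightarrow> int" where
  "crank_weight n = (\<Sum>\<pi>\<in>partitions n. int (num_ones \<pi>) * residue (crank \<pi>))"

definition crank_weight_gf :: "complex \<Rightarrow> complex" where
  "crank_weight_gf q = (\<Sum>k=1..10. residue_hat (int k) * crank_ones_gf q (rt (2 * int k)))"

lemma crank_weight_series:
  assumes q: "norm q < 1"
  shows "((\<lambda>n. of_int (crank_weight n) * q ^ n) has_sum crank_weight_gf q) UNIV"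
proof -
  have "((\<lambda>\<pi>. \<Sum>k=1..10. residue_hat (int k) * (of_nat (num_ones \<pi>) * rt (2 * int k) powi crank \<pi> * q ^ sum_mset \<pi>)) has_sum crank_weight_gf q) {\<pi>. 0 \<notin># \<pi>}"
    unfolding crank_weight_gf_def by (intro has_sum_finite_sum has_sum_cmult_right crank_ones_has_sum q) auto
  moreover have "(\<Sum>k=1..10. residue_hat (int k) * (of_nat (num_ones \<pi>) * rt (2 * int k) powi crank \<pi> * q ^ sum_mset \<pi>)) =
      of_int (int (num_ones \<pi>) * residue (crank \<pi>)) * q ^ sum_mset \<pi>" for \<pi>
  proof -
    have "(\<Sum>k=1..10. residue_hat (int k) * (of_nat (num_ones \<pi>) * rt (2 * int k) powi crank \<pi> * q ^ sum_mset \<pi>)) =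
       of_nat (num_ones \<pi>) * q ^ sum_mset \<pi> * (\<Sum>k=1..10. residue_hat (int k) * rt (2 * int k * crank \<pi>))"
      unfolding sum_distrib_left rt_powi by (rule sum.cong) (simp_all only: mult_ac)
    then show ?thesis unfolding residue_hat_transform by (simp add: mult_ac)
  qed
  ultimately have s: "((\<lambda>\<pi>. of_int (int (num_ones \<pi>) * residue (crank \<pi>)) * q ^ sum_mset \<pi>) has_sum crank_weight_gf q) {\<pi>. 0 \<notin># \<pi>}"
    by simp
  have P: "{\<pi> \<in> {\<pi>. 0 \<notin># \<pi>}. sum_mset \<pi> = n} = partitions n" for n
  proof -
    have "(\<forall>k\<in>#\<pi>. k > 0) \<longleftrightarrow> 0 \<notin># \<pi>" for \<pi> :: "nat multiset" by (metis gr0I less_irrefl)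
    then show ?thesis by (auto simp: partitions_def)
  qed
  from has_sum_by_degree[OF s] have "((\<lambda>n. (\<Sum>\<pi> | \<pi> \<in> {\<pi>. 0 \<notin># \<pi>} \<and> sum_mset \<pi> = n. of_int (int (num_ones \<pi>) * residue (crank \<pi>))) * q ^ n)
      has_sum crank_weight_gf q) UNIV"
    unfolding P using finite_partitions by blast
  moreover have "(\<Sum>\<pi> | \<pi> \<in> {\<pi>. 0 \<notin># \<pi>} \<and> sum_mset \<pi> = n. of_int (int (num_ones \<pi>) * residue (crank \<pi>)) :: complex) = of_int (crank_weight n)" for n
    using P[of n] by (simp add: crank_weight_def)
  ultimately show ?thesis by simp
qed

context nome
begin

text \<open>Pair k with 11 - k. \<open>residue_hat\<close> is odd and \<open>C\<close> is invariant
  under inversion of z, so the Lambert series at q^2 cancels and the other two form a difference;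
  the factor 1/2 undoes the double counting.\<close>

lemma crank_weight_gf_eq:
  "crank_weight_gf q = - 1 / 2 * (\<Sum>k=1..10. E\<^sup>2 / t (int k) * (lambert q (q / (rt (int k))\<^sup>2) - lambert q (q * (rt (int k))\<^sup>2)))"
proof -
  define C where "C = (\<lambda>z. E / (qpoch q (z * q) * qpoch q (q / z)))"
  have Csym: "C (1 / z) = C z" for z by (simp add: C_def mult_ac)
  have gf: "crank_ones_gf q z = C z * (lambert q (q / z) - lambert q (q * q))" if "norm z = 1" for z
    unfolding crank_ones_gf_def[OF q that] C_def ..
  have "2 * crank_weight_gf q = crank_weight_gf q + (\<Sum>k=1..10. residue_hat (11 - int k) * crank_ones_gf q (rt (2 * (11 - int k))))"
    using sum_reflect11[of "\<lambda>k. residue_hat k * crank_ones_gf q (rt (2 * k))"] by (simp add: crank_weight_gf_def)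
  also have "\<dots> = (\<Sum>k=1..10. residue_hat (int k) * crank_ones_gf q (rt (2 * int k)) + residue_hat (11 - int k) * crank_ones_gf q (rt (2 * (11 - int k))))"
    by (simp add: crank_weight_gf_def sum.distrib)
  also have "\<dots> = (\<Sum>k=1..10. - (E\<^sup>2 / t (int k) * (lambert q (q / (rt (int k))\<^sup>2) - lambert q (q * (rt (int k))\<^sup>2))))"
  proof (rule sum.cong)
    fix k :: nat assume "k \<in> {1..10}"
    then have k: "\<not> 11 dvd int k" using zdvd_not_zless[of "int k" 11] by auto
    define u where "u = rt (int k)"
    have u0: "u \<noteq> 0" by (simp add: u_def)
    have z: "rt (2 * int k) = u\<^sup>2" by (simp add: u_def rt_double power2_eq_square)
    have "rt (2 * (11 - int k)) = rt (- (2 * int k))" by (rule rt_cong) (simp add: mod_eq_dvd_iff)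
    then have z': "rt (2 * (11 - int k)) = 1 / u\<^sup>2" by (simp add: rt_minus z)
    have n: "norm (u\<^sup>2) = 1" "norm (1 / u\<^sup>2) = 1" by (simp_all add: u_def norm_power norm_divide)
    have nz: "u - 1 / u \<noteq> 0" unfolding u_def by (rule rt_minus_inverse_nonzero[OF k])
    have t: "t (int k) = (u - 1 / u) * E * qpoch q (q * u\<^sup>2) * qpoch q (q / u\<^sup>2)"
      unfolding t_def u_def[symmetric] by (rule triple_product[OF q q0 u0])
    have "t (int k) \<noteq> 0" by (rule t_nonzero[OF k])
    then have Cf: "residue_hat (int k) * C (u\<^sup>2) = - (E\<^sup>2 / t (int k))"
      unfolding residue_hat_def C_def u_def[symmetric] t using nz by (simp add: power2_eq_square mult_ac)
    have "residue_hat (int k) * crank_ones_gf q (rt (2 * int k)) + residue_hat (11 - int k) * crank_ones_gf q (rt (2 * (11 - int k))) =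
      residue_hat (int k) * C (u\<^sup>2) * (lambert q (q / u\<^sup>2) - lambert q (q * u\<^sup>2))"
      unfolding z z' gf[OF n(1)] gf[OF n(2)] residue_hat_reflect Csym by (simp add: algebra_simps)
    then show "residue_hat (int k) * crank_ones_gf q (rt (2 * int k)) + residue_hat (11 - int k) * crank_ones_gf q (rt (2 * (11 - int k))) =
      - (E\<^sup>2 / t (int k) * (lambert q (q / (rt (int k))\<^sup>2) - lambert q (q * (rt (int k))\<^sup>2)))"
      unfolding Cf u_def[symmetric] by simp
  qed simp
  finally have "2 * crank_weight_gf q = - (\<Sum>k=1..10. E\<^sup>2 / t (int k) * (lambert q (q / (rt (int k))\<^sup>2) - lambert q (q * (rt (int k))\<^sup>2)))"
    by (simp only: sum_negf)
  moreover have "2 * a = - b \<Longrightarrow> a = - 1 / 2 * b" for a b :: complex by (simp add: field_simps)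
  ultimately show ?thesis by blast
qed

text \<open>The key identity carries \<open>sine_product k\<close>, which is the Legendre symbol of
  k times the constant \<open>sine_product 1\<close>. Multiplying by the constant therefore puts the
  character into the sum over k.\<close>

lemma crank_weight_gf_key:
  "sine_product 1 * qpoch (q ^ 11) (q ^ 11) * crank_weight_gf q = - 1 / 2 * (\<Sum>k=1..10. of_int (chi11 (int k)) *
     (E * T3 (int k) + ((- 2) * W1 (int k) + ((- 3 / 2) * W2 (int k) + ((rt (int k))\<^sup>2 + 1) / ((rt (int k))\<^sup>2 - 1) / 2 * W0 (int k)))))"
proof -
  have "sine_product 1 * qpoch (q ^ 11) (q ^ 11) * (E\<^sup>2 / t (int k) * (lambert q (q / (rt (int k))\<^sup>2) - lambert q (q * (rt (int k))\<^sup>2))) =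
     of_int (chi11 (int k)) * (E * T3 (int k) + ((- 2) * W1 (int k) + ((- 3 / 2) * W2 (int k) + ((rt (int k))\<^sup>2 + 1) / ((rt (int k))\<^sup>2 - 1) / 2 * W0 (int k))))"
    if "k \<in> {1..10}" for k
  proof -
    have k: "\<not> 11 dvd int k" using that zdvd_not_zless[of "int k" 11] by auto
    have "chi11 (int k) * chi11 (int k) = 1"
      using k unfolding chi11_def Let_def by (auto simp: mod_eq_0_iff_dvd)
    then have "(of_int (chi11 (int k)) :: complex) * of_int (chi11 (int k)) = 1"
      by (metis of_int_1 of_int_mult)
    then have "sine_product 1 = of_int (chi11 (int k)) * sine_product (int k)"
      unfolding sine_product_chi[OF k] by (simp add: mult.assoc[symmetric])
    then have "sine_product 1 * qpoch (q ^ 11) (q ^ 11) * (E\<^sup>2 / t (int k) * (lambert q (q / (rt (int k))\<^sup>2) - lambert q (q * (rt (int k))\<^sup>2))) =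
      of_int (chi11 (int k)) * (sine_product (int k) * qpoch (q ^ 11) (q ^ 11) * (E\<^sup>2 / t (int k) * (lambert q (q / (rt (int k))\<^sup>2) - lambert q (q * (rt (int k))\<^sup>2))))"
      by (simp only: mult.assoc)
    then show ?thesis unfolding key_identity[OF k] by (simp add: algebra_simps)
  qed
  then show ?thesis
    unfolding crank_weight_gf_eq by (subst mult.left_commute, subst sum_distrib_left) (simp only: cong: sum.cong)
qed

end

lemma sixth_free_crank_weight_gf: "sixth_free (\<lambda>q. qpoch (q ^ 11) (q ^ 11) * crank_weight_gf q)"
proof -
  define s where "s = (\<lambda>k. ((rt (int k))\<^sup>2 + 1) / ((rt (int k))\<^sup>2 - 1) / 2)"
  have W: "sixth_free (\<lambda>q. \<Sum>k=1..10. of_int (chi11 (int k)) *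
     ((- 2) * nome.W1 q (int k) + ((- 3 / 2) * nome.W2 q (int k) + s k * nome.W0 q (int k))))"
    by (intro sixth_free_sum sixth_free_cmult sixth_free_add sixth_free_W) simp
  have k1: "sine_product 1 \<noteq> 0" by (rule sine_product_nonzero) simp
  show ?thesis
  proof (rule sixth_free_cong[OF sixth_free_cmult[OF sixth_free_add[OF sixth_free_T3 W], of "1 / sine_product 1 * (- 1 / 2)"]])
    fix q :: complex assume hq: "0 < norm q" "norm q < 1"
    interpret nome "csqrt q" q using nome_csqrt[OF hq] .
    define R where "R = (\<Sum>k=1..10. of_int (chi11 (int k)) * (E * T3 (int k))) +
      (\<Sum>k=1..10. of_int (chi11 (int k)) * ((- 2) * W1 (int k) + ((- 3 / 2) * W2 (int k) + s k * W0 (int k))))"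
    have "sine_product 1 * qpoch (q ^ 11) (q ^ 11) * crank_weight_gf q = - 1 / 2 * R"
      unfolding crank_weight_gf_key R_def s_def sum.distrib[symmetric] distrib_left[symmetric] ..
    then have "sine_product 1 * (qpoch (q ^ 11) (q ^ 11) * crank_weight_gf q) = - 1 / 2 * R" by (simp only: mult.assoc)
    then have "qpoch (q ^ 11) (q ^ 11) * crank_weight_gf q = 1 / sine_product 1 * (- 1 / 2) * R"
      using k1 by (simp add: field_simps)
    then show "1 / sine_product 1 * (- 1 / 2) * ((\<Sum>k=1..10. of_int (chi11 (int k)) * (E * T3 (int k))) +
      (\<Sum>k=1..10. of_int (chi11 (int k)) * ((- 2) * W1 (int k) + ((- 3 / 2) * W2 (int k) + s k * W0 (int k))))) =
      qpoch (q ^ 11) (q ^ 11) * crank_weight_gf q" by (simp only: R_def)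
  qed
qed

text \<open>By the pentagonal series (q^11;q^11) is a power series in q^11 with constant term 1. Its
  product with the generating function mixes only coefficients of the same class modulo 11, so it
  can be removed by strong induction.\<close>

lemma crank_weight_zero: "crank_weight (11 * n + 6) = 0"
proof -
  obtain r where r: "\<And>n. r (11 * n + 6) = (0 :: complex)"
    and rs: "\<And>q. 0 < norm q \<Longrightarrow> norm q < 1 \<Longrightarrow> ((\<lambda>n. r n * q ^ n) has_sum qpoch (q ^ 11) (q ^ 11) * crank_weight_gf q) UNIV"
    using sixth_free_crank_weight_gf unfolding sixth_free_def by blast
  define I where "I = {w :: int. w mod 6 = 1} \<times> (UNIV :: nat set)"
  define c where "c = (\<lambda>(w, m). complex_of_int (chi4 w * crank_weight m))"
  define e where "e = (\<lambda>(w :: int, m). 11 * nat ((w\<^sup>2 - 1) div 24) + m)"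
  have w24: "\<exists>a. w\<^sup>2 = 24 * a + 1 \<and> (w\<^sup>2 - 1) div 24 = a \<and> a \<ge> 0" if "w mod 6 = 1" for w :: int
  proof -
    have "odd w" "\<not> 3 dvd w" using that by presburger+
    then obtain a where "w\<^sup>2 - 1 = 24 * a" "(w\<^sup>2 - 1) div 24 = a" "a \<ge> 0" using odd_mod6_coprime3 by metis
    then show ?thesis by (intro exI[of _ a]) auto
  qed
  have fin: "finite {v \<in> I. e v = N}" for N
  proof (rule finite_subset)
    show "{v \<in> I. e v = N} \<subseteq> {w. w\<^sup>2 \<le> 24 * int N + 1} \<times> {..N}"
    proof
      fix v assume "v \<in> {v \<in> I. e v = N}"
      then obtain w m where v: "v = (w, m)" "w mod 6 = 1" "11 * nat ((w\<^sup>2 - 1) div 24) + m = N"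
        by (auto simp: I_def e_def)
      obtain a where "w\<^sup>2 = 24 * a + 1" "(w\<^sup>2 - 1) div 24 = a" "a \<ge> 0" using w24[OF v(2)] by blast
      then show "v \<in> {w. w\<^sup>2 \<le> 24 * int N + 1} \<times> {..N}" using v by auto
    qed
  qed (intro finite_cartesian_product finite_bounded_square finite_atMost)
  have "((\<lambda>N. (\<Sum>v | v \<in> I \<and> e v = N. c v) * q ^ N) has_sum qpoch (q ^ 11) (q ^ 11) * crank_weight_gf q) UNIV"
    if hq: "0 < norm q" "norm q < 1" for q
  proof (rule has_sum_by_degree[OF _ fin])
    interpret nome "csqrt q" q using nome_csqrt[OF hq] .
    interpret n11: nome "csqrt q ^ 11" "q ^ 11" by (rule nome_power) simp
    have "((\<lambda>(w, m). of_int (chi4 w) * (q ^ 11) ^ nat ((w\<^sup>2 - 1) div 24) * (of_int (crank_weight m) * q ^ m)) has_sum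
        (qpoch (q ^ 11) (q ^ 11) * crank_weight_gf q)) I"
      unfolding I_def by (intro has_sum_mult_product n11.pentagonal crank_weight_series q)
    then show "((\<lambda>v. c v * q ^ e v) has_sum qpoch (q ^ 11) (q ^ 11) * crank_weight_gf q) I"
      by (rule has_sum_cong[THEN iffD1, rotated]) (auto simp: c_def e_def power_add power_mult)
  qed
  from power_series_unique[OF this rs] have eq: "(\<Sum>v | v \<in> I \<and> e v = N. c v) = r N" for N by blast
  show ?thesis
  proof (induction n rule: less_induct)
    case (less n)
    let ?N = "11 * n + 6"
    let ?V = "{v. v \<in> I \<and> e v = ?N}"
    \<comment> \<open>The index w = 1 is the constant term of (q^11;q^11); every other w lowers the
      degree left for \<open>m\<close> by a positive multiple of 11.\<close>
    have mem: "(1, ?N) \<in> ?V" by (simp add: I_def e_def)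
    have "c v = 0" if vV: "v \<in> ?V - {(1, ?N)}" for v
    proof -
      obtain w m where v: "v = (w, m)" "w mod 6 = 1" "11 * nat ((w\<^sup>2 - 1) div 24) + m = ?N" "(w, m) \<noteq> (1, ?N)"
        using vV by (cases v) (auto simp: I_def e_def)
      obtain a where a: "w\<^sup>2 = 24 * a + 1" "(w\<^sup>2 - 1) div 24 = a" "a \<ge> 0" using w24[OF v(2)] by blast
      have "a \<noteq> 0"
      proof
        assume "a = 0"
        then have "w = 1 \<or> w = -1" using a(1) by (simp add: power2_eq_1_iff)
        then have "w = 1" using v(2) by auto
        then show False using v a \<open>a = 0\<close> by simp
      qed
      define b where "b = nat a"
      have b: "b > 0" "11 * b + m = ?N" using a v(3) \<open>a \<noteq> 0\<close> by (simp_all add: b_def)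
      then have "b \<le> n" by simp
      then have "m = 11 * (n - b) + 6" "n - b < n" using b by auto
      then show ?thesis using less.IH by (simp add: c_def v)
    qed
    then have "sum c ?V = c (1, ?N)"
      using fin[of ?N] mem by (subst sum.mono_neutral_right[of ?V "{(1, ?N)}"]) auto
    then have "c (1, ?N) = 0" using eq[of ?N] r by simp
    then show ?case by (simp add: c_def chi4_def)
  qed
qed

text \<open>The class of 11 - m has representative -m, so the signed multiples of m are exactly
  \<open>residue\<close>; the class of 0 has weight 0.\<close>

lemma weighted_residue_classes:
  "(\<Sum>m = 1..5::nat. int m * (int (M_omega (int m) 11 N) - int (M_omega (11 - int m) 11 N))) = crank_weight N"
proof -
  have M: "int (M_omega r 11 N) = (\<Sum>\<pi>\<in>partitions N. if crank \<pi> mod 11 = r mod 11 then int (num_ones \<pi>) else 0)" for r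
  proof -
    have "int (M_omega r 11 N) = (\<Sum>\<pi> | \<pi> \<in> partitions N \<and> crank \<pi> mod 11 = r mod 11. int (num_ones \<pi>))"
      by (simp add: M_omega_def Cong.cong_def)
    also have "\<dots> = (\<Sum>\<pi>\<in>partitions N. if crank \<pi> mod 11 = r mod 11 then int (num_ones \<pi>) else 0)"
      using finite_partitions by (intro sum.inter_filter)
    finally show ?thesis .
  qed
  have "(\<Sum>m = 1..5::nat. int m * (int (M_omega (int m) 11 N) - int (M_omega (11 - int m) 11 N))) =
     (\<Sum>\<pi>\<in>partitions N. \<Sum>m = 1..5::nat. int m * ((if crank \<pi> mod 11 = int m mod 11 then int (num_ones \<pi>) else 0)
        - (if crank \<pi> mod 11 = (11 - int m) mod 11 then int (num_ones \<pi>) else 0)))"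
    unfolding M by (subst sum.swap) (simp add: sum_distrib_left sum_subtractf right_diff_distrib)
  also have "\<dots> = (\<Sum>\<pi>\<in>partitions N. int (num_ones \<pi>) * residue (crank \<pi>))"
  proof (rule sum.cong)
    fix \<pi>
    have e: "(\<Sum>m = 1..5::nat. f m) = f 1 + f 2 + f 3 + f 4 + f 5" for f :: "nat \<Rightarrow> int"
      by (simp add: eval_nat_numeral)
    have r: "residue (crank \<pi>) = residue (crank \<pi> mod 11)" by (simp add: residue_def mod_add_left_eq)
    show "(\<Sum>m = 1..5::nat. int m * ((if crank \<pi> mod 11 = int m mod 11 then int (num_ones \<pi>) else 0)
        - (if crank \<pi> mod 11 = (11 - int m) mod 11 then int (num_ones \<pi>) else 0))) = int (num_ones \<pi>) * residue (crank \<pi>)"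
      unfolding e r
      by (rule mod11_cases[of "crank \<pi>"]) (simp_all add: residue_def)
  qed simp
  finally show ?thesis by (simp add: crank_weight_def)
qed

theorem theorem1p1:
  fixes n :: nat
  shows "(\<Sum>m = 1..5::nat. int m *
            (int (M_omega (int m) 11 (11 * n + 6))
             - int (M_omega (11 - int m) 11 (11 * n + 6)))) = 0"
  unfolding weighted_residue_classes by (rule crank_weight_zero)

end
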